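(* Let $X$ be a $(1|1)$-dimensional supercurve over $S$, let $\mathcal U\subset X$ be an open set with coordinates $(z,\theta)$, and let $\mathcal F$ be a $\mathcal D_X|_{\mathcal U}$-module. Then $\tau^{(z,\theta)}=1-\theta\nabla_\theta+\rho(\theta\nabla_z+\nabla_\theta)$ gives an isomorphism of $\mathcal D_{\hat X}|_{\mathcal U}$-modules $$\tau^{(z,\theta)}:\mathcal F^{(z,\theta)}\xrightarrow{\ \sim\ }\hat{\mathcal F}.$$
   Context: Base: $S=\operatorname{Spec}(\Lambda)$, where $\Lambda$ is a fixed supercommutative finite-dimensional nilpotent extension of $\mathbb C$. Everything is relative to $S$; one may work in the Zariski or the complex topology. A $(1|1)$-supercurve is a smooth superscheme $X\to S$ of relative dimension $(1|1)$. A $\mathcal D_Z$-module is a ($\mathbb Z_2$-graded) sheaf of $\mathcal O_Z$-modules with a flat connection $\nabla$, equivalently a sheaf of left modules over the sheaf $\mathcal D_Z$ of differential operators. Dual curve: $\Omega_X$ is the algebra of differential forms, locally $\mathcal O_X[d\theta,dz]$ with $d\theta$ even and $dz$ odd. $\Delta=\operatorname{Proj}(\Omega_X)\xrightarrow{\pi}X$ has the same underlying space as $X$ and local coordinates $(z,\theta,\rho)$, $\rho=d\theta^{-1}dz$ odd. The exterior derivative induces an odd derivation $\tilde d:\mathcal O_\Delta\to\mathcal O_\Delta(1)$, locally $\tilde d=d\theta(\rho\partial_z+\partial_\theta)$. The dual supercurve $\hat X$ has the same underlying space and $\mathcal O_{\hat X}=\ker\tilde d\subset\mathcal O_\Delta$,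 with local coordinates $(u,\rho)$, $u=z-\theta\rho$; the inclusion gives $\hat\pi:\Delta\to\hat X$. Transform: $\hat{\mathcal F}=\hat\pi_+\pi^*(\mathcal F)$, where $\pi^*\mathcal F=\mathcal O_\Delta\otimes_{\mathcal O_X}\mathcal F$ with the pulled-back connection, and $\hat\pi_+(\mathcal G)$ is the subsheaf of $\mathcal G$ killed by $\nabla_v$ for all $v$ tangent to the fibers of $\hat\pi$ (locally these $v$ are generated by $\rho\partial_z+\partial_\theta$), with vector fields on $\hat X$ acting through local lifts to $\Delta$. Local identification: $\Psi^{(z,\theta)}:\mathcal O_X|_{\mathcal U}\to\mathcal O_{\hat X}|_{\mathcal U}$ is the isomorphism with $z\mapsto u$, $\theta\mapsto\rho$; explicitly $\Psi^{(z,\theta)}(h)=h-\theta\partial_\theta h+\rho(\theta\partial_z h+\partial_\theta h)$. It extends to an isomorphism $\mathcal D_X|_{\mathcal U}\to\mathcal D_{\hat X}|_{\mathcal U}$ with $\partial_z\mapsto\partial_u$, $\partial_\theta\mapsto\partial_\rho$, where $\partial_u,\partial_\rho$ are taken in the coordinates $(u,\rho)$ on $\hat X$. $\mathcal F^{(z,\theta)}$ denotes $\mathcal F$ regarded as a $\mathcal D_{\hat X}|_{\mathcal U}$-module through this isomorphism. The operator $\tau^{(z,\theta)}$ acts on $\pi^*\mathcal F$ (with $\nabla_z,\nabla_\theta$ taken in the coordinates $(z,\theta,\rho)$), and is applied here to $\mathcal F\subset\pi^*\mathcal F$. *)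

theory Defs
  imports
    "HOL-Complex_Analysis.Complex_Analysis"
    "HOL-Algebra.Module"
    "HOL-Algebra.Subrings"
    "HOL-Library.FuncSet"
begin

section \<open>Superalgebra\<close>

text \<open>Parities are Booleans: \<open>False\<close> is even, \<open>True\<close> is odd. The sum of the parities \<open>p\<close>, \<open>q\<close> is
  \<open>p \<noteq> q\<close>, and the Koszul sign \<open>(-1)\<^sup>p\<^sup>q\<close> is \<open>sg _ (p \<and> q)\<close>.\<close>

definition sg :: "('b, 'm) ring_scheme \<Rightarrow> bool \<Rightarrow> 'b \<Rightarrow> 'b" where
  "sg R s x = (if s then \<ominus>\<^bsub>R\<^esub> x else x)"

definition graded_group :: "('b, 'm) ring_scheme \<Rightarrow> (bool \<Rightarrow> 'b set) \<Rightarrow> bool" where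
  "graded_group M g \<longleftrightarrow> abelian_group M \<and>
     (\<forall>p. subgroup (g p) (add_monoid M)) \<and>
     (\<forall>x\<in>carrier M. \<exists>!y. fst y \<in> g False \<and> snd y \<in> g True \<and> x = fst y \<oplus>\<^bsub>M\<^esub> snd y)"

definition parity_involution :: "('b, 'm) ring_scheme \<Rightarrow> (bool \<Rightarrow> 'b set) \<Rightarrow> 'b \<Rightarrow> 'b" where
  "parity_involution M g x =
     (THE y. \<exists>a\<in>g False. \<exists>b\<in>g True. x = a \<oplus>\<^bsub>M\<^esub> b \<and> y = a \<ominus>\<^bsub>M\<^esub> b)"

record 'a super_ring = "'a ring" +
  gr :: "bool \<Rightarrow> 'a set"

definition supercommutative_ring :: "('a, 'm) super_ring_scheme \<Rightarrow> bool" where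
  "supercommutative_ring R \<longleftrightarrow> ring R \<and> graded_group R (gr R) \<and> \<one>\<^bsub>R\<^esub> \<in> gr R False \<and>
     (\<forall>p q. \<forall>a\<in>gr R p. \<forall>b\<in>gr R q.
        a \<otimes>\<^bsub>R\<^esub> b \<in> gr R (p \<noteq> q) \<and> a \<otimes>\<^bsub>R\<^esub> b = sg R (p \<and> q) (b \<otimes>\<^bsub>R\<^esub> a))"

definition super_ring_hom ::
  "('a, 'm) super_ring_scheme \<Rightarrow> ('b, 'n) super_ring_scheme \<Rightarrow> ('a \<Rightarrow> 'b) set" where
  "super_ring_hom R S = {h \<in> ring_hom R S. \<forall>p. \<forall>a\<in>gr R p. h a \<in> gr S p}"

text \<open>A left supermodule over a not necessarily commutative ring. The fields \<open>mult\<close> and \<open>one\<close>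
  which the library's module record inherits from rings are not used.\<close>

record ('a, 'b) super_module = "('a, 'b) module" +
  mgr :: "bool \<Rightarrow> 'b set"

definition left_supermodule ::
  "('a, 'm) super_ring_scheme \<Rightarrow> ('a, 'b, 'n) super_module_scheme \<Rightarrow> bool" where
  "left_supermodule R M \<longleftrightarrow> graded_group M (mgr M) \<and>
     (\<forall>a\<in>carrier R. \<forall>x\<in>carrier M. a \<odot>\<^bsub>M\<^esub> x \<in> carrier M) \<and>
     (\<forall>a\<in>carrier R. \<forall>x\<in>carrier M. \<forall>y\<in>carrier M.
        a \<odot>\<^bsub>M\<^esub> (x \<oplus>\<^bsub>M\<^esub> y) = (a \<odot>\<^bsub>M\<^esub> x) \<oplus>\<^bsub>M\<^esub> (a \<odot>\<^bsub>M\<^esub> y)) \<and>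
     (\<forall>a\<in>carrier R. \<forall>b\<in>carrier R. \<forall>x\<in>carrier M.
        (a \<oplus>\<^bsub>R\<^esub> b) \<odot>\<^bsub>M\<^esub> x = (a \<odot>\<^bsub>M\<^esub> x) \<oplus>\<^bsub>M\<^esub> (b \<odot>\<^bsub>M\<^esub> x) \<and>
        (a \<otimes>\<^bsub>R\<^esub> b) \<odot>\<^bsub>M\<^esub> x = a \<odot>\<^bsub>M\<^esub> (b \<odot>\<^bsub>M\<^esub> x)) \<and>
     (\<forall>x\<in>carrier M. \<one>\<^bsub>R\<^esub> \<odot>\<^bsub>M\<^esub> x = x) \<and>
     (\<forall>p q. \<forall>a\<in>gr R p. \<forall>x\<in>mgr M q. a \<odot>\<^bsub>M\<^esub> x \<in> mgr M (p \<noteq> q))"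

record 'l super_calgebra = "'l super_ring" +
  cst :: "complex \<Rightarrow> 'l"

definition lincomb :: "('a, 'm) ring_scheme \<Rightarrow> 'a list \<Rightarrow> 'a list \<Rightarrow> 'a" where
  "lincomb R as es = foldr (\<lambda>x y. x \<oplus>\<^bsub>R\<^esub> y) (map2 (\<lambda>a e. a \<otimes>\<^bsub>R\<^esub> e) as es) \<zero>\<^bsub>R\<^esub>"

definition complex_basis :: "('l, 'm) super_calgebra_scheme \<Rightarrow> 'l list \<Rightarrow> bool" where
  "complex_basis L es \<longleftrightarrow> set es \<subseteq> carrier L \<and>
     (\<forall>x\<in>carrier L. \<exists>!cs. length cs = length es \<and> x = lincomb L (map (cst L) cs) es)"

text \<open>A supercommutative finite-dimensional nilpotent extension of \<open>\<complex>\<close>: a finite-dimensional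
  supercommutative \<open>\<complex>\<close>-algebra \<open>L = \<complex> \<oplus> N\<close> with a nilpotent ideal \<open>N\<close>.\<close>

definition nilpotent_extension :: "('l, 'm) super_calgebra_scheme \<Rightarrow> bool" where
  "nilpotent_extension L \<longleftrightarrow> supercommutative_ring L \<and>
     (\<forall>a. cst L a \<in> gr L False) \<and> cst L 1 = \<one>\<^bsub>L\<^esub> \<and>
     (\<forall>a b. cst L (a + b) = cst L a \<oplus>\<^bsub>L\<^esub> cst L b \<and> cst L (a * b) = cst L a \<otimes>\<^bsub>L\<^esub> cst L b) \<and>
     (\<exists>es. complex_basis L es) \<and>
     (\<exists>N. ideal N L \<and> (\<forall>x\<in>carrier L. \<exists>!a. x \<ominus>\<^bsub>L\<^esub> cst L a \<in> N) \<and>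
        (\<exists>k. \<forall>xs. set xs \<subseteq> N \<and> length xs = k \<longrightarrow> foldr (\<lambda>x y. x \<otimes>\<^bsub>L\<^esub> y) xs \<one>\<^bsub>L\<^esub> = \<zero>\<^bsub>L\<^esub>))"

section \<open>Superspaces\<close>

definition sheaf :: "'x topology \<Rightarrow> ('x set \<Rightarrow> 'b set) \<Rightarrow> ('x set \<Rightarrow> 'x set \<Rightarrow> 'b \<Rightarrow> 'b) \<Rightarrow> bool" where
  "sheaf T C r \<longleftrightarrow>
     (\<forall>V W. openin T V \<and> openin T W \<and> W \<subseteq> V \<longrightarrow> r V W \<in> C V \<rightarrow> C W) \<and>
     (\<forall>V. openin T V \<longrightarrow> (\<forall>a\<in>C V. r V V a = a)) \<and>
     (\<forall>V W Z. openin T V \<and> openin T W \<and> openin T Z \<and> W \<subseteq> V \<and> Z \<subseteq> W \<longrightarrow>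
        (\<forall>a\<in>C V. r W Z (r V W a) = r V Z a)) \<and>
     (\<forall>\<W> s. (\<forall>W\<in>\<W>. openin T W \<and> s W \<in> C W) \<and>
        (\<forall>W\<in>\<W>. \<forall>W'\<in>\<W>. r W (W \<inter> W') (s W) = r W' (W \<inter> W') (s W')) \<longrightarrow>
        (\<exists>!t. t \<in> C (\<Union>\<W>) \<and> (\<forall>W\<in>\<W>. r (\<Union>\<W>) W t = s W)))"

text \<open>A space with a sheaf \<open>sec\<close> of superalgebras over a base superalgebra; \<open>res V W\<close> restricts
  sections from \<open>V\<close> to \<open>W\<close>, and \<open>alg V\<close> is the structure map from the base to the sections over
  \<open>V\<close>.\<close>

record ('x, 'a, 'l) superspace =
  tp :: "'x topology"
  base :: "'l super_calgebra"
  sec :: "'x set \<Rightarrow> 'a super_ring"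
  res :: "'x set \<Rightarrow> 'x set \<Rightarrow> 'a \<Rightarrow> 'a"
  alg :: "'x set \<Rightarrow> 'l \<Rightarrow> 'a"

definition opens :: "('x, 'a, 'l) superspace \<Rightarrow> 'x set \<Rightarrow> 'x set set" where
  "opens Y V = {W. openin (tp Y) W \<and> W \<subseteq> V}"

abbreviation whole :: "('x, 'a, 'l) superspace \<Rightarrow> 'x set" where
  "whole Y \<equiv> topspace (tp Y)"

definition open_subspace :: "('x, 'a, 'l) superspace \<Rightarrow> 'x set \<Rightarrow> ('x, 'a, 'l) superspace" where
  "open_subspace Y U = Y\<lparr>tp := subtopology (tp Y) U\<rparr>"

definition superspace :: "('x, 'a, 'l) superspace \<Rightarrow> bool" where
  "superspace Y \<longleftrightarrow> sheaf (tp Y) (\<lambda>V. carrier (sec Y V)) (res Y) \<and>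
     (\<forall>V\<in>opens Y (whole Y). supercommutative_ring (sec Y V) \<and>
        alg Y V \<in> super_ring_hom (base Y) (sec Y V) \<and>
        (\<forall>W\<in>opens Y V. res Y V W \<in> super_ring_hom (sec Y V) (sec Y W) \<and>
           (\<forall>l\<in>carrier (base Y). res Y V W (alg Y V l) = alg Y W l)))"

section \<open>Supercurves\<close>

text \<open>\<open>subalgebra_sheaf Y V A\<close>: on the open set \<open>V\<close>, \<open>A\<close> is a sheaf of \<open>\<complex>\<close>-subalgebras of the even
  part of the structure sheaf.\<close>

definition subalgebra_sheaf :: "('x, 'a, 'l) superspace \<Rightarrow> 'x set \<Rightarrow> ('x set \<Rightarrow> 'a set) \<Rightarrow> bool" where
  "subalgebra_sheaf Y V A \<longleftrightarrow> sheaf (subtopology (tp Y) V) A (res Y) \<and>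
     (\<forall>W\<in>opens Y V. subring (A W) (sec Y W) \<and> A W \<subseteq> gr (sec Y W) False \<and>
        (\<forall>a. alg Y W (cst (base Y) a) \<in> A W))"

text \<open>\<open>(V, A)\<close> is isomorphic, via a homeomorphism \<open>\<phi>\<close>, to an open subset of \<open>\<complex>\<close> with its sheaf of
  holomorphic functions; \<open>h W\<close> sends a holomorphic function on \<open>\<phi> ` W\<close> to a section of \<open>A\<close> over
  \<open>W\<close>.\<close>

definition analytic_curve :: "('x, 'a, 'l) superspace \<Rightarrow> 'x set \<Rightarrow> ('x set \<Rightarrow> 'a set) \<Rightarrow> bool" where
  "analytic_curve Y V A \<longleftrightarrow>
     (\<exists>(\<phi> :: 'x \<Rightarrow> complex) (h :: 'x set \<Rightarrow> (complex \<Rightarrow> complex) \<Rightarrow> 'a).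
        open (\<phi> ` V) \<and>
        homeomorphic_map (subtopology (tp Y) V) (top_of_set (\<phi> ` V)) \<phi> \<and>
        (\<forall>W\<in>opens Y V.
           h W ` {f. f holomorphic_on \<phi> ` W} = A W \<and>
           (\<forall>a. h W (\<lambda>_. a) = alg Y W (cst (base Y) a)) \<and>
           (\<forall>f g. f holomorphic_on \<phi> ` W \<and> g holomorphic_on \<phi> ` W \<longrightarrow>
              (h W f = h W g \<longleftrightarrow> (\<forall>t\<in>\<phi> ` W. f t = g t)) \<and>
              h W (\<lambda>t. f t + g t) = h W f \<oplus>\<^bsub>sec Y W\<^esub> h W g \<and>
              h W (\<lambda>t. f t * g t) = h W f \<otimes>\<^bsub>sec Y W\<^esub> h W g) \<and>
           (\<forall>W'\<in>opens Y W. \<forall>f. f holomorphic_on \<phi> ` W \<longrightarrow> res Y W W' (h W f) = h W' f)))"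

text \<open>\<open>nonvanishing Y V A f\<close> is the set on which the section \<open>f\<close> of \<open>A\<close> over \<open>V\<close> is locally
  invertible.\<close>

definition nonvanishing ::
  "('x, 'a, 'l) superspace \<Rightarrow> 'x set \<Rightarrow> ('x set \<Rightarrow> 'a set) \<Rightarrow> 'a \<Rightarrow> 'x set" where
  "nonvanishing Y V A f = {x. \<exists>W\<in>opens Y V. x \<in> W \<and>
     (\<exists>g\<in>A W. res Y V W f \<otimes>\<^bsub>sec Y W\<^esub> g = \<one>\<^bsub>sec Y W\<^esub>)}"

text \<open>\<open>(V, A)\<close> is an affine scheme: it is identified with the prime spectrum of \<open>R = A V\<close>
  by sending \<open>x\<close> to the ideal of sections vanishing at \<open>x\<close>. The three conditions say that this map
  is bijective, that the sets \<open>D(f)\<close> form a basis of the topology, and that the sections over \<open>D(f)\<close>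
  are the localization of \<open>R\<close> at \<open>f\<close>.\<close>

definition affine_scheme :: "('x, 'a, 'l) superspace \<Rightarrow> 'x set \<Rightarrow> ('x set \<Rightarrow> 'a set) \<Rightarrow> bool" where
  "affine_scheme Y V A \<longleftrightarrow>
     (let R = (sec Y V)\<lparr>carrier := A V\<rparr>; D = nonvanishing Y V A in
        cring R \<and>
        bij_betw (\<lambda>x. {f \<in> A V. x \<notin> D f}) V {P. primeideal P R} \<and>
        (\<forall>W\<in>opens Y V. \<forall>x\<in>W. \<exists>f\<in>A V. x \<in> D f \<and> D f \<subseteq> W) \<and>
        (\<forall>f\<in>A V.
           (\<forall>b\<in>A (D f). \<exists>(n::nat). \<exists>a\<in>A V.
              res Y V (D f) (f [^]\<^bsub>R\<^esub> n) \<otimes>\<^bsub>sec Y (D f)\<^esub> b = res Y V (D f) a) \<and>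
           (\<forall>a\<in>A V. res Y V (D f) a = \<zero>\<^bsub>sec Y (D f)\<^esub> \<longrightarrow>
              (\<exists>(n::nat). (f [^]\<^bsub>R\<^esub> n) \<otimes>\<^bsub>R\<^esub> a = \<zero>\<^bsub>R\<^esub>))))"

text \<open>\<open>(V, A)\<close> is a smooth irreducible affine algebraic curve over \<open>\<complex>\<close>: the spectrum of a finitely
  generated domain, not a field, whose localization at every nonzero prime \<open>P\<close> has a principal
  maximal ideal, i.e. is a discrete valuation ring.\<close>

definition algebraic_curve :: "('x, 'a, 'l) superspace \<Rightarrow> 'x set \<Rightarrow> ('x set \<Rightarrow> 'a set) \<Rightarrow> bool" where
  "algebraic_curve Y V A \<longleftrightarrow> affine_scheme Y V A \<and>
     (let R = (sec Y V)\<lparr>carrier := A V\<rparr> in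
        domain R \<and> \<not> field R \<and>
        (\<exists>G. finite G \<and> G \<subseteq> A V \<and>
           (\<forall>B. subring B R \<and> range (\<lambda>a. alg Y V (cst (base Y) a)) \<union> G \<subseteq> B \<longrightarrow> B = A V)) \<and>
        (\<forall>P. primeideal P R \<and> P \<noteq> {\<zero>\<^bsub>R\<^esub>} \<longrightarrow>
           (\<exists>t\<in>P. \<forall>a\<in>P. \<exists>s\<in>A V - P. \<exists>b\<in>A V. s \<otimes>\<^bsub>R\<^esub> a = t \<otimes>\<^bsub>R\<^esub> b)))"

text \<open>\<open>split_by Y V A \<xi>\<close>: the structure sheaf on \<open>V\<close> is \<open>A \<otimes>\<^sub>\<complex> \<Lambda>[\<xi>]\<close> with \<open>\<xi>\<close> odd, written out in a
  \<open>\<complex>\<close>-basis of the base \<open>\<Lambda>\<close>.\<close>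

definition split_by :: "('x, 'a, 'l) superspace \<Rightarrow> 'x set \<Rightarrow> ('x set \<Rightarrow> 'a set) \<Rightarrow> 'a \<Rightarrow> bool" where
  "split_by Y V A \<xi> \<longleftrightarrow> \<xi> \<in> gr (sec Y V) True \<and>
     (\<forall>W\<in>opens Y V. \<forall>es. complex_basis (base Y) es \<longrightarrow>
        (\<forall>f\<in>carrier (sec Y W). \<exists>!y. case y of (as, bs) \<Rightarrow>
           length as = length es \<and> length bs = length es \<and> set as \<subseteq> A W \<and> set bs \<subseteq> A W \<and>
           f = lincomb (sec Y W) as (map (alg Y W) es) \<oplus>\<^bsub>sec Y W\<^esub>
               lincomb (sec Y W) bs (map (alg Y W) es) \<otimes>\<^bsub>sec Y W\<^esub> res Y V W \<xi>))"

text \<open>A supercurve of dimension \<open>(1|1)\<close> over \<open>Spec \<Lambda>\<close>: locally the product of \<open>Spec \<Lambda>\<close>, a smooth curve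
  and an odd line. The two alternatives are the complex and the Zariski topology.\<close>

definition supercurve :: "'l super_calgebra \<Rightarrow> ('x, 'a, 'l) superspace \<Rightarrow> bool" where
  "supercurve \<Lambda> X \<longleftrightarrow> base X = \<Lambda> \<and> nilpotent_extension \<Lambda> \<and> superspace X \<and>
     ((\<forall>x\<in>whole X. \<exists>V A \<xi>. openin (tp X) V \<and> x \<in> V \<and>
         subalgebra_sheaf X V A \<and> analytic_curve X V A \<and> split_by X V A \<xi>) \<or>
      (\<forall>x\<in>whole X. \<exists>V A \<xi>. openin (tp X) V \<and> x \<in> V \<and>
         subalgebra_sheaf X V A \<and> algebraic_curve X V A \<and> split_by X V A \<xi>))"

section \<open>Vector fields and coordinates\<close>

text \<open>\<open>vf Y V p\<close>: the parity-\<open>p\<close> sections over \<open>V\<close> of the relative tangent sheaf, i.e. the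
  base-linear superderivations of the structure sheaf restricted to \<open>V\<close>. Such a derivation is a
  family of maps indexed by the open subsets of \<open>V\<close>. Base-linearity follows from the Leibniz rule
  and the vanishing on the base. The families are extensional, so that equal derivations are
  equal as functions.\<close>

definition vf :: "('x, 'a, 'l) superspace \<Rightarrow> 'x set \<Rightarrow> bool \<Rightarrow> ('x set \<Rightarrow> 'a \<Rightarrow> 'a) set" where
  "vf Y V p = {v \<in> (\<Pi>\<^sub>E W\<in>opens Y V. carrier (sec Y W) \<rightarrow>\<^sub>E carrier (sec Y W)).
     \<forall>W\<in>opens Y V.
       (\<forall>q. \<forall>a\<in>gr (sec Y W) q. v W a \<in> gr (sec Y W) (p \<noteq> q)) \<and>
       (\<forall>a\<in>carrier (sec Y W). \<forall>b\<in>carrier (sec Y W).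
          v W (a \<oplus>\<^bsub>sec Y W\<^esub> b) = v W a \<oplus>\<^bsub>sec Y W\<^esub> v W b) \<and>
       (\<forall>q. \<forall>a\<in>gr (sec Y W) q. \<forall>b\<in>carrier (sec Y W).
          v W (a \<otimes>\<^bsub>sec Y W\<^esub> b) =
            (v W a \<otimes>\<^bsub>sec Y W\<^esub> b) \<oplus>\<^bsub>sec Y W\<^esub> sg (sec Y W) (p \<and> q) (a \<otimes>\<^bsub>sec Y W\<^esub> v W b)) \<and>
       (\<forall>l\<in>carrier (base Y). v W (alg Y W l) = \<zero>\<^bsub>sec Y W\<^esub>) \<and>
       (\<forall>W'\<in>opens Y W. \<forall>a\<in>carrier (sec Y W). res Y W W' (v W a) = v W' (res Y W W' a))}"

definition vf_res ::
  "('x, 'a, 'l) superspace \<Rightarrow> 'x set \<Rightarrow> ('x set \<Rightarrow> 'a \<Rightarrow> 'a) \<Rightarrow> 'x set \<Rightarrow> 'a \<Rightarrow> 'a" where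
  "vf_res Y W v = (\<lambda>W'\<in>opens Y W. v W')"

definition vf_add :: "('x, 'a, 'l) superspace \<Rightarrow> 'x set \<Rightarrow>
    ('x set \<Rightarrow> 'a \<Rightarrow> 'a) \<Rightarrow> ('x set \<Rightarrow> 'a \<Rightarrow> 'a) \<Rightarrow> 'x set \<Rightarrow> 'a \<Rightarrow> 'a" where
  "vf_add Y V v w = (\<lambda>W\<in>opens Y V. \<lambda>a\<in>carrier (sec Y W). v W a \<oplus>\<^bsub>sec Y W\<^esub> w W a)"

definition vf_smult ::
  "('x, 'a, 'l) superspace \<Rightarrow> 'x set \<Rightarrow> 'a \<Rightarrow> ('x set \<Rightarrow> 'a \<Rightarrow> 'a) \<Rightarrow> 'x set \<Rightarrow> 'a \<Rightarrow> 'a" where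
  "vf_smult Y V f v =
     (\<lambda>W\<in>opens Y V. \<lambda>a\<in>carrier (sec Y W). res Y V W f \<otimes>\<^bsub>sec Y W\<^esub> v W a)"

definition vf_bracket :: "('x, 'a, 'l) superspace \<Rightarrow> 'x set \<Rightarrow> bool \<Rightarrow> bool \<Rightarrow>
    ('x set \<Rightarrow> 'a \<Rightarrow> 'a) \<Rightarrow> ('x set \<Rightarrow> 'a \<Rightarrow> 'a) \<Rightarrow> 'x set \<Rightarrow> 'a \<Rightarrow> 'a" where
  "vf_bracket Y V p q v w = (\<lambda>W\<in>opens Y V. \<lambda>a\<in>carrier (sec Y W).
     v W (w W a) \<ominus>\<^bsub>sec Y W\<^esub> sg (sec Y W) (p \<and> q) (w W (v W a)))"

text \<open>\<open>(z, \<theta>)\<close> are coordinates on \<open>Y\<close> iff \<open>dz\<close>, \<open>d\<theta>\<close> form a frame of the cotangent sheaf, that is,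
  iff \<open>v \<mapsto> (v z, v \<theta>)\<close> is an isomorphism from the tangent sheaf onto the free module of rank
  \<open>(1|1)\<close>.\<close>

definition coordinates :: "('x, 'a, 'l) superspace \<Rightarrow> 'a \<Rightarrow> 'a \<Rightarrow> bool" where
  "coordinates Y z \<theta> \<longleftrightarrow> z \<in> gr (sec Y (whole Y)) False \<and> \<theta> \<in> gr (sec Y (whole Y)) True \<and>
     (\<forall>V\<in>opens Y (whole Y). \<forall>p.
        bij_betw (\<lambda>v. (v V (res Y (whole Y) V z), v V (res Y (whole Y) V \<theta>)))
          (vf Y V p) (gr (sec Y V) p \<times> gr (sec Y V) (\<not> p)))"

definition partial_z :: "('x, 'a, 'l) superspace \<Rightarrow> 'a \<Rightarrow> 'a \<Rightarrow> 'x set \<Rightarrow> 'x set \<Rightarrow> 'a \<Rightarrow> 'a" where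
  "partial_z Y z \<theta> V = (THE v. v \<in> vf Y V False \<and>
     v V (res Y (whole Y) V z) = \<one>\<^bsub>sec Y V\<^esub> \<and> v V (res Y (whole Y) V \<theta>) = \<zero>\<^bsub>sec Y V\<^esub>)"

definition partial_\<theta> :: "('x, 'a, 'l) superspace \<Rightarrow> 'a \<Rightarrow> 'a \<Rightarrow> 'x set \<Rightarrow> 'x set \<Rightarrow> 'a \<Rightarrow> 'a" where
  "partial_\<theta> Y z \<theta> V = (THE v. v \<in> vf Y V True \<and>
     v V (res Y (whole Y) V z) = \<zero>\<^bsub>sec Y V\<^esub> \<and> v V (res Y (whole Y) V \<theta>) = \<one>\<^bsub>sec Y V\<^esub>)"

section \<open>D-modules\<close>

text \<open>A graded sheaf of modules with a flat connection. The connection is given by its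
  contractions \<open>conn V v\<close> with the homogeneous vector fields \<open>v\<close> over \<open>V\<close>.\<close>

record ('x, 'a, 'b) dmod =
  msec :: "'x set \<Rightarrow> ('a, 'b) super_module"
  mres :: "'x set \<Rightarrow> 'x set \<Rightarrow> 'b \<Rightarrow> 'b"
  conn :: "'x set \<Rightarrow> ('x set \<Rightarrow> 'a \<Rightarrow> 'a) \<Rightarrow> 'b \<Rightarrow> 'b"

definition module_sheaf :: "('x, 'a, 'l) superspace \<Rightarrow> ('x, 'a, 'b) dmod \<Rightarrow> bool" where
  "module_sheaf Y M \<longleftrightarrow> sheaf (tp Y) (\<lambda>V. carrier (msec M V)) (mres M) \<and>
     (\<forall>V\<in>opens Y (whole Y). left_supermodule (sec Y V) (msec M V) \<and>
        (\<forall>W\<in>opens Y V.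
           (\<forall>p. \<forall>m\<in>mgr (msec M V) p. mres M V W m \<in> mgr (msec M W) p) \<and>
           (\<forall>m\<in>carrier (msec M V). \<forall>n\<in>carrier (msec M V).
              mres M V W (m \<oplus>\<^bsub>msec M V\<^esub> n) = mres M V W m \<oplus>\<^bsub>msec M W\<^esub> mres M V W n) \<and>
           (\<forall>f\<in>carrier (sec Y V). \<forall>m\<in>carrier (msec M V).
              mres M V W (f \<odot>\<^bsub>msec M V\<^esub> m) = res Y V W f \<odot>\<^bsub>msec M W\<^esub> mres M V W m)))"

definition connection :: "('x, 'a, 'l) superspace \<Rightarrow> ('x, 'a, 'b) dmod \<Rightarrow> bool" where
  "connection Y M \<longleftrightarrow> (\<forall>V\<in>opens Y (whole Y). \<forall>p. \<forall>v\<in>vf Y V p.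
     (\<forall>m\<in>carrier (msec M V). conn M V v m \<in> carrier (msec M V)) \<and>
     (\<forall>q. \<forall>m\<in>mgr (msec M V) q. conn M V v m \<in> mgr (msec M V) (p \<noteq> q)) \<and>
     (\<forall>m\<in>carrier (msec M V). \<forall>n\<in>carrier (msec M V).
        conn M V v (m \<oplus>\<^bsub>msec M V\<^esub> n) = conn M V v m \<oplus>\<^bsub>msec M V\<^esub> conn M V v n) \<and>
     (\<forall>q. \<forall>f\<in>gr (sec Y V) q. \<forall>m\<in>carrier (msec M V).
        conn M V v (f \<odot>\<^bsub>msec M V\<^esub> m) =
          (v V f \<odot>\<^bsub>msec M V\<^esub> m) \<oplus>\<^bsub>msec M V\<^esub>
          sg (msec M V) (p \<and> q) (f \<odot>\<^bsub>msec M V\<^esub> conn M V v m)) \<and>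
     (\<forall>w\<in>vf Y V p. \<forall>m\<in>carrier (msec M V).
        conn M V (vf_add Y V v w) m = conn M V v m \<oplus>\<^bsub>msec M V\<^esub> conn M V w m) \<and>
     (\<forall>q. \<forall>f\<in>gr (sec Y V) q. \<forall>m\<in>carrier (msec M V).
        conn M V (vf_smult Y V f v) m = f \<odot>\<^bsub>msec M V\<^esub> conn M V v m) \<and>
     (\<forall>W\<in>opens Y V. \<forall>m\<in>carrier (msec M V).
        mres M V W (conn M V v m) = conn M W (vf_res Y W v) (mres M V W m)))"

definition flat :: "('x, 'a, 'l) superspace \<Rightarrow> ('x, 'a, 'b) dmod \<Rightarrow> bool" where
  "flat Y M \<longleftrightarrow> (\<forall>V\<in>opens Y (whole Y). \<forall>p q. \<forall>v\<in>vf Y V p. \<forall>w\<in>vf Y V q.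
     \<forall>m\<in>carrier (msec M V).
       conn M V v (conn M V w m) \<ominus>\<^bsub>msec M V\<^esub> sg (msec M V) (p \<and> q) (conn M V w (conn M V v m)) =
       conn M V (vf_bracket Y V p q v w) m)"

definition dmodule :: "('x, 'a, 'l) superspace \<Rightarrow> ('x, 'a, 'b) dmod \<Rightarrow> bool" where
  "dmodule Y M \<longleftrightarrow> module_sheaf Y M \<and> connection Y M \<and> flat Y M"

definition dmodule_iso :: "('x, 'a, 'l) superspace \<Rightarrow> ('x, 'a, 'b) dmod \<Rightarrow> ('x, 'a, 'c) dmod \<Rightarrow>
    ('x set \<Rightarrow> 'b \<Rightarrow> 'c) \<Rightarrow> bool" where
  "dmodule_iso Y M N \<phi> \<longleftrightarrow> dmodule Y M \<and> dmodule Y N \<and>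
     (\<forall>V\<in>opens Y (whole Y).
        bij_betw (\<phi> V) (carrier (msec M V)) (carrier (msec N V)) \<and>
        (\<forall>p. \<forall>m\<in>mgr (msec M V) p. \<phi> V m \<in> mgr (msec N V) p) \<and>
        (\<forall>m\<in>carrier (msec M V). \<forall>n\<in>carrier (msec M V).
           \<phi> V (m \<oplus>\<^bsub>msec M V\<^esub> n) = \<phi> V m \<oplus>\<^bsub>msec N V\<^esub> \<phi> V n) \<and>
        (\<forall>f\<in>carrier (sec Y V). \<forall>m\<in>carrier (msec M V).
           \<phi> V (f \<odot>\<^bsub>msec M V\<^esub> m) = f \<odot>\<^bsub>msec N V\<^esub> \<phi> V m) \<and>
        (\<forall>p. \<forall>v\<in>vf Y V p. \<forall>m\<in>carrier (msec M V).
           \<phi> V (conn M V v m) = conn N V v (\<phi> V m)) \<and>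
        (\<forall>W\<in>opens Y V. \<forall>m\<in>carrier (msec M V). mres N V W (\<phi> V m) = \<phi> W (mres M V W m)))"

section \<open>The space \<open>\<Delta>\<close> and the dual curve\<close>

text \<open>From here on \<open>Y\<close> is a coordinate patch with coordinates \<open>(z, \<theta>)\<close>. The algebra of differential
  forms is \<open>\<O>[d\<theta>, dz]\<close> with \<open>d\<theta>\<close> even and \<open>dz\<close> odd, so \<open>dz\<close> is nilpotent and \<open>Proj\<close> is the locus
  where \<open>d\<theta>\<close> is invertible. Its functions are the fractions \<open>\<omega>/d\<theta>\<^sup>n\<close> with \<open>\<omega>\<close> of degree \<open>n\<close>, and as
  \<open>\<omega> = d\<theta>\<^sup>n f + d\<theta>\<^sup>n\<^sup>-\<^sup>1 dz g\<close> these are \<open>f + \<rho> g\<close> with \<open>\<rho> = d\<theta>\<^sup>-\<^sup>1 dz\<close>. The pair \<open>(f, g)\<close> stands for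
  \<open>f + \<rho> g\<close>. As \<open>\<rho>\<close> is odd, \<open>(f + \<rho> g)(f' + \<rho> g') = f f' + \<rho> (f\<^sup>* g' + g f')\<close>, where \<open>f\<^sup>*\<close> is the image
  of \<open>f\<close> under the parity involution.\<close>

definition Delta_sec :: "'a super_ring \<Rightarrow> ('a \<times> 'a) super_ring" where
  "Delta_sec R = \<lparr>
     carrier = carrier R \<times> carrier R,
     mult = (\<lambda>(f, g) (f', g').
       (f \<otimes>\<^bsub>R\<^esub> f', (parity_involution R (gr R) f \<otimes>\<^bsub>R\<^esub> g') \<oplus>\<^bsub>R\<^esub> (g \<otimes>\<^bsub>R\<^esub> f'))),
     one = (\<one>\<^bsub>R\<^esub>, \<zero>\<^bsub>R\<^esub>),
     zero = (\<zero>\<^bsub>R\<^esub>, \<zero>\<^bsub>R\<^esub>),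
     add = (\<lambda>(f, g) (f', g'). (f \<oplus>\<^bsub>R\<^esub> f', g \<oplus>\<^bsub>R\<^esub> g')),
     gr = (\<lambda>p. gr R p \<times> gr R (\<not> p))\<rparr>"

definition Delta :: "('x, 'a, 'l) superspace \<Rightarrow> ('x, 'a \<times> 'a, 'l) superspace" where
  "Delta Y = \<lparr>
     tp = tp Y,
     base = base Y,
     sec = (\<lambda>V. Delta_sec (sec Y V)),
     res = (\<lambda>V W. map_prod (res Y V W) (res Y V W)),
     alg = (\<lambda>V l. (alg Y V l, \<zero>\<^bsub>sec Y V\<^esub>))\<rparr>"

definition rho :: "('x, 'a, 'l) superspace \<Rightarrow> 'x set \<Rightarrow> 'a \<times> 'a" where
  "rho Y V = (\<zero>\<^bsub>sec Y V\<^esub>, \<one>\<^bsub>sec Y V\<^esub>)"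

definition pull :: "('x, 'a, 'l) superspace \<Rightarrow> 'x set \<Rightarrow> 'a \<Rightarrow> 'a \<times> 'a" where
  "pull Y V f = (f, \<zero>\<^bsub>sec Y V\<^esub>)"

text \<open>Extension of an even, respectively odd, operator \<open>D\<close> to an operator which supercommutes with
  multiplication by \<open>\<rho>\<close>.\<close>

definition even_ext :: "('b \<Rightarrow> 'b) \<Rightarrow> 'b \<times> 'b \<Rightarrow> 'b \<times> 'b" where
  "even_ext D = (\<lambda>(m, n). (D m, D n))"

definition odd_ext :: "('b, 'm) ring_scheme \<Rightarrow> ('b \<Rightarrow> 'b) \<Rightarrow> 'b \<times> 'b \<Rightarrow> 'b \<times> 'b" where
  "odd_ext M D = (\<lambda>(m, n). (D m, \<ominus>\<^bsub>M\<^esub> D n))"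

text \<open>The map \<open>d\<theta>\<^sup>-\<^sup>1 d~ = \<rho> \<partial>\<^sub>z + \<partial>\<^sub>\<theta>\<close>, in the coordinates \<open>(z, \<theta>, \<rho>)\<close>. As \<open>d\<theta>\<close> trivializes
  \<open>\<O>\<^sub>\<Delta>(1)\<close>, its kernel is that of \<open>d~\<close>.\<close>

definition d_tilde :: "('x, 'a, 'l) superspace \<Rightarrow> 'a \<Rightarrow> 'a \<Rightarrow> 'x set \<Rightarrow> 'a \<times> 'a \<Rightarrow> 'a \<times> 'a" where
  "d_tilde Y z \<theta> V s =
     (rho Y V \<otimes>\<^bsub>sec (Delta Y) V\<^esub> even_ext (partial_z Y z \<theta> V V) s) \<oplus>\<^bsub>sec (Delta Y) V\<^esub>
     odd_ext (sec Y V) (partial_\<theta> Y z \<theta> V V) s"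

definition dual_sections :: "('x, 'a, 'l) superspace \<Rightarrow> 'a \<Rightarrow> 'a \<Rightarrow> 'x set \<Rightarrow> ('a \<times> 'a) set" where
  "dual_sections Y z \<theta> V =
     {s \<in> carrier (sec (Delta Y) V). d_tilde Y z \<theta> V s = \<zero>\<^bsub>sec (Delta Y) V\<^esub>}"

definition dual_curve :: "('x, 'a, 'l) superspace \<Rightarrow> 'a \<Rightarrow> 'a \<Rightarrow> ('x, 'a \<times> 'a, 'l) superspace" where
  "dual_curve Y z \<theta> = (Delta Y)\<lparr>sec := (\<lambda>V. (sec (Delta Y) V)\<lparr>
     carrier := dual_sections Y z \<theta> V,
     gr := (\<lambda>p. gr (sec (Delta Y) V) p \<inter> dual_sections Y z \<theta> V)\<rparr>)\<rparr>"

definition u_coord :: "('x, 'a, 'l) superspace \<Rightarrow> 'a \<Rightarrow> 'a \<Rightarrow> 'x set \<Rightarrow> 'a \<times> 'a" where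
  "u_coord Y z \<theta> V = pull Y V (res Y (whole Y) V z) \<ominus>\<^bsub>sec (Delta Y) V\<^esub>
     (pull Y V (res Y (whole Y) V \<theta>) \<otimes>\<^bsub>sec (Delta Y) V\<^esub> rho Y V)"

definition Psi :: "('x, 'a, 'l) superspace \<Rightarrow> 'a \<Rightarrow> 'a \<Rightarrow> 'x set \<Rightarrow> 'a \<Rightarrow> 'a \<times> 'a" where
  "Psi Y z \<theta> V h =
     (let R = sec (Delta Y) V; t = pull Y V (res Y (whole Y) V \<theta>);
          h_z = pull Y V (partial_z Y z \<theta> V V h); h_\<theta> = pull Y V (partial_\<theta> Y z \<theta> V V h)
      in (pull Y V h \<ominus>\<^bsub>R\<^esub> (t \<otimes>\<^bsub>R\<^esub> h_\<theta>)) \<oplus>\<^bsub>R\<^esub> (rho Y V \<otimes>\<^bsub>R\<^esub> ((t \<otimes>\<^bsub>R\<^esub> h_z) \<oplus>\<^bsub>R\<^esub> h_\<theta>)))"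

section \<open>The transform\<close>

text \<open>The module of sections of \<open>\<pi>\<^sup>*\<F> = \<O>\<^sub>\<Delta> \<otimes> \<F>\<close>: as \<open>\<O>\<^sub>\<Delta>\<close> is free over \<open>\<O>\<close> on \<open>1\<close>, \<open>\<rho>\<close>, the pair
  \<open>(m, n)\<close> stands for \<open>1 \<otimes> m + \<rho> \<otimes> n\<close>.\<close>

definition pullback_sec ::
  "'a super_ring \<Rightarrow> ('a, 'b) super_module \<Rightarrow> ('a \<times> 'a, 'b \<times> 'b) super_module" where
  "pullback_sec R M = \<lparr>
     carrier = carrier M \<times> carrier M,
     mult = (\<lambda>(m, n) (m', n'). (m \<otimes>\<^bsub>M\<^esub> m', n \<otimes>\<^bsub>M\<^esub> n')),
     one = (\<one>\<^bsub>M\<^esub>, \<one>\<^bsub>M\<^esub>),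
     zero = (\<zero>\<^bsub>M\<^esub>, \<zero>\<^bsub>M\<^esub>),
     add = (\<lambda>(m, n) (m', n'). (m \<oplus>\<^bsub>M\<^esub> m', n \<oplus>\<^bsub>M\<^esub> n')),
     smult = (\<lambda>(f, g) (m, n).
       (f \<odot>\<^bsub>M\<^esub> m, (parity_involution R (gr R) f \<odot>\<^bsub>M\<^esub> n) \<oplus>\<^bsub>M\<^esub> (g \<odot>\<^bsub>M\<^esub> m))),
     mgr = (\<lambda>p. mgr M p \<times> mgr M (\<not> p))\<rparr>"

definition nabla_z :: "('x, 'a, 'l) superspace \<Rightarrow> 'a \<Rightarrow> 'a \<Rightarrow> ('x, 'a, 'b) dmod \<Rightarrow>
    'x set \<Rightarrow> 'b \<times> 'b \<Rightarrow> 'b \<times> 'b" where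
  "nabla_z Y z \<theta> F V = even_ext (conn F V (partial_z Y z \<theta> V))"

definition nabla_\<theta> :: "('x, 'a, 'l) superspace \<Rightarrow> 'a \<Rightarrow> 'a \<Rightarrow> ('x, 'a, 'b) dmod \<Rightarrow>
    'x set \<Rightarrow> 'b \<times> 'b \<Rightarrow> 'b \<times> 'b" where
  "nabla_\<theta> Y z \<theta> F V = odd_ext (msec F V) (conn F V (partial_\<theta> Y z \<theta> V))"

definition nabla_\<rho> :: "('x, 'a, 'b) dmod \<Rightarrow> 'x set \<Rightarrow> 'b \<times> 'b \<Rightarrow> 'b \<times> 'b" where
  "nabla_\<rho> F V = (\<lambda>(m, n). (n, \<zero>\<^bsub>msec F V\<^esub>))"

text \<open>The pulled-back connection in the coordinates \<open>(z, \<theta>, \<rho>)\<close>,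
  \<open>\<nabla>\<^sub>w = w(z) \<nabla>\<^sub>z + w(\<theta>) \<nabla>\<^sub>\<theta> + w(\<rho>) \<nabla>\<^sub>\<rho>\<close>.\<close>

definition pullback :: "('x, 'a, 'l) superspace \<Rightarrow> 'a \<Rightarrow> 'a \<Rightarrow> ('x, 'a, 'b) dmod \<Rightarrow>
    ('x, 'a \<times> 'a, 'b \<times> 'b) dmod" where
  "pullback Y z \<theta> F = \<lparr>
     msec = (\<lambda>V. pullback_sec (sec Y V) (msec F V)),
     mres = (\<lambda>V W. map_prod (mres F V W) (mres F V W)),
     conn = (\<lambda>V w s. let M = pullback_sec (sec Y V) (msec F V) in
       (w V (pull Y V (res Y (whole Y) V z)) \<odot>\<^bsub>M\<^esub> nabla_z Y z \<theta> F V s) \<oplus>\<^bsub>M\<^esub>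
       (w V (pull Y V (res Y (whole Y) V \<theta>)) \<odot>\<^bsub>M\<^esub> nabla_\<theta> Y z \<theta> F V s) \<oplus>\<^bsub>M\<^esub>
       (w V (rho Y V) \<odot>\<^bsub>M\<^esub> nabla_\<rho> F V s))\<rparr>"

text \<open>Vector fields on \<open>\<Delta>\<close> tangent to the fibers of \<open>\<Delta> \<rightarrow> X^\<close>: those annihilating the functions
  pulled back from \<open>X^\<close>.\<close>

definition vertical ::
  "('x, 'a, 'l) superspace \<Rightarrow> 'a \<Rightarrow> 'a \<Rightarrow> 'x set \<Rightarrow> bool \<Rightarrow> ('x set \<Rightarrow> 'a \<times> 'a \<Rightarrow> 'a \<times> 'a) set" where
  "vertical Y z \<theta> V p = {v \<in> vf (Delta Y) V p.
     \<forall>W\<in>opens Y V. \<forall>s\<in>dual_sections Y z \<theta> W. v W s = \<zero>\<^bsub>sec (Delta Y) W\<^esub>}"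

text \<open>\<open>lifts Y z \<theta> W p w\<close>: the parity-\<open>p\<close> vector fields on \<open>\<Delta>\<close> over \<open>W\<close> which lift the vector field
  \<open>w\<close> on \<open>X^\<close>.\<close>

definition lifts :: "('x, 'a, 'l) superspace \<Rightarrow> 'a \<Rightarrow> 'a \<Rightarrow> 'x set \<Rightarrow> bool \<Rightarrow>
    ('x set \<Rightarrow> 'a \<times> 'a \<Rightarrow> 'a \<times> 'a) \<Rightarrow> ('x set \<Rightarrow> 'a \<times> 'a \<Rightarrow> 'a \<times> 'a) set" where
  "lifts Y z \<theta> W p w = {v \<in> vf (Delta Y) W p.
     \<forall>W'\<in>opens Y W. \<forall>s\<in>dual_sections Y z \<theta> W'. v W' s = w W' s}"

definition transform_sections :: "('x, 'a, 'l) superspace \<Rightarrow> 'a \<Rightarrow> 'a \<Rightarrow> ('x, 'a, 'b) dmod \<Rightarrow>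
    'x set \<Rightarrow> ('b \<times> 'b) set" where
  "transform_sections Y z \<theta> F V = {s \<in> carrier (msec (pullback Y z \<theta> F) V).
     \<forall>W\<in>opens Y V. \<forall>p. \<forall>v\<in>vertical Y z \<theta> W p.
       conn (pullback Y z \<theta> F) W v (mres (pullback Y z \<theta> F) V W s) =
       \<zero>\<^bsub>msec (pullback Y z \<theta> F) W\<^esub>}"

text \<open>The transform of \<open>\<F>\<close>. For a vector field \<open>w\<close> on \<open>X^\<close>, \<open>\<nabla>\<^sub>w s\<close> is the section which coincides
  with \<open>\<nabla>\<^sub>v s\<close> wherever \<open>v\<close> is a local lift of \<open>w\<close>.\<close>

definition transform :: "('x, 'a, 'l) superspace \<Rightarrow> 'a \<Rightarrow> 'a \<Rightarrow> ('x, 'a, 'b) dmod \<Rightarrow>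
    ('x, 'a \<times> 'a, 'b \<times> 'b) dmod" where
  "transform Y z \<theta> F =
     (let P = pullback Y z \<theta> F; C = transform_sections Y z \<theta> F in \<lparr>
       msec = (\<lambda>V. (msec P V)\<lparr>carrier := C V, mgr := (\<lambda>p. mgr (msec P V) p \<inter> C V)\<rparr>),
       mres = mres P,
       conn = (\<lambda>V w s. THE t. t \<in> carrier (msec P V) \<and>
         (\<forall>W\<in>opens Y V. \<forall>p. \<forall>v\<in>lifts Y z \<theta> W p w.
            mres P V W t = conn P W v (mres P V W s)))\<rparr>)"

text \<open>\<open>\<F>\<close> as a D-module on \<open>X^\<close> through \<open>\<Psi>\<close> and \<open>\<partial>\<^sub>z \<mapsto> \<partial>\<^sub>u\<close>, \<open>\<partial>\<^sub>\<theta> \<mapsto> \<partial>\<^sub>\<rho>\<close>: a vector field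
  \<open>w = w(u) \<partial>\<^sub>u + w(\<rho>) \<partial>\<^sub>\<rho>\<close> on \<open>X^\<close> acts as \<open>\<Psi>\<^sup>-\<^sup>1(w(u)) \<nabla>\<^sub>z + \<Psi>\<^sup>-\<^sup>1(w(\<rho>)) \<nabla>\<^sub>\<theta>\<close>.\<close>

definition regard_on_dual :: "('x, 'a, 'l) superspace \<Rightarrow> 'a \<Rightarrow> 'a \<Rightarrow> ('x, 'a, 'b) dmod \<Rightarrow>
    ('x, 'a \<times> 'a, 'b) dmod" where
  "regard_on_dual Y z \<theta> F =
     (let \<Psi>i = (\<lambda>V. inv_into (carrier (sec Y V)) (Psi Y z \<theta> V)) in \<lparr>
       msec = (\<lambda>V. \<lparr>
         carrier = carrier (msec F V),
         mult = mult (msec F V),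
         one = \<one>\<^bsub>msec F V\<^esub>,
         zero = \<zero>\<^bsub>msec F V\<^esub>,
         add = add (msec F V),
         smult = (\<lambda>f m. \<Psi>i V f \<odot>\<^bsub>msec F V\<^esub> m),
         mgr = mgr (msec F V)\<rparr>),
       mres = mres F,
       conn = (\<lambda>V w m.
         (\<Psi>i V (w V (u_coord Y z \<theta> V)) \<odot>\<^bsub>msec F V\<^esub> conn F V (partial_z Y z \<theta> V) m) \<oplus>\<^bsub>msec F V\<^esub>
         (\<Psi>i V (w V (rho Y V)) \<odot>\<^bsub>msec F V\<^esub> conn F V (partial_\<theta> Y z \<theta> V) m))\<rparr>)"

definition tau :: "('x, 'a, 'l) superspace \<Rightarrow> 'a \<Rightarrow> 'a \<Rightarrow> ('x, 'a, 'b) dmod \<Rightarrow>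
    'x set \<Rightarrow> 'b \<times> 'b \<Rightarrow> 'b \<times> 'b" where
  "tau Y z \<theta> F V s =
     (let P = msec (pullback Y z \<theta> F) V; t = pull Y V (res Y (whole Y) V \<theta>) in
      (s \<ominus>\<^bsub>P\<^esub> (t \<odot>\<^bsub>P\<^esub> nabla_\<theta> Y z \<theta> F V s)) \<oplus>\<^bsub>P\<^esub>
      (rho Y V \<odot>\<^bsub>P\<^esub> ((t \<odot>\<^bsub>P\<^esub> nabla_z Y z \<theta> F V s) \<oplus>\<^bsub>P\<^esub> nabla_\<theta> Y z \<theta> F V s)))"

definition incl :: "('x, 'a, 'b) dmod \<Rightarrow> 'x set \<Rightarrow> 'b \<Rightarrow> 'b \<times> 'b" where
  "incl F V m = (m, \<zero>\<^bsub>msec F V\<^esub>)"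

end

theory Submission
  imports Defs
begin

text \<open>On a coordinate patch a section of \<open>\<pi>\<^sup>*\<F>\<close> is \<open>m + \<rho> n\<close> with \<open>m\<close>, \<open>n\<close> sections of \<open>\<F>\<close>, and the
  vector fields tangent to the fibers of \<open>\<Delta> \<rightarrow> X^\<close> are the multiples of \<open>\<rho> \<partial>\<^sub>z + \<partial>\<^sub>\<theta>\<close>. Hence
  \<open>m + \<rho> n\<close> belongs to the transform iff \<open>\<nabla>\<^sub>\<theta> m = 0\<close> and \<open>\<nabla>\<^sub>\<theta> n = \<nabla>\<^sub>z m\<close>; such sections are called
  horizontal below. The coordinates single out a diagonal in \<open>\<Delta>\<close>, the locus \<open>\<rho> = \<theta>\<close>. It maps
  isomorphically to \<open>X\<close>, and also to \<open>X^\<close>, where \<open>u = z - \<theta>\<rho>\<close> restricts to \<open>z\<close> because \<open>\<theta>\<^sup>2 = 0\<close>. It is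
  transverse to the fibers of \<open>\<Delta> \<rightarrow> X^\<close>, so a horizontal section is determined by its restriction
  \<open>m + \<theta> n\<close> to the diagonal. Every section of \<open>\<F>\<close> extends from the diagonal to a horizontal
  section, and the formula for the extension is that of \<open>\<tau>\<close>. Flatness enters here, through
  \<open>\<nabla>\<^sub>z \<nabla>\<^sub>\<theta> = \<nabla>\<^sub>\<theta> \<nabla>\<^sub>z\<close> and \<open>\<nabla>\<^sub>\<theta>\<^sup>2 = 0\<close>. So \<open>\<tau>\<close> is bijective
  (\<open>extend_horizontal\<close>, \<open>diagonal_extend\<close>, \<open>extend_diagonal\<close>).\<close>

text \<open>The map \<open>\<Psi>\<close> is the case \<open>\<F> = \<O>\<close> of \<open>\<tau>\<close>. Restriction to the diagonal is multiplicative, so its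
  inverses \<open>\<Psi>\<close> and \<open>\<tau>\<close> are an isomorphism of structure sheaves and a map linear over it
  (\<open>structure_iso_dual\<close>, \<open>extend_module_smult\<close>).\<close>

text \<open>For the connection let \<open>v\<close> be a vector field on \<open>\<Delta>\<close>. As \<open>z = u + \<theta>\<rho>\<close>, the Leibniz rule gives
  \<open>v(z) = v(u) + v(\<theta>) \<rho> - v(\<rho>) \<theta>\<close> with no dependence on the parity of \<open>v\<close>, and therefore
  \<open>\<nabla>\<^sub>v = v(u) \<nabla>\<^sub>z + v(\<rho>) (\<nabla>\<^sub>\<rho> - \<theta> \<nabla>\<^sub>z) + v(\<theta>) (\<rho> \<nabla>\<^sub>z + \<nabla>\<^sub>\<theta>)\<close>. The last term vanishes on horizontal
  sections, so \<open>\<nabla>\<^sub>v\<close> depends only on the vector field on \<open>X^\<close> which \<open>v\<close> lifts (\<open>conn_lift\<close>). Moreover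
  \<open>\<tau>\<close> intertwines \<open>\<nabla>\<^sub>z\<close> with \<open>\<nabla>\<^sub>z\<close> and \<open>\<nabla>\<^sub>\<theta>\<close> with \<open>\<nabla>\<^sub>\<rho> - \<theta> \<nabla>\<^sub>z\<close> (\<open>extend_nz\<close>, \<open>extend_nt\<close>), which are the
  actions of \<open>\<partial>\<^sub>u\<close> and \<open>\<partial>\<^sub>\<rho>\<close> on the transform. The same computation for \<open>\<F> = \<O>\<close> shows that every vector
  field on \<open>X^\<close> has a lift (\<open>lift_exists\<close>).\<close>

text \<open>That the transform, and \<open>\<F>\<close> regarded as a module on \<open>X^\<close>, are sheaves of modules with a flat
  connection is not verified from their definitions: both are isomorphic images of \<open>\<F>\<close>, and the
  axioms are carried along (\<open>dmodule_N\<close>).\<close>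

section \<open>Graded groups and supermodules\<close>

lemma sg_simps [simp]: "sg R True x = \<ominus>\<^bsub>R\<^esub> x" "sg R False x = x"
  by (simp_all add: sg_def)

lemma (in abelian_group) neg_zero: "\<ominus> \<zero> = \<zero>"
  by (rule minus_equality) simp_all

lemma (in abelian_group) minus_eq_zeroD:
  assumes "x \<in> carrier G" "y \<in> carrier G" "x \<ominus> y = \<zero>"
  shows "x = y"
  using minus_equality[of x "\<ominus> y"] assms by (simp add: a_minus_def)

lemma (in abelian_group) cancel_middle:
  "x \<in> carrier G \<Longrightarrow> y \<in> carrier G \<Longrightarrow> x \<oplus> (y \<oplus> \<ominus> x) = y"
  by (simp add: a_lcomm[of x y "\<ominus> x"] r_neg)

locale graded_abelian_group = abelian_group M for M (structure) +
  fixes g :: "bool \<Rightarrow> 'a set"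
  assumes gr_subgroup: "subgroup (g p) (add_monoid M)"
    and decomposition: "x \<in> carrier M \<Longrightarrow>
      \<exists>!y. fst y \<in> g False \<and> snd y \<in> g True \<and> x = fst y \<oplus> snd y"
begin

lemma gr_carrier: "x \<in> g p \<Longrightarrow> x \<in> carrier M"
  using subgroup.subset[OF gr_subgroup, of p] by auto

lemma gr_add: "x \<in> g p \<Longrightarrow> y \<in> g p \<Longrightarrow> x \<oplus> y \<in> g p"
  using subgroup.m_closed[OF gr_subgroup, of x p y] by simp

lemma gr_zero: "\<zero> \<in> g p"
  using subgroup.one_closed[OF gr_subgroup, of p] by simp

lemma gr_neg: "x \<in> g p \<Longrightarrow> \<ominus> x \<in> g p"
  using subgroup.m_inv_closed[OF gr_subgroup, of x p] by (simp add: a_inv_def)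

lemma gr_sg: "x \<in> g p \<Longrightarrow> sg M s x \<in> g p"
  by (simp add: sg_def gr_neg)

lemma sg_closed: "x \<in> carrier M \<Longrightarrow> sg M s x \<in> carrier M"
  by (simp add: sg_def)

text \<open>Signs are prescribed for homogeneous elements only. Since every element is a sum of homogeneous
  ones, additive statements with signs extend to all elements once the signs are expressed by the
  parity involution.\<close>

lemma homogeneous_induct [consumes 1, case_names homogeneous add]:
  assumes "x \<in> carrier M"
    and "\<And>p y. y \<in> g p \<Longrightarrow> P y"
    and "\<And>y w. y \<in> carrier M \<Longrightarrow> w \<in> carrier M \<Longrightarrow> P y \<Longrightarrow> P w \<Longrightarrow> P (y \<oplus> w)"
  shows "P x"
proof -
  obtain y where y: "fst y \<in> g False" "snd y \<in> g True" "x = fst y \<oplus> snd y"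
    using decomposition[OF assms(1)] by blast
  have "P (fst y \<oplus> snd y)"
    by (rule assms(3)) (use y(1,2) assms(2) gr_carrier in blast)+
  then show ?thesis using y(3) by simp
qed

lemma decomposition_unique:
  assumes "a \<in> g False" "b \<in> g True" "c \<in> g False" "d \<in> g True" "a \<oplus> b = c \<oplus> d"
  shows "a = c \<and> b = d"
proof -
  have "a \<oplus> b \<in> carrier M" using assms gr_carrier by blast
  from decomposition[OF this] obtain w
    where w: "\<And>y. fst y \<in> g False \<and> snd y \<in> g True \<and> a \<oplus> b = fst y \<oplus> snd y \<Longrightarrow> y = w"
    by (elim ex1E) blast
  have "(a, b) = w" "(c, d) = w" by (rule w; use assms in simp)+
  then show ?thesis by (metis Pair_inject)
qed

abbreviation par where "par \<equiv> parity_involution M g"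

lemma par_decomposed:
  assumes "a \<in> g False" "b \<in> g True"
  shows "par (a \<oplus> b) = a \<ominus> b"
  unfolding parity_involution_def
proof (rule the_equality)
  show "\<exists>c\<in>g False. \<exists>d\<in>g True. a \<oplus> b = c \<oplus> d \<and> a \<ominus> b = c \<ominus> d" using assms by blast
qed (use assms decomposition_unique in blast)

lemma par_homogeneous:
  assumes "x \<in> g p" shows "par x = sg M p x"
proof (cases p)
  case True
  then show ?thesis using par_decomposed[OF gr_zero, of x] gr_carrier[OF assms] assms
    by (simp add: a_minus_def)
next
  case False
  then show ?thesis using par_decomposed[OF _ gr_zero, of x] gr_carrier[OF assms] assms
    by (simp add: a_minus_def)
qed

lemma par_add:
  assumes "x \<in> carrier M" "y \<in> carrier M"
  shows "par (x \<oplus> y) = par x \<oplus> par y"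
proof -
  obtain a b where x: "a \<in> g False" "b \<in> g True" "x = a \<oplus> b"
    using decomposition[OF assms(1)] by blast
  obtain c d where y: "c \<in> g False" "d \<in> g True" "y = c \<oplus> d"
    using decomposition[OF assms(2)] by blast
  note carr = x(1,2)[THEN gr_carrier] y(1,2)[THEN gr_carrier]
  have "x \<oplus> y = (a \<oplus> c) \<oplus> (b \<oplus> d)" using carr by (simp add: x(3) y(3) a_ac)
  then have "par (x \<oplus> y) = (a \<oplus> c) \<ominus> (b \<oplus> d)"
    using par_decomposed[OF gr_add[OF x(1) y(1)] gr_add[OF x(2) y(2)]] by simp
  also have "\<dots> = (a \<ominus> b) \<oplus> (c \<ominus> d)" using carr by (simp add: a_minus_def minus_add a_ac)
  finally show ?thesis by (simp add: x y par_decomposed)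
qed

lemma par_closed: "x \<in> carrier M \<Longrightarrow> par x \<in> carrier M"
  by (induction rule: homogeneous_induct)
     (simp_all add: par_homogeneous par_add sg_closed gr_carrier)

lemma par_gr: "x \<in> g p \<Longrightarrow> par x \<in> g p"
  by (simp add: par_homogeneous gr_sg)

lemma par_par: "x \<in> carrier M \<Longrightarrow> par (par x) = x"
proof (induction rule: homogeneous_induct)
  case (homogeneous p y)
  then show ?case
    using gr_carrier[OF homogeneous] par_homogeneous[OF gr_neg[OF homogeneous]]
    by (cases p) (simp_all add: par_homogeneous)
qed (simp add: par_add par_closed)

lemma par_zero: "par \<zero> = \<zero>"
  using par_homogeneous[OF gr_zero[of False]] by simp

end

lemma graded_group_iff: "graded_group M g \<longleftrightarrow> graded_abelian_group M g"
  unfolding graded_group_def graded_abelian_group_def graded_abelian_group_axioms_def by blast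

locale supercommutative = fixes R :: "'a super_ring" (structure)
  assumes supercommutative: "supercommutative_ring R"

sublocale supercommutative \<subseteq> ring R
  using supercommutative by (simp add: supercommutative_ring_def)

sublocale supercommutative \<subseteq> graded_abelian_group R "gr R"
  using supercommutative by (simp add: supercommutative_ring_def graded_group_iff)

context supercommutative
begin

lemma gr_one: "\<one> \<in> gr R False"
  using supercommutative by (simp add: supercommutative_ring_def)

lemma gr_mult: "a \<in> gr R p \<Longrightarrow> b \<in> gr R q \<Longrightarrow> a \<otimes> b \<in> gr R (p \<noteq> q)"
  using supercommutative unfolding supercommutative_ring_def by blast

lemma supercommute: "a \<in> gr R p \<Longrightarrow> b \<in> gr R q \<Longrightarrow> a \<otimes> b = sg R (p \<and> q) (b \<otimes> a)"
  using supercommutative unfolding supercommutative_ring_def by blast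

lemma par_one: "par \<one> = \<one>"
  using par_homogeneous[OF gr_one] by simp

lemma sg_mult:
  assumes "a \<in> carrier R" "b \<in> carrier R"
  shows "sg R s a \<otimes> sg R t b = sg R (s \<noteq> t) (a \<otimes> b)"
  using assms by (cases s; cases t) (simp_all add: l_minus r_minus)

lemma par_mult:
  assumes "a \<in> carrier R" "b \<in> carrier R"
  shows "par (a \<otimes> b) = par a \<otimes> par b"
  using assms(1)
proof (induction rule: homogeneous_induct)
  case hom: (homogeneous p a)
  show ?case using assms(2)
  proof (induction rule: homogeneous_induct)
    case (homogeneous q b)
    show ?case
      using par_homogeneous[OF gr_mult[OF hom homogeneous]] hom homogeneous
      by (simp add: par_homogeneous sg_mult gr_carrier)
  qed (simp add: gr_carrier[OF hom] par_add r_distr par_closed)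
qed (simp add: assms par_add l_distr par_closed)

text \<open>On a homogeneous \<open>a\<close> the parity involution is multiplication by the sign which \<open>a\<close> acquires when
  it moves past an odd element.\<close>

lemma odd_commute:
  assumes "t \<in> gr R True" "a \<in> carrier R"
  shows "a \<otimes> t = t \<otimes> par a"
  using assms(2)
proof (induction rule: homogeneous_induct)
  case (homogeneous p a)
  then show ?case using supercommute[OF homogeneous assms(1)] gr_carrier[OF homogeneous]
      gr_carrier[OF assms(1)]
    by (cases p) (simp_all add: par_homogeneous r_minus)
qed (simp add: gr_carrier[OF assms(1)] l_distr r_distr par_add par_closed)

end

locale supermodule = supercommutative R for R :: "'a super_ring" (structure) +
  fixes M :: "('a, 'b) super_module"
  assumes left_supermodule: "left_supermodule R M"

sublocale supermodule \<subseteq> M: graded_abelian_group M "mgr M"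
  using left_supermodule by (simp add: left_supermodule_def graded_group_iff)

context supermodule
begin

lemma smult_closed: "a \<in> carrier R \<Longrightarrow> x \<in> carrier M \<Longrightarrow> a \<odot>\<^bsub>M\<^esub> x \<in> carrier M"
  and smult_add: "a \<in> carrier R \<Longrightarrow> x \<in> carrier M \<Longrightarrow> y \<in> carrier M \<Longrightarrow>
    a \<odot>\<^bsub>M\<^esub> (x \<oplus>\<^bsub>M\<^esub> y) = (a \<odot>\<^bsub>M\<^esub> x) \<oplus>\<^bsub>M\<^esub> (a \<odot>\<^bsub>M\<^esub> y)"
  and add_smult: "a \<in> carrier R \<Longrightarrow> b \<in> carrier R \<Longrightarrow> x \<in> carrier M \<Longrightarrow>
    (a \<oplus> b) \<odot>\<^bsub>M\<^esub> x = (a \<odot>\<^bsub>M\<^esub> x) \<oplus>\<^bsub>M\<^esub> (b \<odot>\<^bsub>M\<^esub> x)"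
  and mult_smult: "a \<in> carrier R \<Longrightarrow> b \<in> carrier R \<Longrightarrow> x \<in> carrier M \<Longrightarrow>
    (a \<otimes> b) \<odot>\<^bsub>M\<^esub> x = a \<odot>\<^bsub>M\<^esub> (b \<odot>\<^bsub>M\<^esub> x)"
  and one_smult: "x \<in> carrier M \<Longrightarrow> \<one> \<odot>\<^bsub>M\<^esub> x = x"
  and gr_smult: "a \<in> gr R p \<Longrightarrow> x \<in> mgr M q \<Longrightarrow> a \<odot>\<^bsub>M\<^esub> x \<in> mgr M (p \<noteq> q)"
  using left_supermodule unfolding left_supermodule_def by blast+

lemma zero_smult: "x \<in> carrier M \<Longrightarrow> \<zero> \<odot>\<^bsub>M\<^esub> x = \<zero>\<^bsub>M\<^esub>"
  by (metis add_smult M.add.l_cancel_one' r_zero smult_closed zero_closed)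

lemma smult_zero: "a \<in> carrier R \<Longrightarrow> a \<odot>\<^bsub>M\<^esub> \<zero>\<^bsub>M\<^esub> = \<zero>\<^bsub>M\<^esub>"
  by (metis smult_add M.add.l_cancel_one' M.r_zero smult_closed M.zero_closed)

lemma neg_smult: "a \<in> carrier R \<Longrightarrow> x \<in> carrier M \<Longrightarrow> (\<ominus> a) \<odot>\<^bsub>M\<^esub> x = \<ominus>\<^bsub>M\<^esub> (a \<odot>\<^bsub>M\<^esub> x)"
  by (metis M.minus_equality a_inv_closed add_smult l_neg smult_closed zero_smult)

lemma smult_neg: "a \<in> carrier R \<Longrightarrow> x \<in> carrier M \<Longrightarrow> a \<odot>\<^bsub>M\<^esub> (\<ominus>\<^bsub>M\<^esub> x) = \<ominus>\<^bsub>M\<^esub> (a \<odot>\<^bsub>M\<^esub> x)"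
  by (metis M.minus_equality M.a_inv_closed smult_add M.l_neg smult_closed smult_zero)

text \<open>The sign rule gives \<open>\<theta>\<^sup>2 = -\<theta>\<^sup>2\<close>, and flatness gives \<open>2 \<nabla>\<^sub>\<theta>\<^sup>2 = 0\<close>. Half of the unit turns both into
  vanishing.\<close>

lemma double_eq_zero:
  assumes "h \<in> carrier R" "h \<oplus> h = \<one>" "x \<in> carrier M" "x \<oplus>\<^bsub>M\<^esub> x = \<zero>\<^bsub>M\<^esub>"
  shows "x = \<zero>\<^bsub>M\<^esub>"
  by (metis assms add_smult one_smult smult_add smult_zero)

end

text \<open>The ring as a module over itself, so that results on modules with connection apply to the
  structure sheaf with its derivations.\<close>

definition regular_module :: "'a super_ring \<Rightarrow> ('a, 'a) super_module" where
  "regular_module R = \<lparr>carrier = carrier R, mult = mult R, one = \<one>\<^bsub>R\<^esub>, zero = \<zero>\<^bsub>R\<^esub>,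
     add = add R, smult = mult R, mgr = gr R\<rparr>"

lemma regular_module_simps [simp]:
  "carrier (regular_module R) = carrier R" "add (regular_module R) = add R"
  "zero (regular_module R) = zero R" "smult (regular_module R) = mult R"
  "mgr (regular_module R) = gr R"
  by (simp_all add: regular_module_def)

lemma a_inv_cong:
  assumes "carrier M = carrier N" "add M = add N" "zero M = zero N"
  shows "\<ominus>\<^bsub>M\<^esub> x = \<ominus>\<^bsub>N\<^esub> x"
  using assms by (simp add: a_inv_def m_inv_def)

lemma subgroup_add_monoid_iff:
  "subgroup H (add_monoid M) \<longleftrightarrow> H \<subseteq> carrier M \<and> \<zero>\<^bsub>M\<^esub> \<in> H \<and>
     (\<forall>x\<in>H. \<forall>y\<in>H. x \<oplus>\<^bsub>M\<^esub> y \<in> H) \<and> (\<forall>x\<in>H. \<ominus>\<^bsub>M\<^esub> x \<in> H)"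
  unfolding subgroup_def a_inv_def by auto

lemma a_inv_regular_module [simp]: "a_inv (regular_module R) = a_inv R"
  by (rule ext) (simp add: a_inv_cong[of "regular_module R" R])

lemma sg_regular_module [simp]: "sg (regular_module R) = sg R"
  by (simp add: fun_eq_iff sg_def)

lemma a_minus_regular_module [simp]: "a_minus (regular_module R) = a_minus R"
  by (simp add: a_minus_def fun_eq_iff)

lemma (in supercommutative) supermodule_regular: "supermodule R (regular_module R)"
proof
  have "graded_abelian_group (regular_module R) (gr R)"
    unfolding graded_group_iff[symmetric] graded_group_def subgroup_add_monoid_iff
  proof (intro conjI)
    show "abelian_group (regular_module R)"
      by (rule abelian_groupI) (auto simp: a_ac intro: l_neg)
  qed (use decomposition in \<open>auto simp: gr_carrier gr_zero gr_add gr_neg\<close>)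
  then show "left_supermodule R (regular_module R)"
    unfolding left_supermodule_def graded_group_iff
    using gr_mult by (simp add: l_distr r_distr m_assoc)
qed

text \<open>The pair \<open>(d, D)\<close> abstracts a vector field of parity \<open>p\<close> on scalars and its contraction with a
  connection. For the regular module and \<open>D = d\<close> it is a superderivation of the ring.\<close>

locale super_operator = supermodule R M for R :: "'a super_ring" (structure) and M :: "('a, 'b) super_module" +
  fixes p :: bool and d :: "'a \<Rightarrow> 'a" and D :: "'b \<Rightarrow> 'b"
  assumes d_gr: "a \<in> gr R q \<Longrightarrow> d a \<in> gr R (p \<noteq> q)"
    and d_add: "a \<in> carrier R \<Longrightarrow> b \<in> carrier R \<Longrightarrow> d (a \<oplus> b) = d a \<oplus> d b"
    and op_gr: "x \<in> mgr M q \<Longrightarrow> D x \<in> mgr M (p \<noteq> q)"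
    and op_add: "x \<in> carrier M \<Longrightarrow> y \<in> carrier M \<Longrightarrow> D (x \<oplus>\<^bsub>M\<^esub> y) = D x \<oplus>\<^bsub>M\<^esub> D y"
    and op_leibniz: "a \<in> gr R q \<Longrightarrow> x \<in> carrier M \<Longrightarrow>
      D (a \<odot>\<^bsub>M\<^esub> x) = (d a \<odot>\<^bsub>M\<^esub> x) \<oplus>\<^bsub>M\<^esub> sg M (p \<and> q) (a \<odot>\<^bsub>M\<^esub> D x)"
begin

lemma d_closed: "a \<in> carrier R \<Longrightarrow> d a \<in> carrier R"
  by (induction rule: homogeneous_induct) (auto simp: d_add dest: d_gr gr_carrier)

lemma op_closed: "x \<in> carrier M \<Longrightarrow> D x \<in> carrier M"
  by (induction rule: M.homogeneous_induct) (auto simp: op_add dest: op_gr M.gr_carrier)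

lemma d_zero: "d \<zero> = \<zero>"
  using d_add[of \<zero> \<zero>] d_closed[of \<zero>] by (simp add: add.l_cancel_one')

lemma op_zero: "D \<zero>\<^bsub>M\<^esub> = \<zero>\<^bsub>M\<^esub>"
  using op_add[of "\<zero>\<^bsub>M\<^esub>" "\<zero>\<^bsub>M\<^esub>"] op_closed[of "\<zero>\<^bsub>M\<^esub>"] by (simp add: M.add.l_cancel_one')

lemma d_neg: "a \<in> carrier R \<Longrightarrow> d (\<ominus> a) = \<ominus> d a"
  by (metis d_add d_closed d_zero a_inv_closed l_neg minus_equality)

lemma op_neg: "x \<in> carrier M \<Longrightarrow> D (\<ominus>\<^bsub>M\<^esub> x) = \<ominus>\<^bsub>M\<^esub> D x"
  by (metis op_add op_closed op_zero M.a_inv_closed M.l_neg M.minus_equality)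

text \<open>An odd operator anticommutes with the parity involution because it exchanges the parities.\<close>

lemma d_par: "a \<in> carrier R \<Longrightarrow> d (par a) = sg R p (par (d a))"
proof (induction rule: homogeneous_induct)
  case (homogeneous q a)
  then show ?case
    using par_homogeneous[OF d_gr[OF homogeneous]] gr_carrier[OF homogeneous] d_closed[of a]
    by (cases p; cases q) (simp_all add: par_homogeneous d_neg)
next
  case (add a b)
  then show ?case
    by (cases p) (simp_all add: par_add d_add d_closed par_closed minus_add)
qed

lemma op_smult:
  assumes "a \<in> carrier R" "x \<in> carrier M"
  shows "D (a \<odot>\<^bsub>M\<^esub> x) = (d a \<odot>\<^bsub>M\<^esub> x) \<oplus>\<^bsub>M\<^esub> ((if p then par a else a) \<odot>\<^bsub>M\<^esub> D x)"
  using assms(1)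
proof (induction rule: homogeneous_induct)
  case (homogeneous q a)
  then show ?case using op_leibniz[OF homogeneous assms(2)] gr_carrier[OF homogeneous] assms(2)
    by (cases p; cases q) (simp_all add: par_homogeneous neg_smult op_closed)
next
  case (add a b)
  then show ?case
    by (cases p) (simp_all add: assms d_add d_closed op_closed op_add add_smult par_add par_closed
      smult_closed M.a_ac)
qed

end


section \<open>Adjoining an odd variable\<close>

lemma Delta_sec_simps [simp]:
  "carrier (Delta_sec R) = carrier R \<times> carrier R"
  "(f, g) \<otimes>\<^bsub>Delta_sec R\<^esub> (f', g') =
    (f \<otimes>\<^bsub>R\<^esub> f', (parity_involution R (gr R) f \<otimes>\<^bsub>R\<^esub> g') \<oplus>\<^bsub>R\<^esub> (g \<otimes>\<^bsub>R\<^esub> f'))"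
  "\<one>\<^bsub>Delta_sec R\<^esub> = (\<one>\<^bsub>R\<^esub>, \<zero>\<^bsub>R\<^esub>)"
  "\<zero>\<^bsub>Delta_sec R\<^esub> = (\<zero>\<^bsub>R\<^esub>, \<zero>\<^bsub>R\<^esub>)"
  "(f, g) \<oplus>\<^bsub>Delta_sec R\<^esub> (f', g') = (f \<oplus>\<^bsub>R\<^esub> f', g \<oplus>\<^bsub>R\<^esub> g')"
  "gr (Delta_sec R) p = gr R p \<times> gr R (\<not> p)"
  by (simp_all add: Delta_sec_def)

lemma pullback_sec_simps [simp]:
  "carrier (pullback_sec R M) = carrier M \<times> carrier M"
  "\<zero>\<^bsub>pullback_sec R M\<^esub> = (\<zero>\<^bsub>M\<^esub>, \<zero>\<^bsub>M\<^esub>)"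
  "(m, n) \<oplus>\<^bsub>pullback_sec R M\<^esub> (m', n') = (m \<oplus>\<^bsub>M\<^esub> m', n \<oplus>\<^bsub>M\<^esub> n')"
  "(f, g) \<odot>\<^bsub>pullback_sec R M\<^esub> (m, n) =
    (f \<odot>\<^bsub>M\<^esub> m, (parity_involution R (gr R) f \<odot>\<^bsub>M\<^esub> n) \<oplus>\<^bsub>M\<^esub> (g \<odot>\<^bsub>M\<^esub> m))"
  "mgr (pullback_sec R M) p = mgr M p \<times> mgr M (\<not> p)"
  by (simp_all add: pullback_sec_def)

text \<open>The pair \<open>(a, b)\<close> stands for \<open>a + \<rho> b\<close> with \<open>\<rho>\<close> odd, so its second entry carries the opposite
  parity.\<close>

lemma (in graded_abelian_group) graded_group_pairs:
  fixes P :: "('a \<times> 'a, 'c) ring_scheme"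
  assumes P: "carrier P = carrier M \<times> carrier M" "\<zero>\<^bsub>P\<^esub> = (\<zero>, \<zero>)"
      "\<And>a b c d. (a, b) \<oplus>\<^bsub>P\<^esub> (c, d) = (a \<oplus> c, b \<oplus> d)"
    and gP: "\<And>p. gP p = g p \<times> g (\<not> p)"
  shows "graded_abelian_group P gP"
    and "a \<in> carrier M \<Longrightarrow> b \<in> carrier M \<Longrightarrow> \<ominus>\<^bsub>P\<^esub> (a, b) = (\<ominus> a, \<ominus> b)"
proof -
  have gp: "abelian_group P"
  proof (rule abelian_groupI)
    fix x assume "x \<in> carrier P"
    then show "\<exists>y\<in>carrier P. y \<oplus>\<^bsub>P\<^esub> x = \<zero>\<^bsub>P\<^esub>"
      by (intro bexI[of _ "(\<ominus> fst x, \<ominus> snd x)"]) (auto simp: P l_neg)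
  qed (auto simp: P a_ac)
  interpret P: abelian_group P by (rule gp)
  show neg: "\<ominus>\<^bsub>P\<^esub> (a, b) = (\<ominus> a, \<ominus> b)" if "a \<in> carrier M" "b \<in> carrier M" for a b
    by (rule P.minus_equality) (use that in \<open>auto simp: P l_neg\<close>)
  have "\<exists>!y. fst y \<in> gP False \<and> snd y \<in> gP True \<and> x = fst y \<oplus>\<^bsub>P\<^esub> snd y"
    if x_in: "x \<in> carrier P" for x
  proof -
    obtain x1 x2 where x: "x = (x1, x2)" "x1 \<in> carrier M" "x2 \<in> carrier M"
      using x_in unfolding P by (rule SigmaE)
    obtain a b where ab: "a \<in> g False" "b \<in> g True" "x1 = a \<oplus> b"
      using decomposition[OF x(2)] by blast
    obtain c d where cd: "c \<in> g False" "d \<in> g True" "x2 = c \<oplus> d"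
      using decomposition[OF x(3)] by blast
    show ?thesis
    proof (rule ex1I[of _ "((a, d), (b, c))"])
      show "fst ((a, d), (b, c)) \<in> gP False \<and> snd ((a, d), (b, c)) \<in> gP True \<and>
        x = fst ((a, d), (b, c)) \<oplus>\<^bsub>P\<^esub> snd ((a, d), (b, c))"
        using ab cd gr_carrier by (auto simp: P gP x a_comm)
    next
      fix y assume y: "fst y \<in> gP False \<and> snd y \<in> gP True \<and> x = fst y \<oplus>\<^bsub>P\<^esub> snd y"
      obtain a' d' b' c' where y': "y = ((a', d'), (b', c'))" by (metis prod.collapse)
      have h: "a' \<in> g False" "b' \<in> g True" "c' \<in> g False" "d' \<in> g True"
        "a \<oplus> b = a' \<oplus> b'" "c \<oplus> d = d' \<oplus> c'"
        using y y' x ab cd by (auto simp: P gP)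
      then have "c \<oplus> d = c' \<oplus> d'" using gr_carrier a_comm by metis
      with h have "a = a' \<and> b = b'" "c = c' \<and> d = d'"
        using decomposition_unique ab cd by blast+
      then show "y = ((a, d), (b, c))" using y' by simp
    qed
  qed
  then show "graded_abelian_group P gP"
    unfolding graded_group_iff[symmetric] graded_group_def subgroup_add_monoid_iff
    using gp by (auto simp: P gP gr_zero gr_add gr_neg gr_carrier neg)
qed

context supermodule
begin

lemma sg_smult: "a \<in> carrier R \<Longrightarrow> x \<in> carrier M \<Longrightarrow> sg R s a \<odot>\<^bsub>M\<^esub> x = sg M s (a \<odot>\<^bsub>M\<^esub> x)"
  by (cases s) (simp_all add: neg_smult)

lemmas module_simps = smult_closed smult_add add_smult mult_smult one_smult zero_smult smult_zero
  neg_smult smult_neg M.minus_add M.a_ac par_closed par_add par_mult par_par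

end

lemma (in supermodule) graded_pullback:
  "graded_abelian_group (pullback_sec R M) (mgr (pullback_sec R M))"
  by (rule M.graded_group_pairs(1)) simp_all

lemma (in supercommutative) graded_Delta: "graded_abelian_group (Delta_sec R) (gr (Delta_sec R))"
  by (rule graded_group_pairs(1)) simp_all

lemma (in supermodule) pullback_neg:
  "a \<in> carrier M \<Longrightarrow> b \<in> carrier M \<Longrightarrow> \<ominus>\<^bsub>pullback_sec R M\<^esub> (a, b) = (\<ominus>\<^bsub>M\<^esub> a, \<ominus>\<^bsub>M\<^esub> b)"
  by (rule M.graded_group_pairs(2)[where gP = "mgr (pullback_sec R M)"]) simp_all

lemma (in supercommutative) Delta_neg:
  "a \<in> carrier R \<Longrightarrow> b \<in> carrier R \<Longrightarrow> \<ominus>\<^bsub>Delta_sec R\<^esub> (a, b) = (\<ominus> a, \<ominus> b)"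
  by (rule graded_group_pairs(2)[where gP = "gr (Delta_sec R)"]) simp_all

lemma (in supercommutative) supercommutative_Delta: "supercommutative (Delta_sec R)"
proof
  let ?D = "Delta_sec R"
  interpret pairs: graded_abelian_group ?D "gr ?D" by (rule graded_Delta)
  have "ring ?D"
  proof (rule ringI)
    show "monoid ?D"
      by (rule monoidI)
        (auto simp: m_assoc l_distr r_distr par_closed par_mult par_one a_ac)
  qed (use pairs.abelian_group_axioms in
      \<open>auto simp: l_distr r_distr par_closed par_add a_ac\<close>)
  moreover have "a \<otimes>\<^bsub>?D\<^esub> b \<in> gr ?D (p \<noteq> q) \<and> a \<otimes>\<^bsub>?D\<^esub> b = sg ?D (p \<and> q) (b \<otimes>\<^bsub>?D\<^esub> a)"
    if ab: "a \<in> gr ?D p" "b \<in> gr ?D q" for a b p q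
  proof -
    obtain f g f' g' where ab: "a = (f, g)" "b = (f', g')"
      and h: "f \<in> gr R p" "g \<in> gr R (\<not> p)" "f' \<in> gr R q" "g' \<in> gr R (\<not> q)"
      using ab by (cases a; cases b) simp
    note c = h[THEN gr_carrier]
    have gr: "f \<otimes> f' \<in> gr R (p \<noteq> q)" "par f \<otimes> g' \<in> gr R (\<not> (p \<noteq> q))"
        "g \<otimes> f' \<in> gr R (\<not> (p \<noteq> q))"
      using gr_mult[OF h(1) h(3)] gr_mult[OF par_gr[OF h(1)] h(4)] gr_mult[OF h(2) h(3)]
      by (cases p; cases q; simp)+
    have "f \<otimes> f' = sg R (p \<and> q) (f' \<otimes> f)" "f \<otimes> g' = sg R (p \<and> \<not> q) (g' \<otimes> f)"
        "g \<otimes> f' = sg R (\<not> p \<and> q) (f' \<otimes> g)"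
      using supercommute h by blast+
    then have "a \<otimes>\<^bsub>?D\<^esub> b = sg ?D (p \<and> q) (b \<otimes>\<^bsub>?D\<^esub> a)"
      using c by (cases p; cases q)
        (simp_all add: ab par_homogeneous[OF h(1)] par_homogeneous[OF h(3)] Delta_neg
          l_minus r_minus minus_add a_ac)
    moreover have "a \<otimes>\<^bsub>?D\<^esub> b \<in> gr ?D (p \<noteq> q)" using gr by (simp add: ab gr_add)
    ultimately show ?thesis by blast
  qed
  moreover have "\<one>\<^bsub>?D\<^esub> \<in> gr ?D False" by (simp add: gr_one gr_zero)
  ultimately show "supercommutative_ring ?D"
    unfolding supercommutative_ring_def graded_group_iff
    using pairs.graded_abelian_group_axioms by blast
qed

lemma (in supermodule) supermodule_pullback: "supermodule (Delta_sec R) (pullback_sec R M)"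
proof -
  have sc: "supercommutative (Delta_sec R)" by (rule supercommutative_Delta)
  have "a \<odot>\<^bsub>pullback_sec R M\<^esub> x \<in> mgr (pullback_sec R M) (p \<noteq> q)"
    if ax: "a \<in> gr (Delta_sec R) p" "x \<in> mgr (pullback_sec R M) q" for a x p q
  proof -
    obtain f g m n where ab: "a = (f, g)" "x = (m, n)"
      and h: "f \<in> gr R p" "g \<in> gr R (\<not> p)" "m \<in> mgr M q" "n \<in> mgr M (\<not> q)"
      using ax by (cases a; cases x) simp
    show ?thesis
      using gr_smult[OF h(1) h(3)] gr_smult[OF par_gr[OF h(1)] h(4)] gr_smult[OF h(2) h(3)]
      by (cases p; cases q) (simp_all add: ab M.gr_add)
  qed
  then have "left_supermodule (Delta_sec R) (pullback_sec R M)"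
    unfolding left_supermodule_def graded_group_iff
    using graded_pullback
    by (auto simp: module_simps par_one)
  with sc show ?thesis by (simp add: supermodule_def supermodule_axioms_def)
qed

section \<open>Horizontal sections over the odd variable\<close>

text \<open>The situation over one open set: \<open>t\<close> is the odd coordinate \<open>\<theta>\<close>, the derivations \<open>dz\<close>, \<open>dt\<close> are the
  coordinate vector fields, and \<open>nz\<close>, \<open>nt\<close> are their contractions with a flat connection on \<open>M\<close>. The
  last two assumptions are flatness for the brackets \<open>[\<partial>\<^sub>z, \<partial>\<^sub>\<theta>] = 0\<close> and \<open>[\<partial>\<^sub>\<theta>, \<partial>\<^sub>\<theta>] = 0\<close>. Taking for \<open>M\<close>
  the regular module gives statements about the structure sheaf.\<close>

locale odd_plane = supermodule R M +
  Z: super_operator R M False dz nz + T: super_operator R M True dt nt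
  for R :: "'a super_ring" (structure) and M :: "('a, 'b) super_module" and dz nz dt nt +
  fixes t
  assumes t_odd: "t \<in> gr R True" and t_square: "t \<otimes> t = \<zero>"
    and dz_t: "dz t = \<zero>" and dt_t: "dt t = \<one>"
    and commute: "x \<in> carrier M \<Longrightarrow> nz (nt x) = nt (nz x)"
    and nt_square: "x \<in> carrier M \<Longrightarrow> nt (nt x) = \<zero>\<^bsub>M\<^esub>"
begin

lemma t_closed: "t \<in> carrier R"
  using t_odd gr_carrier by blast

lemma t_t_smult: "x \<in> carrier M \<Longrightarrow> t \<odot>\<^bsub>M\<^esub> (t \<odot>\<^bsub>M\<^esub> x) = \<zero>\<^bsub>M\<^esub>"
  using mult_smult[of t t x] by (simp add: t_closed t_square zero_smult)

lemma nz_t: "x \<in> carrier M \<Longrightarrow> nz (t \<odot>\<^bsub>M\<^esub> x) = t \<odot>\<^bsub>M\<^esub> nz x"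
  using Z.op_smult[of t x] by (simp add: t_closed dz_t zero_smult smult_closed Z.op_closed)

lemma nt_t: "x \<in> carrier M \<Longrightarrow> nt (t \<odot>\<^bsub>M\<^esub> x) = x \<ominus>\<^bsub>M\<^esub> t \<odot>\<^bsub>M\<^esub> nt x"
  using T.op_smult[of t x]
  by (simp add: t_closed dt_t one_smult par_homogeneous[OF t_odd] neg_smult T.op_closed a_minus_def)

text \<open>The kernel of \<open>\<rho> \<nabla>\<^sub>z + \<nabla>\<^sub>\<theta>\<close> on pairs, which maps \<open>a + \<rho> b\<close> to \<open>\<nabla>\<^sub>\<theta> a + \<rho> (\<nabla>\<^sub>z a - \<nabla>\<^sub>\<theta> b)\<close>.\<close>

definition horizontal :: "('b \<times> 'b) set" where
  "horizontal = {s \<in> carrier M \<times> carrier M. nt (fst s) = \<zero>\<^bsub>M\<^esub> \<and> nt (snd s) = nz (fst s)}"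

text \<open>Restriction to \<open>\<rho> = \<theta>\<close>.\<close>

definition diagonal :: "'b \<times> 'b \<Rightarrow> 'b" where
  "diagonal s = fst s \<oplus>\<^bsub>M\<^esub> t \<odot>\<^bsub>M\<^esub> snd s"

text \<open>The operator \<open>\<tau>\<close> with its products by \<open>\<rho>\<close> and \<open>\<theta>\<close> carried out.\<close>

definition extend :: "'b \<Rightarrow> 'b \<times> 'b" where
  "extend m = (m \<ominus>\<^bsub>M\<^esub> t \<odot>\<^bsub>M\<^esub> nt m, (t \<odot>\<^bsub>M\<^esub> nz m) \<oplus>\<^bsub>M\<^esub> nt m)"

lemmas closed = t_closed Z.op_closed T.op_closed Z.d_closed T.d_closed smult_closed

lemmas op_simps = nz_t nt_t Z.op_add T.op_add Z.op_neg T.op_neg Z.op_zero T.op_zero commute nt_square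
  smult_zero t_t_smult smult_add smult_neg M.minus_add a_minus_def

lemma horizontalI:
  "a \<in> carrier M \<Longrightarrow> b \<in> carrier M \<Longrightarrow> nt a = \<zero>\<^bsub>M\<^esub> \<Longrightarrow> nt b = nz a \<Longrightarrow> (a, b) \<in> horizontal"
  by (simp add: horizontal_def)

lemma horizontalE:
  assumes "s \<in> horizontal"
  obtains a b where "s = (a, b)" "a \<in> carrier M" "b \<in> carrier M" "nt a = \<zero>\<^bsub>M\<^esub>" "nt b = nz a"
  using assms by (cases s) (auto simp: horizontal_def)

lemma extend_horizontal:
  assumes "m \<in> carrier M" shows "extend m \<in> horizontal"
  unfolding extend_def
  by (rule horizontalI)
    (use assms in \<open>simp_all add: op_simps closed M.a_ac M.r_neg M.r_neg1 M.r_neg2\<close>)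

lemma diagonal_extend:
  assumes "m \<in> carrier M" shows "diagonal (extend m) = m"
  using assms by (simp add: diagonal_def extend_def op_simps closed M.a_assoc M.l_neg)

text \<open>The two equations defining horizontality express \<open>\<nabla>\<^sub>\<theta>\<close> of both entries through the first
  entry, which lets \<open>\<nabla>\<^sub>\<theta>\<close> of the restriction to the diagonal be computed.\<close>

lemma extend_diagonal:
  assumes "s \<in> horizontal" shows "extend (diagonal s) = s"
  using assms
proof (rule horizontalE)
  fix a b assume s: "s = (a, b)" "a \<in> carrier M" "b \<in> carrier M" "nt a = \<zero>\<^bsub>M\<^esub>" "nt b = nz a"
  have d: "nt (a \<oplus>\<^bsub>M\<^esub> t \<odot>\<^bsub>M\<^esub> b) = b \<ominus>\<^bsub>M\<^esub> t \<odot>\<^bsub>M\<^esub> nz a"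
    using s by (simp add: op_simps closed)
  show ?thesis
    unfolding diagonal_def extend_def s fst_conv snd_conv d
    using s(2,3) by (simp add: op_simps closed M.a_ac M.r_neg M.r_neg1 M.r_neg2)
qed

lemma bij_extend: "bij_betw extend (carrier M) horizontal"
  by (rule bij_betw_byWitness[where f' = diagonal])
    (auto simp: diagonal_extend extend_diagonal extend_horizontal, auto simp: horizontal_def diagonal_def closed)

lemma diagonal_closed: "s \<in> carrier M \<times> carrier M \<Longrightarrow> diagonal s \<in> carrier M"
  by (auto simp: diagonal_def closed)

lemma extend_add:
  assumes "m \<in> carrier M" "n \<in> carrier M"
  shows "extend (m \<oplus>\<^bsub>M\<^esub> n) = extend m \<oplus>\<^bsub>pullback_sec R M\<^esub> extend n"
  using assms by (simp add: extend_def op_simps closed M.a_ac)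

lemma extend_zero: "extend \<zero>\<^bsub>M\<^esub> = \<zero>\<^bsub>pullback_sec R M\<^esub>"
  by (simp add: extend_def op_simps closed)

lemma diagonal_gr: "s \<in> mgr (pullback_sec R M) p \<Longrightarrow> diagonal s \<in> mgr M p"
  using gr_smult[OF t_odd, of "snd s" "\<not> p"] by (auto simp: diagonal_def M.gr_add)

lemma extend_gr:
  assumes "m \<in> mgr M p" shows "extend m \<in> mgr (pullback_sec R M) p"
  using gr_smult[OF t_odd T.op_gr[OF assms]] gr_smult[OF t_odd Z.op_gr[OF assms]]
    T.op_gr[OF assms] assms
  by (auto simp: extend_def a_minus_def intro!: M.gr_add M.gr_neg)

lemma extend_gr_image: "extend ` mgr M p = mgr (pullback_sec R M) p \<inter> horizontal"
proof
  show "extend ` mgr M p \<subseteq> mgr (pullback_sec R M) p \<inter> horizontal"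
    using extend_gr extend_horizontal M.gr_carrier by blast
  show "mgr (pullback_sec R M) p \<inter> horizontal \<subseteq> extend ` mgr M p"
    using extend_diagonal diagonal_gr by (metis IntE image_eqI subsetI)
qed

text \<open>The Leibniz rule for the odd operator \<open>\<rho> \<nabla>\<^sub>z + \<nabla>\<^sub>\<theta>\<close>: horizontal sections form a module over the
  functions annihilated by \<open>\<rho> \<partial>\<^sub>z + \<partial>\<^sub>\<theta>\<close>.\<close>

lemma horizontal_smult:
  assumes f: "f \<in> carrier R" "g \<in> carrier R" "dt f = \<zero>" "dt g = dz f" and s: "s \<in> horizontal"
  shows "(f, g) \<odot>\<^bsub>pullback_sec R M\<^esub> s \<in> horizontal"
  using s
proof (rule horizontalE)
  fix a b assume s: "s = (a, b)" "a \<in> carrier M" "b \<in> carrier M" "nt a = \<zero>\<^bsub>M\<^esub>" "nt b = nz a"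
  have "dt (par f) = \<zero>" using T.d_par[of f] f by (simp add: par_zero)
  then show ?thesis
    unfolding s pullback_sec_simps using f s(2-)
    by (intro horizontalI) (simp_all add: closed par_closed T.op_smult Z.op_smult T.op_add zero_smult
      smult_zero par_par M.a_ac)
qed

text \<open>Restriction to the diagonal is multiplicative since \<open>f + \<rho> g \<mapsto> f + \<theta> g\<close> replaces the odd \<open>\<rho>\<close>, of
  square zero, by \<open>\<theta>\<close>, which is subject to the same relations.\<close>

lemma diagonal_smult:
  assumes "f \<in> carrier R" "g \<in> carrier R" "s \<in> carrier M \<times> carrier M"
  shows "diagonal ((f, g) \<odot>\<^bsub>pullback_sec R M\<^esub> s) = (f \<oplus> t \<otimes> g) \<odot>\<^bsub>M\<^esub> diagonal s"
proof -
  obtain a b where s: "s = (a, b)" "a \<in> carrier M" "b \<in> carrier M" using assms(3) by (cases s) auto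
  have "f \<odot>\<^bsub>M\<^esub> (t \<odot>\<^bsub>M\<^esub> b) = t \<odot>\<^bsub>M\<^esub> (par f \<odot>\<^bsub>M\<^esub> b)"
    using odd_commute[OF t_odd assms(1)] mult_smult[of f t b] mult_smult[of t "par f" b] assms s
    by (simp add: t_closed par_closed)
  moreover have "g \<odot>\<^bsub>M\<^esub> (t \<odot>\<^bsub>M\<^esub> b) = t \<odot>\<^bsub>M\<^esub> (par g \<odot>\<^bsub>M\<^esub> b)"
    using odd_commute[OF t_odd assms(2)] mult_smult[of g t b] mult_smult[of t "par g" b] assms s
    by (simp add: t_closed par_closed)
  ultimately show ?thesis
    using s(2,3) assms(1,2)
    by (simp add: s diagonal_def closed par_closed smult_add add_smult mult_smult t_t_smult M.a_ac)
qed

text \<open>Both sides are horizontal and have the same restriction to the diagonal.\<close>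

lemma extend_smult:
  assumes f: "f \<in> carrier R" "g \<in> carrier R" "dt f = \<zero>" "dt g = dz f" and m: "m \<in> carrier M"
  shows "(f, g) \<odot>\<^bsub>pullback_sec R M\<^esub> extend m = extend ((f \<oplus> t \<otimes> g) \<odot>\<^bsub>M\<^esub> m)"
proof -
  have "extend m \<in> carrier M \<times> carrier M" using extend_horizontal[OF m] by (simp add: horizontal_def)
  then show ?thesis
    using extend_diagonal[OF horizontal_smult[OF f extend_horizontal[OF m]]]
      diagonal_smult[OF f(1,2), of "extend m"] diagonal_extend[OF m] by simp
qed

lemma extend_nz:
  assumes "m \<in> carrier M"
  shows "even_ext nz (extend m) = extend (nz m)"
  using assms by (simp add: even_ext_def extend_def op_simps closed)

text \<open>The vector field \<open>\<partial>\<^sub>\<rho> - \<theta> \<partial>\<^sub>z\<close> annihilates \<open>u = z - \<theta>\<rho>\<close> and maps \<open>\<rho>\<close> to \<open>1\<close>, so it lifts the coordinate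
  field \<open>\<partial>\<^sub>\<rho>\<close> of the dual curve; extension from the diagonal turns \<open>\<nabla>\<^sub>\<theta>\<close> into its action.\<close>

lemma extend_nt:
  assumes "m \<in> carrier M"
  shows "(snd (extend m), \<zero>\<^bsub>M\<^esub>) \<ominus>\<^bsub>pullback_sec R M\<^esub> ((t, \<zero>) \<odot>\<^bsub>pullback_sec R M\<^esub> extend (nz m)) = extend (nt m)"
proof -
  interpret P: graded_abelian_group "pullback_sec R M" "mgr (pullback_sec R M)"
    by (rule graded_pullback)
  show ?thesis
    using assms by (simp add: extend_def op_simps closed par_homogeneous[OF t_odd] zero_smult neg_smult
      pullback_neg a_minus_def M.a_ac M.r_neg M.r_neg1 M.r_neg2)
qed

end

section \<open>Operations on superderivations\<close>

lemma (in super_operator) cong: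
  assumes "\<And>a. a \<in> carrier R \<Longrightarrow> d' a = d a" "\<And>x. x \<in> carrier M \<Longrightarrow> D' x = D x"
  shows "super_operator R M p d' D'"
  by unfold_locales
    (use assms d_gr d_add op_gr op_add op_leibniz gr_carrier M.gr_carrier smult_closed in auto)

lemma (in super_operator) add_operator:
  assumes "super_operator R M p e E"
  shows "super_operator R M p (\<lambda>a. d a \<oplus> e a) (\<lambda>x. D x \<oplus>\<^bsub>M\<^esub> E x)"
proof -
  interpret E: super_operator R M p e E by fact
  show ?thesis
  proof
    fix a q x assume a: "a \<in> gr R q" and x: "x \<in> carrier M"
    show "D (a \<odot>\<^bsub>M\<^esub> x) \<oplus>\<^bsub>M\<^esub> E (a \<odot>\<^bsub>M\<^esub> x) =
      ((d a \<oplus> e a) \<odot>\<^bsub>M\<^esub> x) \<oplus>\<^bsub>M\<^esub> sg M (p \<and> q) (a \<odot>\<^bsub>M\<^esub> (D x \<oplus>\<^bsub>M\<^esub> E x))"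
      using gr_carrier[OF a] x op_leibniz[OF a x] E.op_leibniz[OF a x]
      by (cases p; cases q) (simp_all add: d_closed E.d_closed op_closed E.op_closed module_simps)
  next
    show "d a \<oplus> e a \<in> gr R (p \<noteq> q)" if "a \<in> gr R q" for a q
      using that by (intro gr_add d_gr E.d_gr)
    show "D x \<oplus>\<^bsub>M\<^esub> E x \<in> mgr M (p \<noteq> q)" if "x \<in> mgr M q" for x q
      using that by (intro M.gr_add op_gr E.op_gr)
  qed (auto simp: d_add E.d_add op_add E.op_add
      d_closed E.d_closed op_closed E.op_closed a_ac M.a_ac)
qed

lemma (in super_operator) smult_operator:
  assumes f: "f \<in> gr R r"
  shows "super_operator R M (r \<noteq> p) (\<lambda>a. f \<otimes> d a) (\<lambda>x. f \<odot>\<^bsub>M\<^esub> D x)"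
proof
  note fc = gr_carrier[OF f]
  show "f \<otimes> d a \<in> gr R ((r \<noteq> p) \<noteq> q)" if "a \<in> gr R q" for a q
    using gr_mult[OF f d_gr[OF that]] by (cases r; cases p; cases q) simp_all
  show "f \<odot>\<^bsub>M\<^esub> D x \<in> mgr M ((r \<noteq> p) \<noteq> q)" if "x \<in> mgr M q" for x q
    using gr_smult[OF f op_gr[OF that]] by (cases r; cases p; cases q) simp_all
  fix a q x assume a: "a \<in> gr R q" and x: "x \<in> carrier M"
  note ac = gr_carrier[OF a]
  have "f \<odot>\<^bsub>M\<^esub> (a \<odot>\<^bsub>M\<^esub> D x) = sg M (r \<and> q) (a \<odot>\<^bsub>M\<^esub> (f \<odot>\<^bsub>M\<^esub> D x))"
    using mult_smult[OF fc ac op_closed[OF x]] mult_smult[OF ac fc op_closed[OF x]]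
      supercommute[OF f a] ac fc x
    by (simp add: sg_smult op_closed)
  then show "f \<odot>\<^bsub>M\<^esub> D (a \<odot>\<^bsub>M\<^esub> x) =
      ((f \<otimes> d a) \<odot>\<^bsub>M\<^esub> x) \<oplus>\<^bsub>M\<^esub> sg M ((r \<noteq> p) \<and> q) (a \<odot>\<^bsub>M\<^esub> (f \<odot>\<^bsub>M\<^esub> D x))"
    using ac fc x op_leibniz[OF a x]
    by (cases r; cases p; cases q) (simp_all add: d_closed op_closed module_simps)
qed (simp_all add: gr_carrier[OF f] d_add d_closed r_distr op_add op_closed smult_add)

text \<open>The mixed terms \<open>d a \<cdot> E x\<close> and \<open>e a \<cdot> D x\<close> in the Leibniz rule for a bracket cancel in this
  pattern.\<close>

lemma (in abelian_group) cancel_pair: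
  assumes "y \<in> carrier G" "w \<in> carrier G" "a \<in> carrier G" "b \<in> carrier G" "c \<in> carrier G"
  shows "y \<oplus> (w \<oplus> (a \<oplus> (b \<oplus> (\<ominus> y \<oplus> \<ominus> w)))) = a \<oplus> b"
    and "y \<oplus> (w \<oplus> (a \<oplus> (b \<oplus> (\<ominus> y \<oplus> (\<ominus> w \<oplus> c))))) = a \<oplus> (b \<oplus> c)"
proof -
  have "y \<oplus> (w \<oplus> (a \<oplus> (b \<oplus> (\<ominus> y \<oplus> (\<ominus> w \<oplus> c))))) = (y \<oplus> \<ominus> y) \<oplus> ((w \<oplus> \<ominus> w) \<oplus> (a \<oplus> (b \<oplus> c)))"
    if "c \<in> carrier G" for c using assms(1-4) that by (simp add: a_ac)
  then have *: "y \<oplus> (w \<oplus> (a \<oplus> (b \<oplus> (\<ominus> y \<oplus> (\<ominus> w \<oplus> c))))) = a \<oplus> (b \<oplus> c)"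
    if "c \<in> carrier G" for c using assms(1-4) that by (simp add: r_neg)
  show "y \<oplus> (w \<oplus> (a \<oplus> (b \<oplus> (\<ominus> y \<oplus> (\<ominus> w \<oplus> c))))) = a \<oplus> (b \<oplus> c)"
    by (rule *) fact
  show "y \<oplus> (w \<oplus> (a \<oplus> (b \<oplus> (\<ominus> y \<oplus> \<ominus> w)))) = a \<oplus> b"
    using *[OF zero_closed] assms(1-4) by simp
qed

lemma (in super_operator) bracket_operator:
  assumes "super_operator R M r e E"
  shows "super_operator R M (p \<noteq> r) (\<lambda>a. d (e a) \<ominus> sg R (p \<and> r) (e (d a)))
    (\<lambda>x. D (E x) \<ominus>\<^bsub>M\<^esub> sg M (p \<and> r) (E (D x)))"
proof -
  interpret E: super_operator R M r e E by fact
  note cl = d_closed E.d_closed op_closed E.op_closed smult_closed sg_closed M.sg_closed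
  show ?thesis
  proof
    show "d (e a) \<ominus> sg R (p \<and> r) (e (d a)) \<in> gr R ((p \<noteq> r) \<noteq> q)" if "a \<in> gr R q" for a q
      using d_gr[OF E.d_gr[OF that]] E.d_gr[OF d_gr[OF that]]
      by (cases r; cases p; cases q) (simp_all add: a_minus_def gr_add gr_neg)
    show "D (E x) \<ominus>\<^bsub>M\<^esub> sg M (p \<and> r) (E (D x)) \<in> mgr M ((p \<noteq> r) \<noteq> q)" if "x \<in> mgr M q" for x q
      using op_gr[OF E.op_gr[OF that]] E.op_gr[OF op_gr[OF that]]
      by (cases r; cases p; cases q) (simp_all add: a_minus_def M.gr_add M.gr_neg)
    fix a q x assume a: "a \<in> gr R q" and x: "x \<in> carrier M"
    note ac = gr_carrier[OF a]
    have 1: "D (E (a \<odot>\<^bsub>M\<^esub> x)) = D (e a \<odot>\<^bsub>M\<^esub> x) \<oplus>\<^bsub>M\<^esub> sg M (r \<and> q) (D (a \<odot>\<^bsub>M\<^esub> E x))"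
      using ac x by (cases r; cases q) (simp_all add: E.op_leibniz[OF a x] op_add op_neg cl)
    have 2: "E (D (a \<odot>\<^bsub>M\<^esub> x)) = E (d a \<odot>\<^bsub>M\<^esub> x) \<oplus>\<^bsub>M\<^esub> sg M (p \<and> q) (E (a \<odot>\<^bsub>M\<^esub> D x))"
      using ac x by (cases p; cases q) (simp_all add: op_leibniz[OF a x] E.op_add E.op_neg cl)
    show "D (E (a \<odot>\<^bsub>M\<^esub> x)) \<ominus>\<^bsub>M\<^esub> sg M (p \<and> r) (E (D (a \<odot>\<^bsub>M\<^esub> x))) =
      ((d (e a) \<ominus> sg R (p \<and> r) (e (d a))) \<odot>\<^bsub>M\<^esub> x) \<oplus>\<^bsub>M\<^esub>
      sg M ((p \<noteq> r) \<and> q) (a \<odot>\<^bsub>M\<^esub> (D (E x) \<ominus>\<^bsub>M\<^esub> sg M (p \<and> r) (E (D x))))"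
      unfolding 1 2 op_leibniz[OF E.d_gr[OF a] x] E.op_leibniz[OF d_gr[OF a] x]
        op_leibniz[OF a E.op_closed[OF x]] E.op_leibniz[OF a op_closed[OF x]]
      using ac x
      by (cases r; cases p; cases q)
        (simp_all add: cl module_simps a_minus_def M.cancel_pair)
  next
    fix a b assume "a \<in> carrier R" "b \<in> carrier R"
    then show "d (e (a \<oplus> b)) \<ominus> sg R (p \<and> r) (e (d (a \<oplus> b))) =
      (d (e a) \<ominus> sg R (p \<and> r) (e (d a))) \<oplus> (d (e b) \<ominus> sg R (p \<and> r) (e (d b)))"
      by (cases p; cases r) (simp_all add: d_add E.d_add cl a_minus_def minus_add a_ac)
  next
    fix x y assume "x \<in> carrier M" "y \<in> carrier M"
    then show "D (E (x \<oplus>\<^bsub>M\<^esub> y)) \<ominus>\<^bsub>M\<^esub> sg M (p \<and> r) (E (D (x \<oplus>\<^bsub>M\<^esub> y))) =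
      (D (E x) \<ominus>\<^bsub>M\<^esub> sg M (p \<and> r) (E (D x))) \<oplus>\<^bsub>M\<^esub> (D (E y) \<ominus>\<^bsub>M\<^esub> sg M (p \<and> r) (E (D y)))"
      by (cases p; cases r) (simp_all add: op_add E.op_add cl a_minus_def M.minus_add M.a_ac)
  qed
qed

abbreviation superderivation :: "'a super_ring \<Rightarrow> bool \<Rightarrow> ('a \<Rightarrow> 'a) \<Rightarrow> bool" where
  "superderivation R p d \<equiv> super_operator R (regular_module R) p d d"

lemma (in supercommutative) superderivationI:
  assumes "\<And>a q. a \<in> gr R q \<Longrightarrow> d a \<in> gr R (p \<noteq> q)"
    and "\<And>a b. a \<in> carrier R \<Longrightarrow> b \<in> carrier R \<Longrightarrow> d (a \<oplus> b) = d a \<oplus> d b"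
    and "\<And>a q b. a \<in> gr R q \<Longrightarrow> b \<in> carrier R \<Longrightarrow>
      d (a \<otimes> b) = (d a \<otimes> b) \<oplus> sg R (p \<and> q) (a \<otimes> d b)"
  shows "superderivation R p d"
proof -
  interpret supermodule R "regular_module R" by (rule supermodule_regular)
  show ?thesis by unfold_locales (use assms in auto)
qed

lemma (in supercommutative) even_ext_superderivation:
  assumes "superderivation R False d"
  shows "superderivation (Delta_sec R) False (even_ext d)"
proof -
  interpret D: super_operator R "regular_module R" False d d by fact
  interpret E: supercommutative "Delta_sec R" by (rule supercommutative_Delta)
  show ?thesis
  proof (rule E.superderivationI)
    fix a q b assume a: "a \<in> gr (Delta_sec R) q" and b: "b \<in> carrier (Delta_sec R)"
    obtain f g f' g' where ab: "a = (f, g)" "b = (f', g')" and fg: "f \<in> gr R q" "g \<in> gr R (\<not> q)"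
      and fg': "f' \<in> carrier R" "g' \<in> carrier R"
      using a b by (cases a; cases b) simp
    note c = fg[THEN gr_carrier] fg'
    show "even_ext d (a \<otimes>\<^bsub>Delta_sec R\<^esub> b) = (even_ext d a \<otimes>\<^bsub>Delta_sec R\<^esub> b) \<oplus>\<^bsub>Delta_sec R\<^esub>
        sg (Delta_sec R) (False \<and> q) (a \<otimes>\<^bsub>Delta_sec R\<^esub> even_ext d b)"
      using c D.op_smult[of f f'] D.op_smult[of g f'] D.op_smult[of "par f" g'] D.d_par[of f]
      by (simp add: ab even_ext_def par_closed D.d_add D.d_closed a_ac)
  qed (auto simp: even_ext_def D.d_add dest: D.d_gr)
qed

text \<open>The sign in front of the second component is the one for moving the odd operator past \<open>\<rho>\<close>.\<close>

lemma (in supercommutative) odd_ext_superderivation: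
  assumes "superderivation R True d"
  shows "superderivation (Delta_sec R) True (odd_ext R d)"
proof -
  interpret D: super_operator R "regular_module R" True d d by fact
  interpret E: supercommutative "Delta_sec R" by (rule supercommutative_Delta)
  show ?thesis
  proof (rule E.superderivationI)
    fix a q b assume a: "a \<in> gr (Delta_sec R) q" and b: "b \<in> carrier (Delta_sec R)"
    obtain f g f' g' where ab: "a = (f, g)" "b = (f', g')" and fg: "f \<in> gr R q" "g \<in> gr R (\<not> q)"
      and fg': "f' \<in> carrier R" "g' \<in> carrier R"
      using a b by (cases a; cases b) simp
    note c = fg[THEN gr_carrier] fg'
    show "odd_ext R d (a \<otimes>\<^bsub>Delta_sec R\<^esub> b) = (odd_ext R d a \<otimes>\<^bsub>Delta_sec R\<^esub> b) \<oplus>\<^bsub>Delta_sec R\<^esub>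
        sg (Delta_sec R) (True \<and> q) (a \<otimes>\<^bsub>Delta_sec R\<^esub> odd_ext R d b)"
      using c D.op_smult[of f f'] D.op_smult[of g f'] D.op_smult[of f g']
        par_homogeneous[OF fg(1)] par_homogeneous[OF fg(2)] par_homogeneous[OF D.d_gr[OF fg(1)]]
      by (cases q) (simp_all add: ab odd_ext_def par_closed D.d_add D.d_neg D.d_closed Delta_neg
        l_minus r_minus minus_add a_ac)
  qed (auto simp: odd_ext_def D.d_add D.d_closed minus_add dest: D.d_gr intro!: gr_neg)
qed

text \<open>This operator is \<open>\<partial>\<^sub>\<rho>\<close>, which maps \<open>f + \<rho> g\<close> to \<open>g\<close>.\<close>

lemma (in supercommutative) rho_superderivation:
  "superderivation (Delta_sec R) True (\<lambda>(f, g). (g, \<zero>))"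
proof -
  interpret E: supercommutative "Delta_sec R" by (rule supercommutative_Delta)
  show ?thesis
  proof (rule E.superderivationI)
    fix a q b assume a: "a \<in> gr (Delta_sec R) q" and b: "b \<in> carrier (Delta_sec R)"
    obtain f g f' g' where ab: "a = (f, g)" "b = (f', g')" and fg: "f \<in> gr R q" "g \<in> gr R (\<not> q)"
      and fg': "f' \<in> carrier R" "g' \<in> carrier R"
      using a b by (cases a; cases b) simp
    note c = fg[THEN gr_carrier] fg'
    show "(case a \<otimes>\<^bsub>Delta_sec R\<^esub> b of (f, g) \<Rightarrow> (g, \<zero>)) =
        ((case a of (f, g) \<Rightarrow> (g, \<zero>)) \<otimes>\<^bsub>Delta_sec R\<^esub> b) \<oplus>\<^bsub>Delta_sec R\<^esub>
        sg (Delta_sec R) (True \<and> q) (a \<otimes>\<^bsub>Delta_sec R\<^esub> (case b of (f, g) \<Rightarrow> (g, \<zero>)))"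
      using c par_homogeneous[OF fg(1)] par_homogeneous[OF fg(2)]
      by (cases q) (simp_all add: ab par_closed Delta_neg l_minus r_minus a_ac l_neg r_neg)
  qed (auto simp: gr_zero)
qed

section \<open>Vector fields\<close>

lemma opens_trans: "V \<in> opens Y U \<Longrightarrow> W \<in> opens Y V \<Longrightarrow> W \<in> opens Y U"
  by (auto simp: opens_def)

lemma opens_self: "V \<in> opens Y U \<Longrightarrow> V \<in> opens Y V"
  by (auto simp: opens_def)

lemma whole_open: "whole Y \<in> opens Y (whole Y)"
  by (simp add: opens_def)

text \<open>The functorial part of a superspace. It passes to open subspaces, to \<open>\<Delta>\<close> and to the dual curve by
  pure algebra, and it suffices for the calculus of vector fields.\<close>

locale super_presheaf =
  fixes Y :: "('x, 'a, 'l) superspace"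
  assumes sections: "V \<in> opens Y (whole Y) \<Longrightarrow> supercommutative (sec Y V)"
    and res_gr: "V \<in> opens Y (whole Y) \<Longrightarrow> W \<in> opens Y V \<Longrightarrow> a \<in> gr (sec Y V) p \<Longrightarrow>
      res Y V W a \<in> gr (sec Y W) p"
    and res_add: "V \<in> opens Y (whole Y) \<Longrightarrow> W \<in> opens Y V \<Longrightarrow> a \<in> carrier (sec Y V) \<Longrightarrow>
      b \<in> carrier (sec Y V) \<Longrightarrow> res Y V W (a \<oplus>\<^bsub>sec Y V\<^esub> b) = res Y V W a \<oplus>\<^bsub>sec Y W\<^esub> res Y V W b"
    and res_mult: "V \<in> opens Y (whole Y) \<Longrightarrow> W \<in> opens Y V \<Longrightarrow> a \<in> carrier (sec Y V) \<Longrightarrow>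
      b \<in> carrier (sec Y V) \<Longrightarrow> res Y V W (a \<otimes>\<^bsub>sec Y V\<^esub> b) = res Y V W a \<otimes>\<^bsub>sec Y W\<^esub> res Y V W b"
    and res_one: "V \<in> opens Y (whole Y) \<Longrightarrow> W \<in> opens Y V \<Longrightarrow> res Y V W \<one>\<^bsub>sec Y V\<^esub> = \<one>\<^bsub>sec Y W\<^esub>"
    and res_id: "V \<in> opens Y (whole Y) \<Longrightarrow> a \<in> carrier (sec Y V) \<Longrightarrow> res Y V V a = a"
    and res_res: "V \<in> opens Y (whole Y) \<Longrightarrow> W \<in> opens Y V \<Longrightarrow> Z \<in> opens Y W \<Longrightarrow>
      a \<in> carrier (sec Y V) \<Longrightarrow> res Y W Z (res Y V W a) = res Y V Z a"
    and alg_closed: "V \<in> opens Y (whole Y) \<Longrightarrow> l \<in> carrier (base Y) \<Longrightarrow> alg Y V l \<in> carrier (sec Y V)"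

lemma sheaf_restrict:
  assumes "sheaf T C r"
  shows "\<And>V a. openin T V \<Longrightarrow> a \<in> C V \<Longrightarrow> r V V a = a"
    and "\<And>V W Z a. openin T V \<Longrightarrow> openin T W \<Longrightarrow> openin T Z \<Longrightarrow> W \<subseteq> V \<Longrightarrow> Z \<subseteq> W \<Longrightarrow> a \<in> C V \<Longrightarrow>
      r W Z (r V W a) = r V Z a"
    and "\<And>V W a. openin T V \<Longrightarrow> openin T W \<Longrightarrow> W \<subseteq> V \<Longrightarrow> a \<in> C V \<Longrightarrow> r V W a \<in> C W"
proof -
  note ax = assms[unfolded sheaf_def]
  show "r V V a = a" if "openin T V" "a \<in> C V" for V a
    using conjunct1[OF conjunct2[OF ax]] that by blast
  show "r W Z (r V W a) = r V Z a"
    if "openin T V" "openin T W" "openin T Z" "W \<subseteq> V" "Z \<subseteq> W" "a \<in> C V" for V W Z a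
    using conjunct1[OF conjunct2[OF conjunct2[OF ax]]] that by blast
  show "r V W a \<in> C W" if "openin T V" "openin T W" "W \<subseteq> V" "a \<in> C V" for V W a
    using conjunct1[OF ax] that by blast
qed

lemma superspace_presheaf:
  assumes "superspace Y" shows "super_presheaf Y"
proof -
  have sh: "sheaf (tp Y) (\<lambda>V. carrier (sec Y V)) (res Y)" using assms by (simp add: superspace_def)
  have res: "res Y V W \<in> super_ring_hom (sec Y V) (sec Y W)"
    if "V \<in> opens Y (whole Y)" "W \<in> opens Y V" for V W
    using assms that unfolding superspace_def by blast
  then have hom: "res Y V W \<in> ring_hom (sec Y V) (sec Y W)"
    if "V \<in> opens Y (whole Y)" "W \<in> opens Y V" for V W
    using that by (simp add: super_ring_hom_def)
  show ?thesis
  proof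
    show "supercommutative_ring (sec Y V)" if "V \<in> opens Y (whole Y)" for V
      using assms that unfolding superspace_def by blast
    show "res Y V W a \<in> gr (sec Y W) p"
      if "V \<in> opens Y (whole Y)" "W \<in> opens Y V" "a \<in> gr (sec Y V) p" for V W a p
      using res that by (simp add: super_ring_hom_def)
    show "res Y V V a = a" if "V \<in> opens Y (whole Y)" "a \<in> carrier (sec Y V)" for V a
      using sheaf_restrict(1)[OF sh] that by (simp add: opens_def)
    show "res Y W Z (res Y V W a) = res Y V Z a"
      if "V \<in> opens Y (whole Y)" "W \<in> opens Y V" "Z \<in> opens Y W" "a \<in> carrier (sec Y V)" for V W Z a
      using sheaf_restrict(2)[OF sh] that by (simp add: opens_def)
    show "alg Y V l \<in> carrier (sec Y V)" if "V \<in> opens Y (whole Y)" "l \<in> carrier (base Y)" for V l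
      using assms that by (auto simp: superspace_def super_ring_hom_def intro: ring_hom_closed)
  qed (use hom in \<open>auto intro: ring_hom_add ring_hom_mult ring_hom_one\<close>)
qed

context super_presheaf
begin

lemma res_closed:
  assumes "V \<in> opens Y (whole Y)" "W \<in> opens Y V" "a \<in> carrier (sec Y V)"
  shows "res Y V W a \<in> carrier (sec Y W)"
proof -
  interpret V: supercommutative "sec Y V" using sections[OF assms(1)] .
  interpret W: supercommutative "sec Y W" using sections[OF opens_trans[OF assms(1,2)]] .
  show ?thesis using assms(3)
    by (induction rule: V.homogeneous_induct)
      (auto simp: res_add[OF assms(1,2)] dest: res_gr[OF assms(1,2)] W.gr_carrier)
qed

lemma res_zero:
  assumes "V \<in> opens Y (whole Y)" "W \<in> opens Y V"
  shows "res Y V W \<zero>\<^bsub>sec Y V\<^esub> = \<zero>\<^bsub>sec Y W\<^esub>"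
proof -
  interpret V: supercommutative "sec Y V" using sections[OF assms(1)] .
  interpret W: supercommutative "sec Y W" using sections[OF opens_trans[OF assms(1,2)]] .
  show ?thesis
    using res_add[OF assms, of "\<zero>\<^bsub>sec Y V\<^esub>" "\<zero>\<^bsub>sec Y V\<^esub>"] res_closed[OF assms, of "\<zero>\<^bsub>sec Y V\<^esub>"]
    by (simp add: W.add.l_cancel_one')
qed

lemma res_neg:
  assumes "V \<in> opens Y (whole Y)" "W \<in> opens Y V" "a \<in> carrier (sec Y V)"
  shows "res Y V W (\<ominus>\<^bsub>sec Y V\<^esub> a) = \<ominus>\<^bsub>sec Y W\<^esub> res Y V W a"
proof -
  interpret V: supercommutative "sec Y V" using sections[OF assms(1)] .
  interpret W: supercommutative "sec Y W" using sections[OF opens_trans[OF assms(1,2)]] .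
  have "res Y V W (\<ominus>\<^bsub>sec Y V\<^esub> a) \<oplus>\<^bsub>sec Y W\<^esub> res Y V W a = \<zero>\<^bsub>sec Y W\<^esub>"
    using res_add[OF assms(1,2), of "\<ominus>\<^bsub>sec Y V\<^esub> a" a] assms(3) res_zero[OF assms(1,2)]
    by (simp add: V.l_neg)
  then show ?thesis
    using W.minus_equality res_closed[OF assms(1,2)] assms(3) V.a_inv_closed by metis
qed

lemma res_par:
  assumes "V \<in> opens Y (whole Y)" "W \<in> opens Y V" "a \<in> carrier (sec Y V)"
  shows "res Y V W (parity_involution (sec Y V) (gr (sec Y V)) a) =
    parity_involution (sec Y W) (gr (sec Y W)) (res Y V W a)"
proof -
  interpret V: supercommutative "sec Y V" using sections[OF assms(1)] .
  interpret W: supercommutative "sec Y W" using sections[OF opens_trans[OF assms(1,2)]] .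
  show ?thesis using assms(3)
  proof (induction rule: V.homogeneous_induct)
    case (homogeneous p a)
    then show ?case
      using V.gr_carrier[OF homogeneous]
      by (cases p) (simp_all add: V.par_homogeneous[OF homogeneous]
        W.par_homogeneous[OF res_gr[OF assms(1,2) homogeneous]] res_neg[OF assms(1,2)])
  qed (simp add: V.par_add W.par_add V.par_closed res_add[OF assms(1,2)] res_closed[OF assms(1,2)])
qed

text \<open>The conditions on a vector field over each open set, gathered into the operator formalism so that
  its lemmas apply to the values of vector fields.\<close>

lemma vf_iff:
  assumes "V \<in> opens Y (whole Y)"
  shows "v \<in> vf Y V p \<longleftrightarrow> v \<in> extensional (opens Y V) \<and>
    (\<forall>W\<in>opens Y V. v W \<in> extensional (carrier (sec Y W)) \<and> superderivation (sec Y W) p (v W) \<and>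
      (\<forall>l\<in>carrier (base Y). v W (alg Y W l) = \<zero>\<^bsub>sec Y W\<^esub>) \<and>
      (\<forall>W'\<in>opens Y W. \<forall>a\<in>carrier (sec Y W). res Y W W' (v W a) = v W' (res Y W W' a)))"
    (is "_ \<longleftrightarrow> ?r")
proof
  assume v: "v \<in> vf Y V p"
  have "superderivation (sec Y W) p (v W)" if W: "W \<in> opens Y V" for W
  proof -
    interpret supercommutative "sec Y W" using sections[OF opens_trans[OF assms W]] .
    show ?thesis using v W by (intro superderivationI) (auto simp: vf_def)
  qed
  then show ?r using v by (auto simp: vf_def PiE_iff)
next
  assume r: ?r
  have "(\<forall>a\<in>carrier (sec Y W). v W a \<in> carrier (sec Y W)) \<and>
      (\<forall>q. \<forall>a\<in>gr (sec Y W) q. v W a \<in> gr (sec Y W) (p \<noteq> q)) \<and>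
      (\<forall>a\<in>carrier (sec Y W). \<forall>b\<in>carrier (sec Y W).
          v W (a \<oplus>\<^bsub>sec Y W\<^esub> b) = v W a \<oplus>\<^bsub>sec Y W\<^esub> v W b) \<and>
      (\<forall>q. \<forall>a\<in>gr (sec Y W) q. \<forall>b\<in>carrier (sec Y W).
          v W (a \<otimes>\<^bsub>sec Y W\<^esub> b) =
            (v W a \<otimes>\<^bsub>sec Y W\<^esub> b) \<oplus>\<^bsub>sec Y W\<^esub> sg (sec Y W) (p \<and> q) (a \<otimes>\<^bsub>sec Y W\<^esub> v W b))"
    if W: "W \<in> opens Y V" for W
  proof -
    interpret super_operator "sec Y W" "regular_module (sec Y W)" p "v W" "v W" using r W by blast
    show ?thesis using d_closed d_gr d_add op_leibniz by simp
  qed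
  with r show "v \<in> vf Y V p" by (auto simp: vf_def PiE_iff)
qed

lemma vf_superderivation:
  "V \<in> opens Y (whole Y) \<Longrightarrow> v \<in> vf Y V p \<Longrightarrow> W \<in> opens Y V \<Longrightarrow> superderivation (sec Y W) p (v W)"
  by (simp add: vf_iff)

lemma vf_res_section:
  "V \<in> opens Y (whole Y) \<Longrightarrow> v \<in> vf Y V p \<Longrightarrow> W \<in> opens Y V \<Longrightarrow> W' \<in> opens Y W \<Longrightarrow>
    a \<in> carrier (sec Y W) \<Longrightarrow> res Y W W' (v W a) = v W' (res Y W W' a)"
  by (simp add: vf_iff)

text \<open>Vector fields are constructed from operators defined on all elements of the type; extensionality
  is added here.\<close>

lemma vf_restrictI:
  assumes V: "V \<in> opens Y (whole Y)"
    and d: "\<And>W. W \<in> opens Y V \<Longrightarrow> superderivation (sec Y W) p (d W)"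
    and alg: "\<And>W l. W \<in> opens Y V \<Longrightarrow> l \<in> carrier (base Y) \<Longrightarrow> d W (alg Y W l) = \<zero>\<^bsub>sec Y W\<^esub>"
    and res: "\<And>W W' a. W \<in> opens Y V \<Longrightarrow> W' \<in> opens Y W \<Longrightarrow> a \<in> carrier (sec Y W) \<Longrightarrow>
      res Y W W' (d W a) = d W' (res Y W W' a)"
  shows "(\<lambda>W\<in>opens Y V. \<lambda>a\<in>carrier (sec Y W). d W a) \<in> vf Y V p"
  unfolding vf_iff[OF V]
proof (intro conjI ballI)
  fix W assume W: "W \<in> opens Y V"
  note W' = opens_trans[OF V W]
  interpret super_operator "sec Y W" "regular_module (sec Y W)" p "d W" "d W" by (rule d[OF W])
  show "superderivation (sec Y W) p ((\<lambda>W\<in>opens Y V. \<lambda>a\<in>carrier (sec Y W). d W a) W)"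
    by (rule cong) (use W in simp_all)
next
  fix W l assume W: "W \<in> opens Y V" and l: "l \<in> carrier (base Y)"
  then show "(\<lambda>W\<in>opens Y V. \<lambda>a\<in>carrier (sec Y W). d W a) W (alg Y W l) = \<zero>\<^bsub>sec Y W\<^esub>"
    using alg[OF W l] alg_closed[OF opens_trans[OF V W] l] by simp
next
  fix W W' a assume W: "W \<in> opens Y V" and W': "W' \<in> opens Y W" and a: "a \<in> carrier (sec Y W)"
  then show "res Y W W' ((\<lambda>W\<in>opens Y V. \<lambda>a\<in>carrier (sec Y W). d W a) W a) =
      (\<lambda>W\<in>opens Y V. \<lambda>a\<in>carrier (sec Y W). d W a) W' (res Y W W' a)"
    using res[OF W W' a] res_closed[OF opens_trans[OF V W] W' a] opens_trans[OF W W'] by simp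
qed simp_all

lemma vf_add_vf:
  assumes V: "V \<in> opens Y (whole Y)" and v: "v \<in> vf Y V p" and w: "w \<in> vf Y V p"
  shows "vf_add Y V v w \<in> vf Y V p"
  unfolding vf_add_def
proof (rule vf_restrictI[OF V])
  fix W assume W: "W \<in> opens Y V"
  interpret v: super_operator "sec Y W" "regular_module (sec Y W)" p "v W" "v W"
    by (rule vf_superderivation[OF V v W])
  interpret w: super_operator "sec Y W" "regular_module (sec Y W)" p "w W" "w W"
    by (rule vf_superderivation[OF V w W])
  show "superderivation (sec Y W) p (\<lambda>a. v W a \<oplus>\<^bsub>sec Y W\<^esub> w W a)"
    using v.add_operator[OF w.super_operator_axioms] by simp
  show "v W (alg Y W l) \<oplus>\<^bsub>sec Y W\<^esub> w W (alg Y W l) = \<zero>\<^bsub>sec Y W\<^esub>" if "l \<in> carrier (base Y)" for l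
    using v w that W by (simp add: vf_iff[OF V])
  show "res Y W W' (v W a \<oplus>\<^bsub>sec Y W\<^esub> w W a) =
      v W' (res Y W W' a) \<oplus>\<^bsub>sec Y W'\<^esub> w W' (res Y W W' a)"
    if "W' \<in> opens Y W" "a \<in> carrier (sec Y W)" for W' a
    using that res_add[OF opens_trans[OF V W] that(1)] v.d_closed w.d_closed
      vf_res_section[OF V v W that] vf_res_section[OF V w W that] by simp
qed

lemma vf_smult_vf:
  assumes V: "V \<in> opens Y (whole Y)" and f: "f \<in> gr (sec Y V) q" and v: "v \<in> vf Y V p"
  shows "vf_smult Y V f v \<in> vf Y V (q \<noteq> p)"
  unfolding vf_smult_def
proof (rule vf_restrictI[OF V])
  fix W assume W: "W \<in> opens Y V"
  interpret v: super_operator "sec Y W" "regular_module (sec Y W)" p "v W" "v W"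
    by (rule vf_superderivation[OF V v W])
  interpret V: supercommutative "sec Y V" by (rule sections[OF V])
  note fW = res_gr[OF V W f]
  show "superderivation (sec Y W) (q \<noteq> p) (\<lambda>a. res Y V W f \<otimes>\<^bsub>sec Y W\<^esub> v W a)"
    using v.smult_operator[OF fW] by simp
  show "res Y V W f \<otimes>\<^bsub>sec Y W\<^esub> v W (alg Y W l) = \<zero>\<^bsub>sec Y W\<^esub>" if "l \<in> carrier (base Y)" for l
    using v that W v.gr_carrier[OF fW] by (simp add: vf_iff[OF V])
  show "res Y W W' (res Y V W f \<otimes>\<^bsub>sec Y W\<^esub> v W a) =
      res Y V W' f \<otimes>\<^bsub>sec Y W'\<^esub> v W' (res Y W W' a)"
    if "W' \<in> opens Y W" "a \<in> carrier (sec Y W)" for W' a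
    using that res_mult[OF opens_trans[OF V W] that(1)] v.d_closed v.gr_carrier[OF fW]
      vf_res_section[OF V v W that] res_res[OF V W that(1) V.gr_carrier[OF f]] by simp
qed

lemma vf_bracket_vf:
  assumes V: "V \<in> opens Y (whole Y)" and v: "v \<in> vf Y V p" and w: "w \<in> vf Y V q"
  shows "vf_bracket Y V p q v w \<in> vf Y V (p \<noteq> q)"
  unfolding vf_bracket_def
proof (rule vf_restrictI[OF V])
  fix W assume W: "W \<in> opens Y V"
  interpret v: super_operator "sec Y W" "regular_module (sec Y W)" p "v W" "v W"
    by (rule vf_superderivation[OF V v W])
  interpret w: super_operator "sec Y W" "regular_module (sec Y W)" q "w W" "w W"
    by (rule vf_superderivation[OF V w W])
  show "superderivation (sec Y W) (p \<noteq> q)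
      (\<lambda>a. v W (w W a) \<ominus>\<^bsub>sec Y W\<^esub> sg (sec Y W) (p \<and> q) (w W (v W a)))"
    using v.bracket_operator[OF w.super_operator_axioms] by simp
  show "v W (w W (alg Y W l)) \<ominus>\<^bsub>sec Y W\<^esub> sg (sec Y W) (p \<and> q) (w W (v W (alg Y W l))) =
      \<zero>\<^bsub>sec Y W\<^esub>" if "l \<in> carrier (base Y)" for l
    using v w that W v.d_zero w.d_zero
    by (cases p; cases q) (simp_all add: vf_iff[OF V] a_minus_def)
  show "res Y W W' (v W (w W a) \<ominus>\<^bsub>sec Y W\<^esub> sg (sec Y W) (p \<and> q) (w W (v W a))) =
      v W' (w W' (res Y W W' a)) \<ominus>\<^bsub>sec Y W'\<^esub> sg (sec Y W') (p \<and> q) (w W' (v W' (res Y W W' a)))"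
    if "W' \<in> opens Y W" "a \<in> carrier (sec Y W)" for W' a
  proof -
    note W' = opens_trans[OF W that(1)]
    interpret v': super_operator "sec Y W'" "regular_module (sec Y W')" p "v W'" "v W'"
      by (rule vf_superderivation[OF V v W'])
    interpret w': super_operator "sec Y W'" "regular_module (sec Y W')" q "w W'" "w W'"
      by (rule vf_superderivation[OF V w W'])
    show ?thesis
      using that res_add[OF opens_trans[OF V W] that(1)] res_neg[OF opens_trans[OF V W] that(1)]
        v.d_closed w.d_closed v'.d_closed w'.d_closed res_closed[OF opens_trans[OF V W] that]
        vf_res_section[OF V v W that(1)] vf_res_section[OF V w W that(1)]
      by (cases p; cases q) (simp_all add: a_minus_def)
  qed
qed

lemma vf_res_vf:
  assumes "V \<in> opens Y (whole Y)" "W \<in> opens Y V" "v \<in> vf Y V p"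
  shows "vf_res Y W v \<in> vf Y W p"
proof -
  have *: "v W' = vf_res Y W v W'" if "W' \<in> opens Y W" for W' using that by (simp add: vf_res_def)
  have sub: "W' \<in> opens Y V" if "W' \<in> opens Y W" for W' using opens_trans[OF assms(2) that] .
  show ?thesis
    unfolding vf_iff[OF opens_trans[OF assms(1,2)]]
  proof (intro conjI ballI)
    show "vf_res Y W v \<in> extensional (opens Y W)" by (simp add: vf_res_def)
    fix Z assume Z: "Z \<in> opens Y W"
    show "res Y Z W' (vf_res Y W v Z a) = vf_res Y W v W' (res Y Z W' a)"
      if "W' \<in> opens Y Z" "a \<in> carrier (sec Y Z)" for W' a
      using vf_res_section[OF assms(1,3) sub[OF Z] that] *[OF Z] *[OF opens_trans[OF Z that(1)]]
      by simp
  qed (use assms(3) sub in \<open>simp_all add: *[symmetric] vf_iff[OF assms(1)]\<close>)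
qed

end

section \<open>Modules with connection\<close>

locale super_dmodule = super_presheaf Y for Y :: "('x, 'a, 'l) superspace" +
  fixes F :: "('x, 'a, 'b) dmod"
  assumes dmodule: "dmodule Y F"
begin

lemma supermodule_sections:
  assumes "V \<in> opens Y (whole Y)" shows "supermodule (sec Y V) (msec F V)"
  using assms dmodule sections[OF assms]
  by (simp add: dmodule_def module_sheaf_def supermodule_def supermodule_axioms_def)

lemma
  assumes "V \<in> opens Y (whole Y)" "v \<in> vf Y V p"
  shows conn_operator: "super_operator (sec Y V) (msec F V) p (v V) (conn F V v)"
    and conn_vf_add: "\<And>w m. w \<in> vf Y V p \<Longrightarrow> m \<in> carrier (msec F V) \<Longrightarrow>
      conn F V (vf_add Y V v w) m = conn F V v m \<oplus>\<^bsub>msec F V\<^esub> conn F V w m"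
    and conn_vf_smult: "\<And>q f m. f \<in> gr (sec Y V) q \<Longrightarrow> m \<in> carrier (msec F V) \<Longrightarrow>
      conn F V (vf_smult Y V f v) m = f \<odot>\<^bsub>msec F V\<^esub> conn F V v m"
    and conn_res: "\<And>W m. W \<in> opens Y V \<Longrightarrow> m \<in> carrier (msec F V) \<Longrightarrow>
      mres F V W (conn F V v m) = conn F W (vf_res Y W v) (mres F V W m)"
proof -
  interpret supermodule "sec Y V" "msec F V" by (rule supermodule_sections[OF assms(1)])
  interpret v: super_operator "sec Y V" "regular_module (sec Y V)" p "v V" "v V"
    by (rule vf_superderivation[OF assms opens_self[OF assms(1)]])
  note c = dmodule[unfolded dmodule_def connection_def, THEN conjunct2, THEN conjunct1,
    rule_format, OF assms]
  show "super_operator (sec Y V) (msec F V) p (v V) (conn F V v)"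
    by unfold_locales (use c v.d_gr v.d_add in blast)+
qed (use dmodule[unfolded dmodule_def connection_def, THEN conjunct2, THEN conjunct1,
    rule_format, OF assms] in blast)+

lemma mres_closed:
  assumes "V \<in> opens Y (whole Y)" "W \<in> opens Y V" "m \<in> carrier (msec F V)"
  shows "mres F V W m \<in> carrier (msec F W)"
proof -
  have "sheaf (tp Y) (\<lambda>V. carrier (msec F V)) (mres F)"
    using dmodule by (simp add: dmodule_def module_sheaf_def)
  from sheaf_restrict(3)[OF this] show ?thesis using assms by (auto simp: opens_def)
qed

lemma mres_id:
  assumes "V \<in> opens Y (whole Y)" "m \<in> carrier (msec F V)"
  shows "mres F V V m = m"
proof -
  have "sheaf (tp Y) (\<lambda>V. carrier (msec F V)) (mres F)"
    using dmodule by (simp add: dmodule_def module_sheaf_def)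
  from sheaf_restrict(1)[OF this] show ?thesis using assms by (simp add: opens_def)
qed

lemma
  assumes "V \<in> opens Y (whole Y)" "W \<in> opens Y V"
  shows mres_gr: "\<And>p m. m \<in> mgr (msec F V) p \<Longrightarrow> mres F V W m \<in> mgr (msec F W) p"
    and mres_add: "\<And>m n. m \<in> carrier (msec F V) \<Longrightarrow> n \<in> carrier (msec F V) \<Longrightarrow>
      mres F V W (m \<oplus>\<^bsub>msec F V\<^esub> n) = mres F V W m \<oplus>\<^bsub>msec F W\<^esub> mres F V W n"
    and mres_smult: "\<And>f m. f \<in> carrier (sec Y V) \<Longrightarrow> m \<in> carrier (msec F V) \<Longrightarrow>
      mres F V W (f \<odot>\<^bsub>msec F V\<^esub> m) = res Y V W f \<odot>\<^bsub>msec F W\<^esub> mres F V W m"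
  using dmodule[unfolded dmodule_def module_sheaf_def, THEN conjunct1, THEN conjunct2,
      rule_format, OF assms(1), THEN conjunct2, rule_format, OF assms(2)] by blast+

end

section \<open>Coordinates\<close>

text \<open>The assumption on halves holds on a supercurve because the base is a \<open>\<complex>\<close>-algebra.\<close>

locale coordinate_patch = super_presheaf Y
  for Y :: "('x, 'a, 'l) superspace" and z \<theta> :: 'a +
  assumes coordinates: "coordinates Y z \<theta>"
    and half: "V \<in> opens Y (whole Y) \<Longrightarrow> \<exists>h\<in>carrier (sec Y V). h \<oplus>\<^bsub>sec Y V\<^esub> h = \<one>\<^bsub>sec Y V\<^esub>"
begin

abbreviation z_on where "z_on V \<equiv> res Y (whole Y) V z"
abbreviation \<theta>_on where "\<theta>_on V \<equiv> res Y (whole Y) V \<theta>"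
abbreviation pz where "pz V \<equiv> partial_z Y z \<theta> V"
abbreviation pt where "pt V \<equiv> partial_\<theta> Y z \<theta> V"

lemma z_on_gr: "V \<in> opens Y (whole Y) \<Longrightarrow> z_on V \<in> gr (sec Y V) False"
  using coordinates res_gr[OF whole_open] by (auto simp: coordinates_def)

lemma \<theta>_on_gr: "V \<in> opens Y (whole Y) \<Longrightarrow> \<theta>_on V \<in> gr (sec Y V) True"
  using coordinates res_gr[OF whole_open] by (auto simp: coordinates_def)

lemma coordinates_closed:
  assumes "V \<in> opens Y (whole Y)"
  shows "z_on V \<in> carrier (sec Y V)" "\<theta>_on V \<in> carrier (sec Y V)"
proof -
  interpret supercommutative "sec Y V" by (rule sections[OF assms])
  show "z_on V \<in> carrier (sec Y V)" "\<theta>_on V \<in> carrier (sec Y V)"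
    using z_on_gr[OF assms] \<theta>_on_gr[OF assms] gr_carrier by blast+
qed

lemma coordinates_res:
  assumes "V \<in> opens Y (whole Y)" "W \<in> opens Y V"
  shows "res Y V W (z_on V) = z_on W" "res Y V W (\<theta>_on V) = \<theta>_on W"
proof -
  have "whole Y \<in> opens Y (whole Y)" by (rule whole_open)
  then interpret supercommutative "sec Y (whole Y)" by (rule sections)
  have "z \<in> carrier (sec Y (whole Y))" "\<theta> \<in> carrier (sec Y (whole Y))"
    using coordinates gr_carrier by (auto simp: coordinates_def)
  then show "res Y V W (z_on V) = z_on W" "res Y V W (\<theta>_on V) = \<theta>_on W"
    using res_res[OF whole_open assms] by auto
qed

lemma coordinates_bij:
  "V \<in> opens Y (whole Y) \<Longrightarrow> bij_betw (\<lambda>v. (v V (z_on V), v V (\<theta>_on V)))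
     (vf Y V p) (gr (sec Y V) p \<times> gr (sec Y V) (\<not> p))"
  using coordinates by (simp add: coordinates_def)

lemma vf_eqI:
  assumes "V \<in> opens Y (whole Y)" "v \<in> vf Y V p" "w \<in> vf Y V p"
    and "v V (z_on V) = w V (z_on V)" "v V (\<theta>_on V) = w V (\<theta>_on V)"
  shows "v = w"
  using bij_betw_imp_inj_on[OF coordinates_bij[OF assms(1), of p]] assms(2-5)
  by (simp add: inj_on_def)

lemma vf_existence:
  assumes "V \<in> opens Y (whole Y)" "a \<in> gr (sec Y V) p" "b \<in> gr (sec Y V) (\<not> p)"
  obtains v where "v \<in> vf Y V p" "v V (z_on V) = a" "v V (\<theta>_on V) = b"
proof -
  have "(a, b) \<in> (\<lambda>v. (v V (z_on V), v V (\<theta>_on V))) ` vf Y V p"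
    using bij_betw_imp_surj_on[OF coordinates_bij[OF assms(1), of p]] assms(2,3) by simp
  then show thesis using that by auto
qed

lemma partial_z:
  assumes "V \<in> opens Y (whole Y)"
  shows "pz V \<in> vf Y V False" "pz V V (z_on V) = \<one>\<^bsub>sec Y V\<^esub>" "pz V V (\<theta>_on V) = \<zero>\<^bsub>sec Y V\<^esub>"
proof -
  interpret supercommutative "sec Y V" by (rule sections[OF assms])
  obtain v where v: "v \<in> vf Y V False" "v V (z_on V) = \<one>\<^bsub>sec Y V\<^esub>" "v V (\<theta>_on V) = \<zero>\<^bsub>sec Y V\<^esub>"
    using vf_existence[OF assms gr_one gr_zero] .
  have "pz V \<in> vf Y V False \<and> pz V V (z_on V) = \<one>\<^bsub>sec Y V\<^esub> \<and> pz V V (\<theta>_on V) = \<zero>\<^bsub>sec Y V\<^esub>"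
    unfolding partial_z_def by (rule theI[of _ v]) (use v vf_eqI[OF assms] in auto)
  then show "pz V \<in> vf Y V False" "pz V V (z_on V) = \<one>\<^bsub>sec Y V\<^esub>" "pz V V (\<theta>_on V) = \<zero>\<^bsub>sec Y V\<^esub>"
    by auto
qed

lemma partial_\<theta>:
  assumes "V \<in> opens Y (whole Y)"
  shows "pt V \<in> vf Y V True" "pt V V (z_on V) = \<zero>\<^bsub>sec Y V\<^esub>" "pt V V (\<theta>_on V) = \<one>\<^bsub>sec Y V\<^esub>"
proof -
  interpret supercommutative "sec Y V" by (rule sections[OF assms])
  obtain v where v: "v \<in> vf Y V True" "v V (z_on V) = \<zero>\<^bsub>sec Y V\<^esub>" "v V (\<theta>_on V) = \<one>\<^bsub>sec Y V\<^esub>"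
    using vf_existence[OF assms gr_zero[of True], of "\<one>\<^bsub>sec Y V\<^esub>"] gr_one by auto
  have "pt V \<in> vf Y V True \<and> pt V V (z_on V) = \<zero>\<^bsub>sec Y V\<^esub> \<and> pt V V (\<theta>_on V) = \<one>\<^bsub>sec Y V\<^esub>"
    unfolding partial_\<theta>_def by (rule theI[of _ v]) (use v vf_eqI[OF assms] in auto)
  then show "pt V \<in> vf Y V True" "pt V V (z_on V) = \<zero>\<^bsub>sec Y V\<^esub>" "pt V V (\<theta>_on V) = \<one>\<^bsub>sec Y V\<^esub>"
    by auto
qed

text \<open>The restriction of a coordinate field takes the same values on the restricted coordinates, which
  determine it.\<close>

lemma partial_res:
  assumes V: "V \<in> opens Y (whole Y)" and W: "W \<in> opens Y V"
  shows "vf_res Y W (pz V) = pz W" "vf_res Y W (pt V) = pt W"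
proof -
  note W' = opens_trans[OF V W]
  have eq: "vf_res Y W v W = v W" for v using opens_self[OF W] by (simp add: vf_res_def)
  have r: "v W (z_on W) = res Y V W (v V (z_on V))" "v W (\<theta>_on W) = res Y V W (v V (\<theta>_on V))"
    if "v \<in> vf Y V p" for v p
    using vf_res_section[OF V that opens_self[OF V] W] coordinates_closed[OF V]
      coordinates_res[OF V W] by simp_all
  show "vf_res Y W (pz V) = pz W"
    using r[OF partial_z(1)[OF V]] partial_z[OF V] partial_z[OF W'] res_one[OF V W] res_zero[OF V W]
    by (intro vf_eqI[OF W' vf_res_vf[OF V W]]) (simp_all add: eq)
  show "vf_res Y W (pt V) = pt W"
    using r[OF partial_\<theta>(1)[OF V]] partial_\<theta>[OF V] partial_\<theta>[OF W'] res_one[OF V W] res_zero[OF V W]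
    by (intro vf_eqI[OF W' vf_res_vf[OF V W]]) (simp_all add: eq)
qed

lemma partial_eq:
  assumes V: "V \<in> opens Y (whole Y)" and W: "W \<in> opens Y V"
  shows "pz V W = pz W W" "pt V W = pt W W"
  using partial_res[OF V W, THEN fun_cong, of W] opens_self[OF W] by (simp_all add: vf_res_def)

lemma partial_res_section:
  assumes V: "V \<in> opens Y (whole Y)" and W: "W \<in> opens Y V" and a: "a \<in> carrier (sec Y V)"
  shows "res Y V W (pz V V a) = pz W W (res Y V W a)" "res Y V W (pt V V a) = pt W W (res Y V W a)"
  using vf_res_section[OF V _ opens_self[OF V] W a] partial_z(1)[OF V] partial_\<theta>(1)[OF V]
    partial_eq[OF V W] by simp_all

lemma vf_expansion:
  assumes V: "V \<in> opens Y (whole Y)" and v: "v \<in> vf Y V p"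
  shows "v V (z_on V) \<in> gr (sec Y V) p" "v V (\<theta>_on V) \<in> gr (sec Y V) (\<not> p)"
    and "vf_smult Y V (v V (z_on V)) (pz V) \<in> vf Y V p"
    and "vf_smult Y V (v V (\<theta>_on V)) (pt V) \<in> vf Y V p"
    and "v = vf_add Y V (vf_smult Y V (v V (z_on V)) (pz V)) (vf_smult Y V (v V (\<theta>_on V)) (pt V))"
proof -
  interpret v: super_operator "sec Y V" "regular_module (sec Y V)" p "v V" "v V"
    by (rule vf_superderivation[OF V v opens_self[OF V]])
  show gr: "v V (z_on V) \<in> gr (sec Y V) p" "v V (\<theta>_on V) \<in> gr (sec Y V) (\<not> p)"
    using v.d_gr[OF z_on_gr[OF V]] v.d_gr[OF \<theta>_on_gr[OF V]] by (cases p; simp)+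
  show 1: "vf_smult Y V (v V (z_on V)) (pz V) \<in> vf Y V p"
    using vf_smult_vf[OF V gr(1) partial_z(1)[OF V]] by simp
  show 2: "vf_smult Y V (v V (\<theta>_on V)) (pt V) \<in> vf Y V p"
    using vf_smult_vf[OF V gr(2) partial_\<theta>(1)[OF V]] by simp
  show "v = vf_add Y V (vf_smult Y V (v V (z_on V)) (pz V)) (vf_smult Y V (v V (\<theta>_on V)) (pt V))"
    using opens_self[OF V] coordinates_closed[OF V] gr[THEN v.gr_carrier]
      partial_z[OF V] partial_\<theta>[OF V]
    by (intro vf_eqI[OF V v vf_add_vf[OF V 1 2]])
      (simp_all add: vf_add_def vf_smult_def res_id[OF V])
qed

lemma vf_value:
  assumes V: "V \<in> opens Y (whole Y)" and v: "v \<in> vf Y V p" and a: "a \<in> carrier (sec Y V)"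
  shows "v V a = (v V (z_on V) \<otimes>\<^bsub>sec Y V\<^esub> pz V V a) \<oplus>\<^bsub>sec Y V\<^esub> (v V (\<theta>_on V) \<otimes>\<^bsub>sec Y V\<^esub> pt V V a)"
proof -
  interpret supercommutative "sec Y V" by (rule sections[OF V])
  show ?thesis
    using fun_cong[OF fun_cong[OF vf_expansion(5)[OF V v]], of V a] a opens_self[OF V]
      vf_expansion(1,2)[OF V v, THEN gr_carrier]
    by (simp add: vf_add_def vf_smult_def res_id[OF V])
qed

text \<open>A vector field killing both coordinates is zero. It is convenient to say that it equals its
  own multiple by \<open>0\<close>, because linearity of a connection in the vector field then yields that the
  contraction vanishes as well.\<close>

lemma vf_vanishing:
  assumes V: "V \<in> opens Y (whole Y)" and v: "v \<in> vf Y V p"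
    and "v V (z_on V) = \<zero>\<^bsub>sec Y V\<^esub>" "v V (\<theta>_on V) = \<zero>\<^bsub>sec Y V\<^esub>"
  shows "v = vf_smult Y V \<zero>\<^bsub>sec Y V\<^esub> v"
proof -
  interpret supercommutative "sec Y V" by (rule sections[OF V])
  have *: "vf_smult Y V \<zero>\<^bsub>sec Y V\<^esub> v \<in> vf Y V p"
    using vf_smult_vf[OF V gr_zero v, of False] by simp
  show ?thesis
    using assms opens_self[OF V] coordinates_closed[OF V]
    by (intro vf_eqI[OF V v *]) (simp_all add: vf_smult_def res_id)
qed

text \<open>The brackets of coordinate fields annihilate both coordinates, whose derivatives are the constants
  \<open>0\<close> and \<open>1\<close>.\<close>

lemma bracket_vanishing:
  assumes V: "V \<in> opens Y (whole Y)"
  shows "vf_bracket Y V False True (pz V) (pt V) =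
      vf_smult Y V \<zero>\<^bsub>sec Y V\<^esub> (vf_bracket Y V False True (pz V) (pt V))"
    and "vf_bracket Y V True True (pt V) (pt V) =
      vf_smult Y V \<zero>\<^bsub>sec Y V\<^esub> (vf_bracket Y V True True (pt V) (pt V))"
proof -
  note z = partial_z[OF V] and t = partial_\<theta>[OF V]
  interpret z: super_operator "sec Y V" "regular_module (sec Y V)" False "pz V V" "pz V V"
    by (rule vf_superderivation[OF V z(1) opens_self[OF V]])
  interpret t: super_operator "sec Y V" "regular_module (sec Y V)" True "pt V V" "pt V V"
    by (rule vf_superderivation[OF V t(1) opens_self[OF V]])
  have one: "pz V V \<one>\<^bsub>sec Y V\<^esub> = \<zero>\<^bsub>sec Y V\<^esub>" "pt V V \<one>\<^bsub>sec Y V\<^esub> = \<zero>\<^bsub>sec Y V\<^esub>"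
    using z.op_leibniz[OF z.gr_one, of "\<one>\<^bsub>sec Y V\<^esub>"] t.op_leibniz[OF z.gr_one, of "\<one>\<^bsub>sec Y V\<^esub>"]
      z.d_closed[of "\<one>\<^bsub>sec Y V\<^esub>"] t.d_closed[of "\<one>\<^bsub>sec Y V\<^esub>"]
    by (simp_all add: z.add.l_cancel_one')
  show "vf_bracket Y V False True (pz V) (pt V) =
      vf_smult Y V \<zero>\<^bsub>sec Y V\<^esub> (vf_bracket Y V False True (pz V) (pt V))"
    by (rule vf_vanishing[OF V vf_bracket_vf[OF V z(1) t(1)]])
      (use opens_self[OF V] coordinates_closed[OF V] in
        \<open>simp_all add: vf_bracket_def z t one z.d_zero t.d_zero a_minus_def\<close>)
  show "vf_bracket Y V True True (pt V) (pt V) =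
      vf_smult Y V \<zero>\<^bsub>sec Y V\<^esub> (vf_bracket Y V True True (pt V) (pt V))"
    by (rule vf_vanishing[OF V vf_bracket_vf[OF V t(1) t(1)]])
      (use opens_self[OF V] coordinates_closed[OF V] in
        \<open>simp_all add: vf_bracket_def z t one z.d_zero t.d_zero a_minus_def\<close>)
qed

lemma \<theta>_square:
  assumes V: "V \<in> opens Y (whole Y)"
  shows "\<theta>_on V \<otimes>\<^bsub>sec Y V\<^esub> \<theta>_on V = \<zero>\<^bsub>sec Y V\<^esub>"
proof -
  interpret supercommutative "sec Y V" by (rule sections[OF V])
  interpret supermodule "sec Y V" "regular_module (sec Y V)" by (rule supermodule_regular)
  obtain h where h: "h \<in> carrier (sec Y V)" "h \<oplus>\<^bsub>sec Y V\<^esub> h = \<one>\<^bsub>sec Y V\<^esub>" using half[OF V] by blast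
  let ?q = "\<theta>_on V \<otimes>\<^bsub>sec Y V\<^esub> \<theta>_on V"
  have q: "?q \<in> carrier (sec Y V)" using coordinates_closed[OF V] by simp
  have "?q = \<ominus>\<^bsub>sec Y V\<^esub> ?q"
    using supercommute[OF \<theta>_on_gr[OF V] \<theta>_on_gr[OF V]] by simp
  then have "?q \<oplus>\<^bsub>sec Y V\<^esub> ?q = ?q \<oplus>\<^bsub>sec Y V\<^esub> (\<ominus>\<^bsub>sec Y V\<^esub> ?q)"
    by (rule arg_cong)
  then show ?thesis using double_eq_zero[OF h, of ?q] r_neg[OF q] q by simp
qed

lemma odd_plane_sections:
  assumes V: "V \<in> opens Y (whole Y)"
  shows "odd_plane (sec Y V) (regular_module (sec Y V)) (pz V V) (pz V V) (pt V V) (pt V V) (\<theta>_on V)"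
proof -
  note z = partial_z[OF V] and t = partial_\<theta>[OF V]
  interpret z: super_operator "sec Y V" "regular_module (sec Y V)" False "pz V V" "pz V V"
    by (rule vf_superderivation[OF V z(1) opens_self[OF V]])
  interpret t: super_operator "sec Y V" "regular_module (sec Y V)" True "pt V V" "pt V V"
    by (rule vf_superderivation[OF V t(1) opens_self[OF V]])
  obtain h where h: "h \<in> carrier (sec Y V)" "h \<oplus>\<^bsub>sec Y V\<^esub> h = \<one>\<^bsub>sec Y V\<^esub>" using half[OF V] by blast
  show ?thesis
  proof
    show "\<theta>_on V \<in> gr (sec Y V) True" by (rule \<theta>_on_gr[OF V])
    show "\<theta>_on V \<otimes>\<^bsub>sec Y V\<^esub> \<theta>_on V = \<zero>\<^bsub>sec Y V\<^esub>" by (rule \<theta>_square[OF V])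
    fix x assume x: "x \<in> carrier (regular_module (sec Y V))"
    have "pz V V (pt V V x) \<ominus>\<^bsub>sec Y V\<^esub> pt V V (pz V V x) = \<zero>\<^bsub>sec Y V\<^esub>"
      using fun_cong[OF fun_cong[OF bracket_vanishing(1)[OF V]], of V x] x opens_self[OF V]
      by (simp add: vf_bracket_def vf_smult_def res_id[OF V] z.d_closed t.d_closed)
    then show "pz V V (pt V V x) = pt V V (pz V V x)"
      using x z.minus_eq_zeroD by (simp add: z.d_closed t.d_closed)
    have "pt V V (pt V V x) \<oplus>\<^bsub>sec Y V\<^esub> pt V V (pt V V x) = \<zero>\<^bsub>sec Y V\<^esub>"
      using fun_cong[OF fun_cong[OF bracket_vanishing(2)[OF V]], of V x] x opens_self[OF V]
      by (simp add: vf_bracket_def vf_smult_def res_id[OF V] z.d_closed t.d_closed a_minus_def)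
    then show "pt V V (pt V V x) = \<zero>\<^bsub>regular_module (sec Y V)\<^esub>"
      using z.double_eq_zero[OF h, of "pt V V (pt V V x)"] x by (simp add: t.d_closed)
  qed (simp_all add: z t)
qed

end

locale patch_dmodule = coordinate_patch Y z \<theta> + super_dmodule Y F
  for Y :: "('x, 'a, 'l) superspace" and z \<theta> :: 'a and F :: "('x, 'a, 'b) dmod"
begin

lemma conn_expansion:
  assumes V: "V \<in> opens Y (whole Y)" and v: "v \<in> vf Y V p" and m: "m \<in> carrier (msec F V)"
  shows "conn F V v m = (v V (z_on V) \<odot>\<^bsub>msec F V\<^esub> conn F V (pz V) m) \<oplus>\<^bsub>msec F V\<^esub>
    (v V (\<theta>_on V) \<odot>\<^bsub>msec F V\<^esub> conn F V (pt V) m)"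
  by (subst vf_expansion(5)[OF V v])
    (simp add: conn_vf_add[OF V vf_expansion(3)[OF V v] vf_expansion(4)[OF V v] m]
      conn_vf_smult[OF V partial_z(1)[OF V] vf_expansion(1)[OF V v] m]
      conn_vf_smult[OF V partial_\<theta>(1)[OF V] vf_expansion(2)[OF V v] m])

text \<open>Flatness for a pair of coordinate fields whose bracket vanishes gives the two relations between
  \<open>\<nabla>\<^sub>z\<close> and \<open>\<nabla>\<^sub>\<theta>\<close>; for the pair \<open>(\<partial>\<^sub>\<theta>, \<partial>\<^sub>\<theta>)\<close> it reads \<open>2 \<nabla>\<^sub>\<theta>\<^sup>2 = 0\<close>.\<close>

lemma odd_plane_module:
  assumes V: "V \<in> opens Y (whole Y)"
  shows "odd_plane (sec Y V) (msec F V) (pz V V) (conn F V (pz V)) (pt V V) (conn F V (pt V)) (\<theta>_on V)"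
proof -
  note z = partial_z[OF V] and t = partial_\<theta>[OF V]
  interpret z: super_operator "sec Y V" "msec F V" False "pz V V" "conn F V (pz V)"
    by (rule conn_operator[OF V z(1)])
  interpret t: super_operator "sec Y V" "msec F V" True "pt V V" "conn F V (pt V)"
    by (rule conn_operator[OF V t(1)])
  obtain h where h: "h \<in> carrier (sec Y V)" "h \<oplus>\<^bsub>sec Y V\<^esub> h = \<one>\<^bsub>sec Y V\<^esub>" using half[OF V] by blast
  have flat: "conn F V v (conn F V w m) \<ominus>\<^bsub>msec F V\<^esub> sg (msec F V) (p \<and> q) (conn F V w (conn F V v m)) =
      conn F V (vf_bracket Y V p q v w) m"
    if "v \<in> vf Y V p" "w \<in> vf Y V q" "m \<in> carrier (msec F V)" for p q v w m
    using dmodule V that unfolding dmodule_def flat_def by blast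
  have zero: "conn F V v m = \<zero>\<^bsub>msec F V\<^esub>"
    if "v \<in> vf Y V p" "v = vf_smult Y V \<zero>\<^bsub>sec Y V\<^esub> v" "m \<in> carrier (msec F V)" for v p m
  proof -
    interpret v: super_operator "sec Y V" "msec F V" p "v V" "conn F V v"
      by (rule conn_operator[OF V that(1)])
    show ?thesis
      using conn_vf_smult[OF V that(1) z.gr_zero that(3)] that(2,3)
      by (simp add: z.zero_smult v.op_closed)
  qed
  show ?thesis
  proof
    show "\<theta>_on V \<in> gr (sec Y V) True" by (rule \<theta>_on_gr[OF V])
    show "\<theta>_on V \<otimes>\<^bsub>sec Y V\<^esub> \<theta>_on V = \<zero>\<^bsub>sec Y V\<^esub>" by (rule \<theta>_square[OF V])
    fix x assume x: "x \<in> carrier (msec F V)"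
    show "conn F V (pz V) (conn F V (pt V) x) = conn F V (pt V) (conn F V (pz V) x)"
      using flat[OF z(1) t(1) x] zero[OF vf_bracket_vf[OF V z(1) t(1)] bracket_vanishing(1)[OF V] x]
        z.M.minus_eq_zeroD[of "conn F V (pz V) (conn F V (pt V) x)"] x by (simp add: z.op_closed t.op_closed)
    have "conn F V (pt V) (conn F V (pt V) x) \<oplus>\<^bsub>msec F V\<^esub> conn F V (pt V) (conn F V (pt V) x) =
        \<zero>\<^bsub>msec F V\<^esub>"
      using flat[OF t(1) t(1) x] zero[OF vf_bracket_vf[OF V t(1) t(1)] bracket_vanishing(2)[OF V] x]
        x by (simp add: a_minus_def t.op_closed)
    then show "conn F V (pt V) (conn F V (pt V) x) = \<zero>\<^bsub>msec F V\<^esub>"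
      using z.double_eq_zero[OF h, of "conn F V (pt V) (conn F V (pt V) x)"] x by (simp add: t.op_closed)
  qed (simp_all add: z t)
qed

end

section \<open>Transport of structure\<close>

lemma abelian_group_transport:
  assumes M: "abelian_group M" and bij: "bij_betw \<phi> (carrier M) (carrier N)"
    and add: "\<And>x y. x \<in> carrier M \<Longrightarrow> y \<in> carrier M \<Longrightarrow> \<phi> (x \<oplus>\<^bsub>M\<^esub> y) = \<phi> x \<oplus>\<^bsub>N\<^esub> \<phi> y"
    and zero: "\<phi> \<zero>\<^bsub>M\<^esub> = \<zero>\<^bsub>N\<^esub>"
  shows "abelian_group N" and "x \<in> carrier M \<Longrightarrow> \<phi> (\<ominus>\<^bsub>M\<^esub> x) = \<ominus>\<^bsub>N\<^esub> \<phi> x"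
proof -
  interpret M: abelian_group M by fact
  have surj: "\<exists>x\<in>carrier M. y = \<phi> x" if "y \<in> carrier N" for y
    using bij that by (auto simp: bij_betw_def)
  have cl: "\<phi> x \<in> carrier N" if "x \<in> carrier M" for x using bij_betwE[OF bij] that by blast
  show N: "abelian_group N"
  proof (rule abelian_groupI)
    fix x y z assume "x \<in> carrier N" "y \<in> carrier N" "z \<in> carrier N"
    then obtain a b c where abc: "a \<in> carrier M" "b \<in> carrier M" "c \<in> carrier M"
      "x = \<phi> a" "y = \<phi> b" "z = \<phi> c" using surj by metis
    then show "x \<oplus>\<^bsub>N\<^esub> y \<oplus>\<^bsub>N\<^esub> z = x \<oplus>\<^bsub>N\<^esub> (y \<oplus>\<^bsub>N\<^esub> z)"
      by (simp add: add[symmetric] M.a_assoc)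
  next
    fix x y assume "x \<in> carrier N" "y \<in> carrier N"
    then obtain a b where abc: "a \<in> carrier M" "b \<in> carrier M" "x = \<phi> a" "y = \<phi> b"
      using surj by metis
    then show "x \<oplus>\<^bsub>N\<^esub> y \<in> carrier N" "x \<oplus>\<^bsub>N\<^esub> y = y \<oplus>\<^bsub>N\<^esub> x"
      by (simp_all add: add[symmetric] cl M.a_comm)
  next
    show "\<zero>\<^bsub>N\<^esub> \<in> carrier N" using cl[OF M.zero_closed] zero by simp
  next
    fix x assume "x \<in> carrier N"
    then obtain a where a: "a \<in> carrier M" "x = \<phi> a" using surj by metis
    then show "\<zero>\<^bsub>N\<^esub> \<oplus>\<^bsub>N\<^esub> x = x" by (simp add: zero[symmetric] add[symmetric])
    show "\<exists>y\<in>carrier N. y \<oplus>\<^bsub>N\<^esub> x = \<zero>\<^bsub>N\<^esub>"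
      using a by (intro bexI[of _ "\<phi> (\<ominus>\<^bsub>M\<^esub> a)"]) (simp_all add: zero[symmetric] add[symmetric] cl M.l_neg)
  qed
  interpret N: abelian_group N by fact
  show "\<phi> (\<ominus>\<^bsub>M\<^esub> x) = \<ominus>\<^bsub>N\<^esub> \<phi> x" if x: "x \<in> carrier M"
    by (rule sym, rule N.minus_equality) (simp_all add: x cl add[symmetric] zero M.l_neg)
qed

lemma graded_group_transport:
  assumes M: "graded_abelian_group M g" and bij: "bij_betw \<phi> (carrier M) (carrier N)"
    and add: "\<And>x y. x \<in> carrier M \<Longrightarrow> y \<in> carrier M \<Longrightarrow> \<phi> (x \<oplus>\<^bsub>M\<^esub> y) = \<phi> x \<oplus>\<^bsub>N\<^esub> \<phi> y"
    and zero: "\<phi> \<zero>\<^bsub>M\<^esub> = \<zero>\<^bsub>N\<^esub>"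
    and gr: "\<And>p. \<phi> ` g p = g' p"
  shows "graded_abelian_group N g'"
proof -
  interpret M: graded_abelian_group M g by fact
  note tr = abelian_group_transport[OF M.abelian_group_axioms bij add zero]
  have inj: "\<phi> x = \<phi> y \<longleftrightarrow> x = y" if "x \<in> carrier M" "y \<in> carrier M" for x y
    using bij that by (auto simp: bij_betw_def inj_on_eq_iff)
  have "g' p \<subseteq> carrier N" for p
    using bij_betwE[OF bij] M.gr_carrier by (auto simp: gr[symmetric])
  moreover have "\<zero>\<^bsub>N\<^esub> \<in> g' p" for p using M.gr_zero by (auto simp: gr[symmetric] zero[symmetric])
  moreover have "x \<oplus>\<^bsub>N\<^esub> y \<in> g' p" if "x \<in> g' p" "y \<in> g' p" for x y p
    using that M.gr_add M.gr_carrier by (auto simp: gr[symmetric] add[symmetric])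
  moreover have "\<ominus>\<^bsub>N\<^esub> x \<in> g' p" if "x \<in> g' p" for x p
    using that M.gr_neg M.gr_carrier by (auto simp: gr[symmetric] tr(2)[symmetric])
  moreover have "\<exists>!y. fst y \<in> g' False \<and> snd y \<in> g' True \<and> x = fst y \<oplus>\<^bsub>N\<^esub> snd y"
    if x_in: "x \<in> carrier N" for x
  proof -
    obtain m where m: "m \<in> carrier M" "x = \<phi> m" using bij x_in by (auto simp: bij_betw_def)
    obtain a b where ab: "a \<in> g False" "b \<in> g True" "m = a \<oplus>\<^bsub>M\<^esub> b"
      using M.decomposition[OF m(1)] by blast
    show ?thesis
    proof (rule ex1I[of _ "(\<phi> a, \<phi> b)"])
      show "fst (\<phi> a, \<phi> b) \<in> g' False \<and> snd (\<phi> a, \<phi> b) \<in> g' True \<and>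
          x = fst (\<phi> a, \<phi> b) \<oplus>\<^bsub>N\<^esub> snd (\<phi> a, \<phi> b)"
        using ab m M.gr_carrier by (auto simp: gr[symmetric] add)
      fix y assume y: "fst y \<in> g' False \<and> snd y \<in> g' True \<and> x = fst y \<oplus>\<^bsub>N\<^esub> snd y"
      then obtain c d where cd: "c \<in> g False" "d \<in> g True" "fst y = \<phi> c" "snd y = \<phi> d"
        by (auto simp: gr[symmetric])
      have "\<phi> (a \<oplus>\<^bsub>M\<^esub> b) = \<phi> (c \<oplus>\<^bsub>M\<^esub> d)"
        using y cd ab m M.gr_carrier by (simp add: add)
      then have "a \<oplus>\<^bsub>M\<^esub> b = c \<oplus>\<^bsub>M\<^esub> d"
        using inj[of "a \<oplus>\<^bsub>M\<^esub> b" "c \<oplus>\<^bsub>M\<^esub> d"] ab cd M.gr_carrier by simp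
      then have "a = c \<and> b = d" by (rule M.decomposition_unique[OF ab(1,2) cd(1,2)])
      then show "y = (\<phi> a, \<phi> b)" using cd by (simp add: prod_eq_iff)
    qed
  qed
  ultimately show ?thesis
    unfolding graded_group_iff[symmetric] graded_group_def subgroup_add_monoid_iff
    using tr(1) by blast
qed

text \<open>Local sections of the image are pulled back, glued there and mapped forward; the choice of
  preimages is harmless because the maps are injective.\<close>

lemma sheaf_transport:
  assumes sh: "sheaf T C r" and bij: "\<And>V. openin T V \<Longrightarrow> bij_betw (\<phi> V) (C V) (C' V)"
    and res: "\<And>V W x. openin T V \<Longrightarrow> openin T W \<Longrightarrow> W \<subseteq> V \<Longrightarrow> x \<in> C V \<Longrightarrow>
      r' V W (\<phi> V x) = \<phi> W (r V W x)"
  shows "sheaf T C' r'"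
proof -
  note r = sheaf_restrict[OF sh]
  have surj: "\<exists>x\<in>C V. y = \<phi> V x" if "openin T V" "y \<in> C' V" for y V
    using bij that by (auto simp: bij_betw_def)
  have cl: "\<phi> V x \<in> C' V" if "openin T V" "x \<in> C V" for V x using bij_betwE[OF bij] that by blast
  have inj: "x = y" if "openin T V" "x \<in> C V" "y \<in> C V" "\<phi> V x = \<phi> V y" for V x y
    using bij[OF that(1)] that by (auto simp: bij_betw_def inj_on_eq_iff)
  have A: "r' V W \<in> C' V \<rightarrow> C' W" if h: "openin T V" "openin T W" "W \<subseteq> V" for V W
  proof
    fix y assume y: "y \<in> C' V"
    obtain x where "x \<in> C V" "y = \<phi> V x" using surj[OF h(1) y] by blast
    then show "r' V W y \<in> C' W" using res[OF h] cl[OF h(2) r(3)[OF h]] by simp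
  qed
  have B: "r' V V y = y" if V: "openin T V" and y: "y \<in> C' V" for V y
  proof -
    obtain x where "x \<in> C V" "y = \<phi> V x" using surj[OF V y] by blast
    then show ?thesis using V res[OF V V] r(1)[OF V] by simp
  qed
  have C: "r' W Z (r' V W y) = r' V Z y"
    if h: "openin T V" "openin T W" "openin T Z" "W \<subseteq> V" "Z \<subseteq> W" and y: "y \<in> C' V" for V W Z y
  proof -
    obtain x where "x \<in> C V" "y = \<phi> V x" using surj[OF h(1) y] by blast
    then show ?thesis using h res r(2,3) by (simp add: subset_trans[OF h(5,4)])
  qed
  have D: "\<exists>!t. t \<in> C' (\<Union>\<W>) \<and> (\<forall>W\<in>\<W>. r' (\<Union>\<W>) W t = s W)"
    if W: "\<forall>W\<in>\<W>. openin T W \<and> s W \<in> C' W"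
      and s: "\<forall>W\<in>\<W>. \<forall>W'\<in>\<W>. r' W (W \<inter> W') (s W) = r' W' (W \<inter> W') (s W')" for \<W> s
  proof -
    define \<sigma> where "\<sigma> W = (SOME x. x \<in> C W \<and> s W = \<phi> W x)" for W
    have \<sigma>: "\<sigma> W \<in> C W" "s W = \<phi> W (\<sigma> W)" if "W \<in> \<W>" for W
    proof -
      have "\<exists>x. x \<in> C W \<and> s W = \<phi> W x" using surj W that by blast
      then have "\<sigma> W \<in> C W \<and> s W = \<phi> W (\<sigma> W)" unfolding \<sigma>_def by (rule someI_ex)
      then show "\<sigma> W \<in> C W" "s W = \<phi> W (\<sigma> W)" by auto
    qed
    have op: "openin T W" if "W \<in> \<W>" for W using W that by blast
    have opU: "openin T (\<Union>\<W>)" using op by blast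
    have "r W (W \<inter> W') (\<sigma> W) = r W' (W \<inter> W') (\<sigma> W')" if "W \<in> \<W>" "W' \<in> \<W>" for W W'
    proof -
      note o = op[OF that(1)] op[OF that(2)]
      have oi: "openin T (W \<inter> W')" using o by blast
      have "r' W (W \<inter> W') (s W) = r' W' (W \<inter> W') (s W')" using s that by blast
      then have "\<phi> (W \<inter> W') (r W (W \<inter> W') (\<sigma> W)) = \<phi> (W \<inter> W') (r W' (W \<inter> W') (\<sigma> W'))"
        using \<sigma>[OF that(1)] \<sigma>[OF that(2)] res[OF o(1) oi] res[OF o(2) oi] by auto
      then show ?thesis using inj[OF oi] r(3)[OF o(1) oi] r(3)[OF o(2) oi] \<sigma> that by auto
    qed
    moreover have "\<forall>W\<in>\<W>. openin T W \<and> \<sigma> W \<in> C W" using op \<sigma> by blast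
    moreover note sh[unfolded sheaf_def, THEN conjunct2, THEN conjunct2, THEN conjunct2,
        THEN spec[of _ \<W>], THEN spec[of _ \<sigma>]]
    ultimately have "\<exists>!t. t \<in> C (\<Union>\<W>) \<and> (\<forall>W\<in>\<W>. r (\<Union>\<W>) W t = \<sigma> W)" by blast
    then obtain t where t: "t \<in> C (\<Union>\<W>)" "\<And>W. W \<in> \<W> \<Longrightarrow> r (\<Union>\<W>) W t = \<sigma> W"
      and uniq: "\<And>t'. t' \<in> C (\<Union>\<W>) \<Longrightarrow> (\<And>W. W \<in> \<W> \<Longrightarrow> r (\<Union>\<W>) W t' = \<sigma> W) \<Longrightarrow> t' = t"
      by (elim ex1E) blast
    have resU: "r' (\<Union>\<W>) W (\<phi> (\<Union>\<W>) x) = \<phi> W (r (\<Union>\<W>) W x)" if "W \<in> \<W>" "x \<in> C (\<Union>\<W>)" for W x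
      by (rule res[OF opU op]) (use that in auto)
    show ?thesis
    proof (rule ex1I[of _ "\<phi> (\<Union>\<W>) t"])
      show "\<phi> (\<Union>\<W>) t \<in> C' (\<Union>\<W>) \<and> (\<forall>W\<in>\<W>. r' (\<Union>\<W>) W (\<phi> (\<Union>\<W>) t) = s W)"
        using cl[OF opU t(1)] t \<sigma> resU by simp
      fix y assume y: "y \<in> C' (\<Union>\<W>) \<and> (\<forall>W\<in>\<W>. r' (\<Union>\<W>) W y = s W)"
      then obtain x where x: "x \<in> C (\<Union>\<W>)" "y = \<phi> (\<Union>\<W>) x" using surj[OF opU] by blast
      have "r (\<Union>\<W>) W x = \<sigma> W" if "W \<in> \<W>" for W
      proof (rule inj[OF op[OF that]])
        show "\<phi> W (r (\<Union>\<W>) W x) = \<phi> W (\<sigma> W)" using y x \<sigma>[OF that] resU[OF that x(1)] that by simp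
        show "r (\<Union>\<W>) W x \<in> C W" by (rule r(3)[OF opU op[OF that]]) (use that x in auto)
      qed (rule \<sigma>[OF that])
      then show "y = \<phi> (\<Union>\<W>) t" using uniq x by blast
    qed
  qed
  show ?thesis
    unfolding sheaf_def
    by (intro conjI allI impI ballI; (elim conjE)?; (rule A | rule B | rule C | rule D); assumption)
qed

text \<open>An isomorphism of the structure presheaves of two spaces on the same topological space. Only the
  source is assumed to have supercommutative rings of sections; the target inherits them.\<close>

locale structure_iso = super_presheaf Y
  for Y :: "('x, 'a, 'l) superspace" +
  fixes Y' :: "('x, 'c, 'l) superspace" and \<Psi> :: "'x set \<Rightarrow> 'a \<Rightarrow> 'c"
  assumes same_space: "tp Y' = tp Y" "base Y' = base Y"
    and \<Psi>_bij: "V \<in> opens Y (whole Y) \<Longrightarrow> bij_betw (\<Psi> V) (carrier (sec Y V)) (carrier (sec Y' V))"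
    and \<Psi>_add: "V \<in> opens Y (whole Y) \<Longrightarrow> a \<in> carrier (sec Y V) \<Longrightarrow> b \<in> carrier (sec Y V) \<Longrightarrow>
      \<Psi> V (a \<oplus>\<^bsub>sec Y V\<^esub> b) = \<Psi> V a \<oplus>\<^bsub>sec Y' V\<^esub> \<Psi> V b"
    and \<Psi>_mult: "V \<in> opens Y (whole Y) \<Longrightarrow> a \<in> carrier (sec Y V) \<Longrightarrow> b \<in> carrier (sec Y V) \<Longrightarrow>
      \<Psi> V (a \<otimes>\<^bsub>sec Y V\<^esub> b) = \<Psi> V a \<otimes>\<^bsub>sec Y' V\<^esub> \<Psi> V b"
    and \<Psi>_zero: "V \<in> opens Y (whole Y) \<Longrightarrow> \<Psi> V \<zero>\<^bsub>sec Y V\<^esub> = \<zero>\<^bsub>sec Y' V\<^esub>"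
    and \<Psi>_one: "V \<in> opens Y (whole Y) \<Longrightarrow> \<Psi> V \<one>\<^bsub>sec Y V\<^esub> = \<one>\<^bsub>sec Y' V\<^esub>"
    and \<Psi>_gr: "V \<in> opens Y (whole Y) \<Longrightarrow> \<Psi> V ` gr (sec Y V) p = gr (sec Y' V) p"
    and \<Psi>_alg: "V \<in> opens Y (whole Y) \<Longrightarrow> l \<in> carrier (base Y) \<Longrightarrow> \<Psi> V (alg Y V l) = alg Y' V l"
    and \<Psi>_res: "V \<in> opens Y (whole Y) \<Longrightarrow> W \<in> opens Y V \<Longrightarrow> a \<in> carrier (sec Y V) \<Longrightarrow>
      res Y' V W (\<Psi> V a) = \<Psi> W (res Y V W a)"
begin

lemma opens_eq [simp]: "opens Y' V = opens Y V"
  by (simp add: opens_def same_space)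

lemma \<Psi>_closed: "V \<in> opens Y (whole Y) \<Longrightarrow> a \<in> carrier (sec Y V) \<Longrightarrow> \<Psi> V a \<in> carrier (sec Y' V)"
  using bij_betwE[OF \<Psi>_bij] by blast

lemma \<Psi>_inv:
  "V \<in> opens Y (whole Y) \<Longrightarrow> a \<in> carrier (sec Y V) \<Longrightarrow> inv_into (carrier (sec Y V)) (\<Psi> V) (\<Psi> V a) = a"
  by (rule bij_betw_inv_into_left[OF \<Psi>_bij])

lemma inv_\<Psi>:
  assumes "V \<in> opens Y (whole Y)" "c \<in> carrier (sec Y' V)"
  shows "inv_into (carrier (sec Y V)) (\<Psi> V) c \<in> carrier (sec Y V)"
    "\<Psi> V (inv_into (carrier (sec Y V)) (\<Psi> V) c) = c"
  using bij_betw_inv_into_right[OF \<Psi>_bij[OF assms(1)] assms(2)]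
    bij_betwE[OF bij_betw_inv_into[OF \<Psi>_bij[OF assms(1)]]] assms(2) by auto

lemma \<Psi>_sg:
  assumes "V \<in> opens Y (whole Y)" "a \<in> carrier (sec Y V)"
  shows "\<Psi> V (sg (sec Y V) s a) = sg (sec Y' V) s (\<Psi> V a)"
proof -
  interpret supercommutative "sec Y V" by (rule sections[OF assms(1)])
  show ?thesis
    using abelian_group_transport(2)[OF abelian_group_axioms \<Psi>_bij[OF assms(1)]
        \<Psi>_add[OF assms(1)] \<Psi>_zero[OF assms(1)] assms(2)] by (simp add: sg_def)
qed

text \<open>Conjugation by \<open>\<Psi>\<close>, from vector fields on the target to vector fields on the source.\<close>

definition pull_vf :: "'x set \<Rightarrow> ('x set \<Rightarrow> 'c \<Rightarrow> 'c) \<Rightarrow> 'x set \<Rightarrow> 'a \<Rightarrow> 'a" where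
  "pull_vf V w = (\<lambda>W\<in>opens Y V. \<lambda>a\<in>carrier (sec Y W).
     inv_into (carrier (sec Y W)) (\<Psi> W) (w W (\<Psi> W a)))"

lemma pull_vf_apply:
  assumes V: "V \<in> opens Y (whole Y)" and w: "w \<in> vf Y' V p"
    and W: "W \<in> opens Y V" and a: "a \<in> carrier (sec Y W)"
  shows "pull_vf V w W a \<in> carrier (sec Y W)" "\<Psi> W (pull_vf V w W a) = w W (\<Psi> W a)"
proof -
  note W' = opens_trans[OF V W]
  have "w W (\<Psi> W a) \<in> carrier (sec Y' W)"
    using w W \<Psi>_closed[OF W' a] by (auto simp: vf_def PiE_iff)
  then show "pull_vf V w W a \<in> carrier (sec Y W)" "\<Psi> W (pull_vf V w W a) = w W (\<Psi> W a)"
    using inv_\<Psi>[OF W'] W a by (simp_all add: pull_vf_def)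
qed

lemma pull_vf_vf:
  assumes V: "V \<in> opens Y (whole Y)" and w: "w \<in> vf Y' V p"
  shows "pull_vf V w \<in> vf Y V p"
proof -
  let ?d = "\<lambda>W a. inv_into (carrier (sec Y W)) (\<Psi> W) (w W (\<Psi> W a))"
  have d: "?d W a \<in> carrier (sec Y W)" "\<Psi> W (?d W a) = w W (\<Psi> W a)"
    if "W \<in> opens Y V" "a \<in> carrier (sec Y W)" for W a
    using pull_vf_apply[OF V w that] that by (simp_all add: pull_vf_def)
  have inj: "x = y" if "W \<in> opens Y V" "x \<in> carrier (sec Y W)" "y \<in> carrier (sec Y W)" "\<Psi> W x = \<Psi> W y"
    for W x y using \<Psi>_inv[OF opens_trans[OF V that(1)]] that(2-4) by metis
  have w_gr: "w W c \<in> gr (sec Y' W) (p \<noteq> q)"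
    if "W \<in> opens Y V" "c \<in> gr (sec Y' W) q" for W c q
    using w that by (simp add: vf_def)
  have w_add: "w W (c \<oplus>\<^bsub>sec Y' W\<^esub> e) = w W c \<oplus>\<^bsub>sec Y' W\<^esub> w W e"
    if "W \<in> opens Y V" "c \<in> carrier (sec Y' W)" "e \<in> carrier (sec Y' W)" for W c e
    using w that by (simp add: vf_def)
  have w_leibniz: "w W (c \<otimes>\<^bsub>sec Y' W\<^esub> e) = (w W c \<otimes>\<^bsub>sec Y' W\<^esub> e) \<oplus>\<^bsub>sec Y' W\<^esub>
      sg (sec Y' W) (p \<and> q) (c \<otimes>\<^bsub>sec Y' W\<^esub> w W e)"
    if "W \<in> opens Y V" "c \<in> gr (sec Y' W) q" "e \<in> carrier (sec Y' W)" for W c e q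
    using w that unfolding vf_def by (auto simp del: simp_thms(6))
  have w_alg: "w W (alg Y' W l) = \<zero>\<^bsub>sec Y' W\<^esub>" if "W \<in> opens Y V" "l \<in> carrier (base Y)" for W l
    using w that by (simp add: vf_def same_space)
  have w_res: "res Y' W W' (w W c) = w W' (res Y' W W' c)"
    if "W \<in> opens Y V" "W' \<in> opens Y W" "c \<in> carrier (sec Y' W)" for W W' c
    using w that by (simp add: vf_def)
  show ?thesis
    unfolding pull_vf_def
  proof (rule vf_restrictI[OF V])
    fix W assume W: "W \<in> opens Y V"
    note W' = opens_trans[OF V W]
    interpret supercommutative "sec Y W" by (rule sections[OF W'])
    show "superderivation (sec Y W) p (?d W)"
    proof (rule superderivationI)
      fix a q assume a: "a \<in> gr (sec Y W) q"
      then have "w W (\<Psi> W a) \<in> gr (sec Y' W) (p \<noteq> q)" using w_gr[OF W] \<Psi>_gr[OF W'] by blast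
      then obtain c where "c \<in> gr (sec Y W) (p \<noteq> q)" "w W (\<Psi> W a) = \<Psi> W c"
        using \<Psi>_gr[OF W', of "p \<noteq> q"] by blast
      then show "?d W a \<in> gr (sec Y W) (p \<noteq> q)" using \<Psi>_inv[OF W' gr_carrier] by simp
      fix b assume b: "b \<in> carrier (sec Y W)"
      note ac = gr_carrier[OF a]
      have "\<Psi> W a \<in> gr (sec Y' W) q" using a \<Psi>_gr[OF W'] by blast
      then have "w W (\<Psi> W (a \<otimes>\<^bsub>sec Y W\<^esub> b)) = \<Psi> W ((?d W a \<otimes>\<^bsub>sec Y W\<^esub> b) \<oplus>\<^bsub>sec Y W\<^esub>
          sg (sec Y W) (p \<and> q) (a \<otimes>\<^bsub>sec Y W\<^esub> ?d W b))"
        using ac b by (simp add: d[OF W] \<Psi>_add[OF W'] \<Psi>_mult[OF W'] \<Psi>_sg[OF W'] sg_closed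
          w_leibniz[OF W] \<Psi>_closed[OF W'])
      then show "?d W (a \<otimes>\<^bsub>sec Y W\<^esub> b) = (?d W a \<otimes>\<^bsub>sec Y W\<^esub> b) \<oplus>\<^bsub>sec Y W\<^esub>
          sg (sec Y W) (p \<and> q) (a \<otimes>\<^bsub>sec Y W\<^esub> ?d W b)"
        using ac b by (simp add: \<Psi>_inv[OF W'] d[OF W] sg_closed)
    next
      fix a b assume ab: "a \<in> carrier (sec Y W)" "b \<in> carrier (sec Y W)"
      then have "w W (\<Psi> W (a \<oplus>\<^bsub>sec Y W\<^esub> b)) = \<Psi> W (?d W a \<oplus>\<^bsub>sec Y W\<^esub> ?d W b)"
        by (simp add: d[OF W] \<Psi>_add[OF W'] w_add[OF W] \<Psi>_closed[OF W'])
      then show "?d W (a \<oplus>\<^bsub>sec Y W\<^esub> b) = ?d W a \<oplus>\<^bsub>sec Y W\<^esub> ?d W b"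
        using ab by (simp add: \<Psi>_inv[OF W'] d[OF W])
    qed
    show "?d W (alg Y W l) = \<zero>\<^bsub>sec Y W\<^esub>" if "l \<in> carrier (base Y)" for l
      using that \<Psi>_inv[OF W' zero_closed] by (simp add: \<Psi>_alg[OF W'] \<Psi>_zero[OF W'] w_alg[OF W])
    show "res Y W Z (?d W a) = ?d Z (res Y W Z a)"
      if "Z \<in> opens Y W" "a \<in> carrier (sec Y W)" for Z a
    proof -
      have Z: "Z \<in> opens Y V" by (rule opens_trans[OF W that(1)])
      have "w Z (\<Psi> Z (res Y W Z a)) = res Y' W Z (\<Psi> W (?d W a))"
        using that by (simp add: d[OF W] \<Psi>_res[OF W' that(1), symmetric] w_res[OF W that(1)]
          \<Psi>_closed[OF W'])
      also have "\<dots> = \<Psi> Z (res Y W Z (?d W a))" by (rule \<Psi>_res[OF W' that(1) d(1)[OF W that(2)]])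
      finally show ?thesis
        using \<Psi>_inv[OF opens_trans[OF V Z] res_closed[OF W' that(1) d(1)[OF W that(2)]]] by simp
    qed
  qed
qed

lemma pull_vf_operations:
  assumes V: "V \<in> opens Y (whole Y)" and v: "v \<in> vf Y' V p"
  shows "\<And>w. w \<in> vf Y' V p \<Longrightarrow> pull_vf V (vf_add Y' V v w) = vf_add Y V (pull_vf V v) (pull_vf V w)"
    and "\<And>f q. f \<in> gr (sec Y V) q \<Longrightarrow> pull_vf V (vf_smult Y' V (\<Psi> V f) v) = vf_smult Y V f (pull_vf V v)"
    and "\<And>w q. w \<in> vf Y' V q \<Longrightarrow>
      pull_vf V (vf_bracket Y' V p q v w) = vf_bracket Y V p q (pull_vf V v) (pull_vf V w)"
    and "\<And>W. W \<in> opens Y V \<Longrightarrow> pull_vf W (vf_res Y' W v) = vf_res Y W (pull_vf V v)"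
proof -
  have inv: "inv_into (carrier (sec Y W)) (\<Psi> W) (\<Psi> W a) = a"
    if "W \<in> opens Y V" "a \<in> carrier (sec Y W)" for W a
    using \<Psi>_inv[OF opens_trans[OF V that(1)] that(2)] .
  note ap = pull_vf_apply[OF V]
  show "pull_vf V (vf_add Y' V v w) = vf_add Y V (pull_vf V v) (pull_vf V w)"
    if w: "w \<in> vf Y' V p" for w
    unfolding pull_vf_def[of V "vf_add Y' V v w"] vf_add_def[of Y V]
  proof (intro restrict_ext)
    fix W a assume W: "W \<in> opens Y V" and a: "a \<in> carrier (sec Y W)"
    note W' = opens_trans[OF V W]
    interpret supercommutative "sec Y W" by (rule sections[OF W'])
    have "vf_add Y' V v w W (\<Psi> W a) = \<Psi> W (pull_vf V v W a \<oplus>\<^bsub>sec Y W\<^esub> pull_vf V w W a)"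
      using W a by (simp add: vf_add_def \<Psi>_closed[OF W'] \<Psi>_add[OF W'] ap[OF v] ap[OF w])
    then show "inv_into (carrier (sec Y W)) (\<Psi> W) (vf_add Y' V v w W (\<Psi> W a)) =
        pull_vf V v W a \<oplus>\<^bsub>sec Y W\<^esub> pull_vf V w W a"
      using W a by (simp add: inv ap[OF v] ap[OF w])
  qed
  show "pull_vf V (vf_smult Y' V (\<Psi> V f) v) = vf_smult Y V f (pull_vf V v)"
    if f: "f \<in> gr (sec Y V) q" for f q
    unfolding pull_vf_def[of V "vf_smult Y' V (\<Psi> V f) v"] vf_smult_def[of Y V]
  proof (intro restrict_ext)
    fix W a assume W: "W \<in> opens Y V" and a: "a \<in> carrier (sec Y W)"
    note W' = opens_trans[OF V W]
    interpret V: supercommutative "sec Y V" by (rule sections[OF V])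
    interpret supercommutative "sec Y W" by (rule sections[OF W'])
    have fc: "f \<in> carrier (sec Y V)" using V.gr_carrier[OF f] .
    have "vf_smult Y' V (\<Psi> V f) v W (\<Psi> W a) = \<Psi> W (res Y V W f \<otimes>\<^bsub>sec Y W\<^esub> pull_vf V v W a)"
      using W a fc res_closed[OF V W fc]
      by (simp add: vf_smult_def \<Psi>_closed[OF W'] \<Psi>_mult[OF W'] ap[OF v] \<Psi>_res[OF V W])
    then show "inv_into (carrier (sec Y W)) (\<Psi> W) (vf_smult Y' V (\<Psi> V f) v W (\<Psi> W a)) =
        res Y V W f \<otimes>\<^bsub>sec Y W\<^esub> pull_vf V v W a"
      using W a res_closed[OF V W fc] by (simp add: inv ap[OF v])
  qed
  show "pull_vf V (vf_bracket Y' V p q v w) = vf_bracket Y V p q (pull_vf V v) (pull_vf V w)"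
    if w: "w \<in> vf Y' V q" for w q
    unfolding pull_vf_def[of V "vf_bracket Y' V p q v w"] vf_bracket_def[of Y V]
  proof (intro restrict_ext)
    fix W a assume W: "W \<in> opens Y V" and a: "a \<in> carrier (sec Y W)"
    note W' = opens_trans[OF V W]
    interpret supercommutative "sec Y W" by (rule sections[OF W'])
    let ?c = "pull_vf V v W (pull_vf V w W a) \<ominus>\<^bsub>sec Y W\<^esub>
      sg (sec Y W) (p \<and> q) (pull_vf V w W (pull_vf V v W a))"
    have neg: "\<Psi> W (\<ominus>\<^bsub>sec Y W\<^esub> b) = \<ominus>\<^bsub>sec Y' W\<^esub> \<Psi> W b" if "b \<in> carrier (sec Y W)" for b
      using \<Psi>_sg[OF W' that, of True] by simp
    have "vf_bracket Y' V p q v w W (\<Psi> W a) = \<Psi> W ?c"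
      using W a by (simp add: vf_bracket_def \<Psi>_closed[OF W'] \<Psi>_add[OF W'] neg \<Psi>_sg[OF W']
        sg_closed ap[OF v] ap[OF w] a_minus_def)
    moreover have "?c \<in> carrier (sec Y W)"
      using W a by (simp add: sg_closed ap[OF v] ap[OF w])
    ultimately show "inv_into (carrier (sec Y W)) (\<Psi> W) (vf_bracket Y' V p q v w W (\<Psi> W a)) = ?c"
      using inv[OF W] by simp
  qed
  show "pull_vf W (vf_res Y' W v) = vf_res Y W (pull_vf V v)" if W: "W \<in> opens Y V" for W
    unfolding pull_vf_def[of W] vf_res_def[of Y]
    using opens_trans[OF W] by (intro restrict_ext) (simp_all add: pull_vf_def vf_res_def)
qed

end

context structure_iso
begin

lemma \<Psi>_surj:
  assumes "V \<in> opens Y (whole Y)" "c \<in> carrier (sec Y' V)"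
  obtains f where "f \<in> carrier (sec Y V)" "c = \<Psi> V f"
  using inv_\<Psi>[OF assms] by metis

lemma supercommutative_transport:
  assumes V: "V \<in> opens Y (whole Y)" shows "supercommutative (sec Y' V)"
proof
  interpret supercommutative "sec Y V" by (rule sections[OF V])
  note tr = \<Psi>_add[OF V, symmetric] \<Psi>_mult[OF V, symmetric] \<Psi>_one[OF V, symmetric]
  have gr: "graded_abelian_group (sec Y' V) (gr (sec Y' V))"
    by (rule graded_group_transport[OF graded_abelian_group_axioms \<Psi>_bij[OF V]])
      (use \<Psi>_add \<Psi>_zero \<Psi>_gr V in auto)
  have "ring (sec Y' V)"
  proof (rule ringI)
    show "abelian_group (sec Y' V)" using gr by (rule graded_abelian_group.axioms(1))
    show "monoid (sec Y' V)"
    proof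
      fix x y z assume "x \<in> carrier (sec Y' V)" "y \<in> carrier (sec Y' V)" "z \<in> carrier (sec Y' V)"
      then show "x \<otimes>\<^bsub>sec Y' V\<^esub> y \<otimes>\<^bsub>sec Y' V\<^esub> z = x \<otimes>\<^bsub>sec Y' V\<^esub> (y \<otimes>\<^bsub>sec Y' V\<^esub> z)"
        by (elim \<Psi>_surj[OF V]) (simp add: tr m_assoc)
    next
      fix x y assume "x \<in> carrier (sec Y' V)" "y \<in> carrier (sec Y' V)"
      then show "x \<otimes>\<^bsub>sec Y' V\<^esub> y \<in> carrier (sec Y' V)"
        by (elim \<Psi>_surj[OF V]) (simp add: tr \<Psi>_closed[OF V])
    next
      show "\<one>\<^bsub>sec Y' V\<^esub> \<in> carrier (sec Y' V)" by (simp add: tr \<Psi>_closed[OF V])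
      fix x assume "x \<in> carrier (sec Y' V)"
      then show "\<one>\<^bsub>sec Y' V\<^esub> \<otimes>\<^bsub>sec Y' V\<^esub> x = x" "x \<otimes>\<^bsub>sec Y' V\<^esub> \<one>\<^bsub>sec Y' V\<^esub> = x"
        by (elim \<Psi>_surj[OF V]; simp add: tr)+
    qed
    fix x y z assume "x \<in> carrier (sec Y' V)" "y \<in> carrier (sec Y' V)" "z \<in> carrier (sec Y' V)"
    then show "(x \<oplus>\<^bsub>sec Y' V\<^esub> y) \<otimes>\<^bsub>sec Y' V\<^esub> z = x \<otimes>\<^bsub>sec Y' V\<^esub> z \<oplus>\<^bsub>sec Y' V\<^esub> y \<otimes>\<^bsub>sec Y' V\<^esub> z"
      "z \<otimes>\<^bsub>sec Y' V\<^esub> (x \<oplus>\<^bsub>sec Y' V\<^esub> y) = z \<otimes>\<^bsub>sec Y' V\<^esub> x \<oplus>\<^bsub>sec Y' V\<^esub> z \<otimes>\<^bsub>sec Y' V\<^esub> y"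
      by (elim \<Psi>_surj[OF V]; simp add: tr l_distr r_distr)+
  qed
  moreover have "a \<otimes>\<^bsub>sec Y' V\<^esub> b \<in> gr (sec Y' V) (p \<noteq> q) \<and>
      a \<otimes>\<^bsub>sec Y' V\<^esub> b = sg (sec Y' V) (p \<and> q) (b \<otimes>\<^bsub>sec Y' V\<^esub> a)"
    if a: "a \<in> gr (sec Y' V) p" and b: "b \<in> gr (sec Y' V) q" for a b p q
  proof -
    obtain f where f: "f \<in> gr (sec Y V) p" "a = \<Psi> V f" using a \<Psi>_gr[OF V] by blast
    obtain g where g: "g \<in> gr (sec Y V) q" "b = \<Psi> V g" using b \<Psi>_gr[OF V] by blast
    note c = gr_carrier[OF f(1)] gr_carrier[OF g(1)]
    have "a \<otimes>\<^bsub>sec Y' V\<^esub> b = \<Psi> V (f \<otimes>\<^bsub>sec Y V\<^esub> g)" "b \<otimes>\<^bsub>sec Y' V\<^esub> a = \<Psi> V (g \<otimes>\<^bsub>sec Y V\<^esub> f)"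
      using c by (simp_all add: f g tr)
    moreover have "\<Psi> V (f \<otimes>\<^bsub>sec Y V\<^esub> g) = sg (sec Y' V) (p \<and> q) (\<Psi> V (g \<otimes>\<^bsub>sec Y V\<^esub> f))"
      using c by (simp add: supercommute[OF f(1) g(1)] \<Psi>_sg[OF V])
    moreover have "\<Psi> V (f \<otimes>\<^bsub>sec Y V\<^esub> g) \<in> gr (sec Y' V) (p \<noteq> q)"
      using gr_mult[OF f(1) g(1)] \<Psi>_gr[OF V] by blast
    ultimately show ?thesis by simp
  qed
  moreover have "\<one>\<^bsub>sec Y' V\<^esub> \<in> gr (sec Y' V) False"
    using gr_one \<Psi>_gr[OF V] \<Psi>_one[OF V] by (metis image_eqI)
  ultimately show "supercommutative_ring (sec Y' V)"
    unfolding supercommutative_ring_def graded_group_iff using gr by blast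
qed

lemma presheaf_transport: "super_presheaf Y'"
proof
  fix V assume "V \<in> opens Y' (whole Y')"
  then have V: "V \<in> opens Y (whole Y)" by (simp add: same_space)
  interpret supercommutative "sec Y V" by (rule sections[OF V])
  show "supercommutative_ring (sec Y' V)"
    using supercommutative_transport[OF V] by (rule supercommutative.supercommutative)
  show "alg Y' V l \<in> carrier (sec Y' V)" if "l \<in> carrier (base Y')" for l
    using that \<Psi>_alg[OF V] \<Psi>_closed[OF V] alg_closed[OF V] by (metis same_space(2))
  show "res Y' V V c = c" if "c \<in> carrier (sec Y' V)" for c
    using that by (elim \<Psi>_surj[OF V]) (simp add: \<Psi>_res[OF V opens_self[OF V]] res_id[OF V])
  fix W assume "W \<in> opens Y' V"
  then have W: "W \<in> opens Y V" by simp
  note W' = opens_trans[OF V W]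
  show "res Y' V W \<one>\<^bsub>sec Y' V\<^esub> = \<one>\<^bsub>sec Y' W\<^esub>"
    by (simp add: \<Psi>_one[OF V, symmetric] \<Psi>_one[OF W', symmetric] \<Psi>_res[OF V W] res_one[OF V W])
  show "res Y' V W c \<in> gr (sec Y' W) p" if c: "c \<in> gr (sec Y' V) p" for c p
  proof -
    obtain f where f: "f \<in> gr (sec Y V) p" "c = \<Psi> V f" using c \<Psi>_gr[OF V] by blast
    then show ?thesis
      using \<Psi>_res[OF V W gr_carrier[OF f(1)]] res_gr[OF V W f(1)] \<Psi>_gr[OF W'] by auto
  qed
  show "res Y' W Z (res Y' V W c) = res Y' V Z c"
    if "Z \<in> opens Y' W" "c \<in> carrier (sec Y' V)" for Z c
  proof -
    have Z: "Z \<in> opens Y W" using that(1) by simp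
    show ?thesis
      using that(2) by (elim \<Psi>_surj[OF V]) (simp add: \<Psi>_res[OF V W] \<Psi>_res[OF V opens_trans[OF W Z]]
        \<Psi>_res[OF W' Z] res_closed[OF V W] res_res[OF V W Z])
  qed
  show "res Y' V W (c \<oplus>\<^bsub>sec Y' V\<^esub> e) = res Y' V W c \<oplus>\<^bsub>sec Y' W\<^esub> res Y' V W e"
    "res Y' V W (c \<otimes>\<^bsub>sec Y' V\<^esub> e) = res Y' V W c \<otimes>\<^bsub>sec Y' W\<^esub> res Y' V W e"
    if "c \<in> carrier (sec Y' V)" "e \<in> carrier (sec Y' V)" for c e
    using that by (elim \<Psi>_surj[OF V]; simp add: \<Psi>_res[OF V W] res_closed[OF V W]
      \<Psi>_add[OF V, symmetric] \<Psi>_mult[OF V, symmetric] \<Psi>_add[OF W', symmetric]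
      \<Psi>_mult[OF W', symmetric] res_add[OF V W] res_mult[OF V W])+
qed

end

text \<open>Each axiom of a D-module is an identity or closure condition on sections and vector fields, and
  an isomorphism turns the axioms for \<open>F\<close> into those for \<open>N\<close>. The target \<open>N\<close> enters only as data with
  operations; that it satisfies the axioms is the conclusion.\<close>

locale dmodule_transport = structure_iso Y Y' \<Psi> + super_dmodule Y F
  for Y :: "('x, 'a, 'l) superspace" and Y' :: "('x, 'c, 'l) superspace" and \<Psi>
    and F :: "('x, 'a, 'b) dmod" +
  fixes N :: "('x, 'c, 'd) dmod" and \<phi> :: "'x set \<Rightarrow> 'b \<Rightarrow> 'd"
  assumes \<phi>_bij: "V \<in> opens Y (whole Y) \<Longrightarrow> bij_betw (\<phi> V) (carrier (msec F V)) (carrier (msec N V))"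
    and \<phi>_add: "V \<in> opens Y (whole Y) \<Longrightarrow> m \<in> carrier (msec F V) \<Longrightarrow> n \<in> carrier (msec F V) \<Longrightarrow>
      \<phi> V (m \<oplus>\<^bsub>msec F V\<^esub> n) = \<phi> V m \<oplus>\<^bsub>msec N V\<^esub> \<phi> V n"
    and \<phi>_zero: "V \<in> opens Y (whole Y) \<Longrightarrow> \<phi> V \<zero>\<^bsub>msec F V\<^esub> = \<zero>\<^bsub>msec N V\<^esub>"
    and \<phi>_gr: "V \<in> opens Y (whole Y) \<Longrightarrow> \<phi> V ` mgr (msec F V) p = mgr (msec N V) p"
    and \<phi>_smult: "V \<in> opens Y (whole Y) \<Longrightarrow> f \<in> carrier (sec Y V) \<Longrightarrow> m \<in> carrier (msec F V) \<Longrightarrow>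
      \<phi> V (f \<odot>\<^bsub>msec F V\<^esub> m) = \<Psi> V f \<odot>\<^bsub>msec N V\<^esub> \<phi> V m"
    and \<phi>_res: "V \<in> opens Y (whole Y) \<Longrightarrow> W \<in> opens Y V \<Longrightarrow> m \<in> carrier (msec F V) \<Longrightarrow>
      mres N V W (\<phi> V m) = \<phi> W (mres F V W m)"
    and \<phi>_conn: "V \<in> opens Y (whole Y) \<Longrightarrow> w \<in> vf Y' V p \<Longrightarrow> m \<in> carrier (msec F V) \<Longrightarrow>
      conn N V w (\<phi> V m) = \<phi> V (conn F V (pull_vf V w) m)"
begin

lemma \<phi>_surj:
  assumes "V \<in> opens Y (whole Y)" "y \<in> carrier (msec N V)"
  obtains m where "m \<in> carrier (msec F V)" "y = \<phi> V m"
  using \<phi>_bij[OF assms(1)] assms(2) by (auto simp: bij_betw_def)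

lemma \<phi>_closed: "V \<in> opens Y (whole Y) \<Longrightarrow> m \<in> carrier (msec F V) \<Longrightarrow> \<phi> V m \<in> carrier (msec N V)"
  using bij_betwE[OF \<phi>_bij] by blast

lemma graded_N:
  assumes "V \<in> opens Y (whole Y)"
  shows "graded_abelian_group (msec N V) (mgr (msec N V))"
proof -
  interpret supermodule "sec Y V" "msec F V" by (rule supermodule_sections[OF assms])
  show ?thesis
    by (rule graded_group_transport[OF M.graded_abelian_group_axioms \<phi>_bij[OF assms]])
      (use \<phi>_add \<phi>_zero \<phi>_gr assms in auto)
qed

lemma \<phi>_neg:
  assumes "V \<in> opens Y (whole Y)" "m \<in> carrier (msec F V)"
  shows "\<phi> V (\<ominus>\<^bsub>msec F V\<^esub> m) = \<ominus>\<^bsub>msec N V\<^esub> \<phi> V m"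
proof -
  interpret supermodule "sec Y V" "msec F V" by (rule supermodule_sections[OF assms(1)])
  show ?thesis
    using abelian_group_transport(2)[OF M.abelian_group_axioms \<phi>_bij[OF assms(1)]] \<phi>_add \<phi>_zero assms
    by blast
qed

lemma left_supermodule_N:
  assumes V: "V \<in> opens Y (whole Y)" shows "left_supermodule (sec Y' V) (msec N V)"
proof -
  interpret supermodule "sec Y V" "msec F V" by (rule supermodule_sections[OF V])
  note tr = \<phi>_add[OF V, symmetric] \<phi>_smult[OF V, symmetric] \<Psi>_add[OF V, symmetric]
    \<Psi>_mult[OF V, symmetric]
  show ?thesis
    unfolding left_supermodule_def graded_group_iff
  proof (intro conjI ballI allI)
    show "graded_abelian_group (msec N V) (mgr (msec N V))" by (rule graded_N[OF V])
  next
    fix a x assume "a \<in> carrier (sec Y' V)" "x \<in> carrier (msec N V)"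
    then show "a \<odot>\<^bsub>msec N V\<^esub> x \<in> carrier (msec N V)"
      by (elim \<Psi>_surj[OF V] \<phi>_surj[OF V]) (simp add: tr \<phi>_closed[OF V] smult_closed)
  next
    fix a x y assume "a \<in> carrier (sec Y' V)" "x \<in> carrier (msec N V)" "y \<in> carrier (msec N V)"
    then show "a \<odot>\<^bsub>msec N V\<^esub> (x \<oplus>\<^bsub>msec N V\<^esub> y) = (a \<odot>\<^bsub>msec N V\<^esub> x) \<oplus>\<^bsub>msec N V\<^esub> (a \<odot>\<^bsub>msec N V\<^esub> y)"
      by (elim \<Psi>_surj[OF V] \<phi>_surj[OF V]) (simp add: tr smult_closed smult_add)
  next
    fix a b x assume "a \<in> carrier (sec Y' V)" "b \<in> carrier (sec Y' V)" "x \<in> carrier (msec N V)"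
    then show "(a \<oplus>\<^bsub>sec Y' V\<^esub> b) \<odot>\<^bsub>msec N V\<^esub> x = (a \<odot>\<^bsub>msec N V\<^esub> x) \<oplus>\<^bsub>msec N V\<^esub> (b \<odot>\<^bsub>msec N V\<^esub> x)"
      "(a \<otimes>\<^bsub>sec Y' V\<^esub> b) \<odot>\<^bsub>msec N V\<^esub> x = a \<odot>\<^bsub>msec N V\<^esub> (b \<odot>\<^bsub>msec N V\<^esub> x)"
      by (elim \<Psi>_surj[OF V] \<phi>_surj[OF V]; simp add: tr smult_closed add_smult mult_smult)+
  next
    fix x assume "x \<in> carrier (msec N V)"
    then show "\<one>\<^bsub>sec Y' V\<^esub> \<odot>\<^bsub>msec N V\<^esub> x = x"
      by (elim \<phi>_surj[OF V]) (simp add: tr \<Psi>_one[OF V, symmetric] one_smult)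
  next
    fix p q a x assume a: "a \<in> gr (sec Y' V) p" and x: "x \<in> mgr (msec N V) q"
    obtain f where f: "f \<in> gr (sec Y V) p" "a = \<Psi> V f" using a \<Psi>_gr[OF V] by blast
    obtain m where m: "m \<in> mgr (msec F V) q" "x = \<phi> V m" using x \<phi>_gr[OF V] by blast
    have "a \<odot>\<^bsub>msec N V\<^esub> x = \<phi> V (f \<odot>\<^bsub>msec F V\<^esub> m)"
      using f m gr_carrier M.gr_carrier by (simp add: tr)
    then show "a \<odot>\<^bsub>msec N V\<^esub> x \<in> mgr (msec N V) (p \<noteq> q)"
      using gr_smult[OF f(1) m(1)] \<phi>_gr[OF V] by blast
  qed
qed

lemma module_sheaf_N: "module_sheaf Y' N"
  unfolding module_sheaf_def
proof (intro conjI ballI allI)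
  have sh: "sheaf (tp Y) (\<lambda>V. carrier (msec F V)) (mres F)"
    using dmodule by (simp add: dmodule_def module_sheaf_def)
  have op: "V \<in> opens Y (whole Y)" if "openin (tp Y) V" for V
    using that openin_subset by (auto simp: opens_def)
  show "sheaf (tp Y') (\<lambda>V. carrier (msec N V)) (mres N)"
    unfolding same_space
  proof (rule sheaf_transport[OF sh, where \<phi> = \<phi>])
    show "bij_betw (\<phi> V) (carrier (msec F V)) (carrier (msec N V))" if "openin (tp Y) V" for V
      by (rule \<phi>_bij[OF op[OF that]])
    show "mres N V W (\<phi> V m) = \<phi> W (mres F V W m)"
      if "openin (tp Y) V" "openin (tp Y) W" "W \<subseteq> V" "m \<in> carrier (msec F V)" for V W m
      using \<phi>_res[OF op[OF that(1)] _ that(4)] that(2,3) by (simp add: opens_def)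
  qed
next
  fix V assume "V \<in> opens Y' (whole Y')"
  then have V: "V \<in> opens Y (whole Y)" by (simp add: same_space)
  interpret V: supermodule "sec Y V" "msec F V" by (rule supermodule_sections[OF V])
  show "left_supermodule (sec Y' V) (msec N V)" by (rule left_supermodule_N[OF V])
  fix W assume "W \<in> opens Y' V"
  then have W: "W \<in> opens Y V" by simp
  note W' = opens_trans[OF V W]
  interpret W: supermodule "sec Y W" "msec F W" by (rule supermodule_sections[OF W'])
  show "mres N V W x \<in> mgr (msec N W) p" if x: "x \<in> mgr (msec N V) p" for p x
  proof -
    obtain m where m: "m \<in> mgr (msec F V) p" "x = \<phi> V m" using x \<phi>_gr[OF V] by blast
    then show ?thesis
      using \<phi>_res[OF V W V.M.gr_carrier[OF m(1)]] mres_gr[OF V W m(1)] \<phi>_gr[OF W'] by auto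
  qed
  fix x assume x: "x \<in> carrier (msec N V)"
  show "mres N V W (x \<oplus>\<^bsub>msec N V\<^esub> y) = mres N V W x \<oplus>\<^bsub>msec N W\<^esub> mres N V W y"
    if "y \<in> carrier (msec N V)" for y
    using x that
    by (elim \<phi>_surj[OF V]) (simp add: \<phi>_res[OF V W] \<phi>_add[OF V, symmetric] \<phi>_add[OF W', symmetric]
      mres_closed[OF V W] mres_add[OF V W])
next
  fix V W f x assume "V \<in> opens Y' (whole Y')" "W \<in> opens Y' V"
  then have V: "V \<in> opens Y (whole Y)" and W: "W \<in> opens Y V" by (simp_all add: same_space)
  note W' = opens_trans[OF V W]
  interpret V: supermodule "sec Y V" "msec F V" by (rule supermodule_sections[OF V])
  assume "f \<in> carrier (sec Y' V)" "x \<in> carrier (msec N V)"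
  then show "mres N V W (f \<odot>\<^bsub>msec N V\<^esub> x) = res Y' V W f \<odot>\<^bsub>msec N W\<^esub> mres N V W x"
    by (elim \<phi>_surj[OF V] \<Psi>_surj[OF V])
      (simp add: \<phi>_res[OF V W] \<Psi>_res[OF V W] \<phi>_smult[OF V, symmetric] \<phi>_smult[OF W', symmetric]
        mres_closed[OF V W] res_closed[OF V W] mres_smult[OF V W] V.smult_closed)
qed

lemma pulled_operator:
  assumes "V \<in> opens Y (whole Y)" "v \<in> vf Y' V p"
  shows "super_operator (sec Y V) (msec F V) p (pull_vf V v V) (conn F V (pull_vf V v))"
  by (rule conn_operator[OF assms(1) pull_vf_vf[OF assms]])

lemma \<phi>_sg:
  assumes "V \<in> opens Y (whole Y)" "m \<in> carrier (msec F V)"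
  shows "sg (msec N V) s (\<phi> V m) = \<phi> V (sg (msec F V) s m)"
  using \<phi>_neg[OF assms] by (simp add: sg_def)

lemma connection_N: "connection Y' N"
  unfolding connection_def
proof (intro ballI allI conjI)
  fix V p v assume "V \<in> opens Y' (whole Y')"
  then have V: "V \<in> opens Y (whole Y)" and V': "V \<in> opens Y' (whole Y')" by (simp_all add: same_space)
  assume v: "v \<in> vf Y' V p"
  note Tv = pull_vf_vf[OF V v]
  interpret Y': super_presheaf Y' by (rule presheaf_transport)
  interpret super_operator "sec Y V" "msec F V" p "pull_vf V v V" "conn F V (pull_vf V v)"
    by (rule pulled_operator[OF V v])
  show "conn N V v x \<in> carrier (msec N V)" if "x \<in> carrier (msec N V)" for x
    using that by (elim \<phi>_surj[OF V]) (simp add: \<phi>_conn[OF V v] \<phi>_closed[OF V] op_closed)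
  show "conn N V v x \<in> mgr (msec N V) (p \<noteq> q)" if x: "x \<in> mgr (msec N V) q" for q x
  proof -
    obtain m where m: "m \<in> mgr (msec F V) q" "x = \<phi> V m" using x \<phi>_gr[OF V] by blast
    then show ?thesis
      using \<phi>_conn[OF V v M.gr_carrier[OF m(1)]] op_gr[OF m(1)] \<phi>_gr[OF V] by auto
  qed
  show "conn N V v (x \<oplus>\<^bsub>msec N V\<^esub> y) = conn N V v x \<oplus>\<^bsub>msec N V\<^esub> conn N V v y"
    if "x \<in> carrier (msec N V)" "y \<in> carrier (msec N V)" for x y
    using that by (elim \<phi>_surj[OF V])
      (simp add: \<phi>_conn[OF V v] \<phi>_add[OF V, symmetric] op_closed op_add)
  show "conn N V v (f \<odot>\<^bsub>msec N V\<^esub> x) = (v V f \<odot>\<^bsub>msec N V\<^esub> x) \<oplus>\<^bsub>msec N V\<^esub>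
      sg (msec N V) (p \<and> q) (f \<odot>\<^bsub>msec N V\<^esub> conn N V v x)"
    if f: "f \<in> gr (sec Y' V) q" and x: "x \<in> carrier (msec N V)" for q f x
  proof -
    obtain g where g: "g \<in> gr (sec Y V) q" "f = \<Psi> V g" using f \<Psi>_gr[OF V] by blast
    obtain m where m: "m \<in> carrier (msec F V)" "x = \<phi> V m" using \<phi>_surj[OF V x] .
    have "v V (\<Psi> V g) = \<Psi> V (pull_vf V v V g)"
      using pull_vf_apply[OF V v opens_self[OF V] gr_carrier[OF g(1)]] by simp
    then show ?thesis
      using g m gr_carrier[OF g(1)]
      by (simp add: \<phi>_conn[OF V v] \<phi>_smult[OF V, symmetric] \<phi>_add[OF V, symmetric] \<phi>_sg[OF V]
        op_closed d_closed smult_closed M.sg_closed op_leibniz)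
  qed
  show "conn N V (vf_add Y' V v w) x = conn N V v x \<oplus>\<^bsub>msec N V\<^esub> conn N V w x"
    if w: "w \<in> vf Y' V p" and x: "x \<in> carrier (msec N V)" for w x
  proof -
    interpret w: super_operator "sec Y V" "msec F V" p "pull_vf V w V" "conn F V (pull_vf V w)"
      by (rule pulled_operator[OF V w])
    obtain m where m: "m \<in> carrier (msec F V)" "x = \<phi> V m" using \<phi>_surj[OF V x] .
    then show ?thesis
      by (simp add: \<phi>_conn[OF V v] \<phi>_conn[OF V w] \<phi>_conn[OF V Y'.vf_add_vf[OF V' v w]]
        pull_vf_operations(1)[OF V v w] conn_vf_add[OF V Tv pull_vf_vf[OF V w]]
        \<phi>_add[OF V] op_closed w.op_closed)
  qed
  show "conn N V (vf_smult Y' V f v) x = f \<odot>\<^bsub>msec N V\<^esub> conn N V v x"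
    if f: "f \<in> gr (sec Y' V) q" and x: "x \<in> carrier (msec N V)" for q f x
  proof -
    obtain g where g: "g \<in> gr (sec Y V) q" "f = \<Psi> V g" using f \<Psi>_gr[OF V] by blast
    obtain m where m: "m \<in> carrier (msec F V)" "x = \<phi> V m" using \<phi>_surj[OF V x] .
    have "conn N V (vf_smult Y' V f v) x = \<phi> V (conn F V (pull_vf V (vf_smult Y' V f v)) m)"
      using \<phi>_conn[OF V Y'.vf_smult_vf[OF V' f v] m(1)] m(2) by simp
    also have "\<dots> = \<phi> V (g \<odot>\<^bsub>msec F V\<^esub> conn F V (pull_vf V v) m)"
      using pull_vf_operations(2)[OF V v g(1)] conn_vf_smult[OF V Tv g(1) m(1)] g(2) by simp
    also have "\<dots> = f \<odot>\<^bsub>msec N V\<^esub> conn N V v x"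
      using g m gr_carrier[OF g(1)] by (simp add: \<phi>_conn[OF V v] \<phi>_smult[OF V] op_closed)
    finally show ?thesis .
  qed
  show "mres N V W (conn N V v x) = conn N W (vf_res Y' W v) (mres N V W x)"
    if "W \<in> opens Y' V" and x: "x \<in> carrier (msec N V)" for W x
  proof -
    have W: "W \<in> opens Y V" using that(1) by simp
    note W' = opens_trans[OF V W]
    obtain m where m: "m \<in> carrier (msec F V)" "x = \<phi> V m" using \<phi>_surj[OF V x] .
    then show ?thesis
      by (simp add: \<phi>_conn[OF V v] \<phi>_res[OF V W] op_closed conn_res[OF V Tv W]
        pull_vf_operations(4)[OF V v W] mres_closed[OF V W]
        \<phi>_conn[OF W' Y'.vf_res_vf[OF V' that(1) v]])
  qed
qed

lemma flat_N: "flat Y' N"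
  unfolding flat_def
proof (intro ballI allI)
  fix V p q v w x assume "V \<in> opens Y' (whole Y')"
  then have V: "V \<in> opens Y (whole Y)" and V': "V \<in> opens Y' (whole Y')" by (simp_all add: same_space)
  assume v: "v \<in> vf Y' V p" and w: "w \<in> vf Y' V q" and x: "x \<in> carrier (msec N V)"
  interpret Y': super_presheaf Y' by (rule presheaf_transport)
  interpret v: super_operator "sec Y V" "msec F V" p "pull_vf V v V" "conn F V (pull_vf V v)"
    by (rule pulled_operator[OF V v])
  interpret w: super_operator "sec Y V" "msec F V" q "pull_vf V w V" "conn F V (pull_vf V w)"
    by (rule pulled_operator[OF V w])
  obtain m where m: "m \<in> carrier (msec F V)" "x = \<phi> V m" using \<phi>_surj[OF V x] .
  have "conn F V (pull_vf V v) (conn F V (pull_vf V w) m) \<ominus>\<^bsub>msec F V\<^esub>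
      sg (msec F V) (p \<and> q) (conn F V (pull_vf V w) (conn F V (pull_vf V v) m)) =
      conn F V (vf_bracket Y V p q (pull_vf V v) (pull_vf V w)) m"
    using dmodule V m(1) pull_vf_vf[OF V v] pull_vf_vf[OF V w] unfolding dmodule_def flat_def by blast
  then show "conn N V v (conn N V w x) \<ominus>\<^bsub>msec N V\<^esub> sg (msec N V) (p \<and> q) (conn N V w (conn N V v x)) =
      conn N V (vf_bracket Y' V p q v w) x"
    using m v.op_closed w.op_closed
    by (simp add: \<phi>_conn[OF V v] \<phi>_conn[OF V w] \<phi>_conn[OF V Y'.vf_bracket_vf[OF V' v w]]
      pull_vf_operations(3)[OF V v w] \<phi>_sg[OF V] \<phi>_neg[OF V, symmetric] v.M.sg_closed a_minus_def
      \<phi>_add[OF V, symmetric])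
qed

lemma dmodule_N: "dmodule Y' N"
  by (simp add: dmodule_def module_sheaf_N connection_N flat_N)

end

section \<open>The dual curve\<close>

lemma Delta_simps [simp]:
  "tp (Delta Y) = tp Y" "base (Delta Y) = base Y" "sec (Delta Y) V = Delta_sec (sec Y V)"
  "res (Delta Y) V W = map_prod (res Y V W) (res Y V W)"
  "alg (Delta Y) V l = (alg Y V l, \<zero>\<^bsub>sec Y V\<^esub>)"
  by (simp_all add: Delta_def)

lemma opens_Delta [simp]: "opens (Delta Y) V = opens Y V"
  by (simp add: opens_def)

lemma dual_curve_simps [simp]:
  "tp (dual_curve Y z \<theta>) = tp Y" "base (dual_curve Y z \<theta>) = base Y"
  "res (dual_curve Y z \<theta>) V W = map_prod (res Y V W) (res Y V W)"
  "alg (dual_curve Y z \<theta>) V l = (alg Y V l, \<zero>\<^bsub>sec Y V\<^esub>)"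
  "carrier (sec (dual_curve Y z \<theta>) V) = dual_sections Y z \<theta> V"
  "add (sec (dual_curve Y z \<theta>) V) = add (Delta_sec (sec Y V))"
  "mult (sec (dual_curve Y z \<theta>) V) = mult (Delta_sec (sec Y V))"
  "one (sec (dual_curve Y z \<theta>) V) = one (Delta_sec (sec Y V))"
  "zero (sec (dual_curve Y z \<theta>) V) = zero (Delta_sec (sec Y V))"
  "gr (sec (dual_curve Y z \<theta>) V) p = gr (Delta_sec (sec Y V)) p \<inter> dual_sections Y z \<theta> V"
  by (simp_all add: dual_curve_def)

lemma pullback_regular:
  "smult (pullback_sec R (regular_module R)) = mult (Delta_sec R)"
  "add (pullback_sec R (regular_module R)) = add (Delta_sec R)"
  by (simp_all add: pullback_sec_def Delta_sec_def)

lemma (in super_presheaf) presheaf_Delta: "super_presheaf (Delta Y)"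
proof
  fix V assume "V \<in> opens (Delta Y) (whole (Delta Y))"
  then have V: "V \<in> opens Y (whole Y)" by simp
  interpret V: supercommutative "sec Y V" by (rule sections[OF V])
  show "supercommutative_ring (sec (Delta Y) V)"
    using V.supercommutative_Delta by (simp add: supercommutative_def)
  show "alg (Delta Y) V l \<in> carrier (sec (Delta Y) V)" if "l \<in> carrier (base (Delta Y))" for l
    using that alg_closed[OF V] by simp
  show "res (Delta Y) V V a = a" if "a \<in> carrier (sec (Delta Y) V)" for a
    using that by (cases a) (simp add: res_id[OF V])
  fix W assume "W \<in> opens (Delta Y) V"
  then have W: "W \<in> opens Y V" by simp
  note W' = opens_trans[OF V W]
  interpret W: supercommutative "sec Y W" by (rule sections[OF W'])
  show "res (Delta Y) V W a \<in> gr (sec (Delta Y) W) p" if "a \<in> gr (sec (Delta Y) V) p" for a p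
    using that by (cases a) (simp add: res_gr[OF V W])
  show "res (Delta Y) V W \<one>\<^bsub>sec (Delta Y) V\<^esub> = \<one>\<^bsub>sec (Delta Y) W\<^esub>"
    by (simp add: res_one[OF V W] res_zero[OF V W])
  show "res (Delta Y) W Z (res (Delta Y) V W a) = res (Delta Y) V Z a"
    if "Z \<in> opens (Delta Y) W" "a \<in> carrier (sec (Delta Y) V)" for Z a
    using that by (cases a) (simp add: res_res[OF V W])
  show "res (Delta Y) V W (a \<oplus>\<^bsub>sec (Delta Y) V\<^esub> b) =
      res (Delta Y) V W a \<oplus>\<^bsub>sec (Delta Y) W\<^esub> res (Delta Y) V W b"
    "res (Delta Y) V W (a \<otimes>\<^bsub>sec (Delta Y) V\<^esub> b) =
      res (Delta Y) V W a \<otimes>\<^bsub>sec (Delta Y) W\<^esub> res (Delta Y) V W b"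
    if "a \<in> carrier (sec (Delta Y) V)" "b \<in> carrier (sec (Delta Y) V)" for a b
    using that by (cases a; cases b; simp add: res_add[OF V W] res_mult[OF V W] res_par[OF V W]
      V.par_closed)+
qed

context coordinate_patch
begin

abbreviation extend_on where
  "extend_on V \<equiv> odd_plane.extend (regular_module (sec Y V)) (pz V V) (pt V V) (\<theta>_on V)"

lemma partial_constants:
  assumes V: "V \<in> opens Y (whole Y)"
  shows "pz V V \<one>\<^bsub>sec Y V\<^esub> = \<zero>\<^bsub>sec Y V\<^esub>" "pt V V \<one>\<^bsub>sec Y V\<^esub> = \<zero>\<^bsub>sec Y V\<^esub>"
    and "l \<in> carrier (base Y) \<Longrightarrow> pz V V (alg Y V l) = \<zero>\<^bsub>sec Y V\<^esub>"
    and "l \<in> carrier (base Y) \<Longrightarrow> pt V V (alg Y V l) = \<zero>\<^bsub>sec Y V\<^esub>"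
proof -
  interpret odd_plane "sec Y V" "regular_module (sec Y V)" "pz V V" "pz V V" "pt V V" "pt V V" "\<theta>_on V"
    by (rule odd_plane_sections[OF V])
  show "pz V V \<one>\<^bsub>sec Y V\<^esub> = \<zero>\<^bsub>sec Y V\<^esub>" "pt V V \<one>\<^bsub>sec Y V\<^esub> = \<zero>\<^bsub>sec Y V\<^esub>"
    using Z.op_leibniz[OF gr_one, of "\<one>\<^bsub>sec Y V\<^esub>"] T.op_leibniz[OF gr_one, of "\<one>\<^bsub>sec Y V\<^esub>"]
      Z.d_closed[of "\<one>\<^bsub>sec Y V\<^esub>"] T.d_closed[of "\<one>\<^bsub>sec Y V\<^esub>"]
    by (simp_all add: add.l_cancel_one')
  show "pz V V (alg Y V l) = \<zero>\<^bsub>sec Y V\<^esub>" "pt V V (alg Y V l) = \<zero>\<^bsub>sec Y V\<^esub>"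
    if "l \<in> carrier (base Y)"
    using partial_z(1)[OF V] partial_\<theta>(1)[OF V] that opens_self[OF V] by (simp_all add: vf_iff[OF V])
qed

lemma d_tilde_eq:
  assumes V: "V \<in> opens Y (whole Y)" and "f \<in> carrier (sec Y V)" "g \<in> carrier (sec Y V)"
  shows "d_tilde Y z \<theta> V (f, g) = (pt V V f, pz V V f \<ominus>\<^bsub>sec Y V\<^esub> pt V V g)"
proof -
  interpret odd_plane "sec Y V" "regular_module (sec Y V)" "pz V V" "pz V V" "pt V V" "pt V V" "\<theta>_on V"
    by (rule odd_plane_sections[OF V])
  show ?thesis
    using assms(2,3) by (simp add: d_tilde_def rho_def even_ext_def odd_ext_def par_zero closed a_minus_def
      Z.d_closed T.d_closed)
qed

text \<open>Functions on the dual curve are the horizontal sections for \<open>\<F> = \<O>\<close>.\<close>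

lemma dual_sections_eq:
  assumes V: "V \<in> opens Y (whole Y)"
  shows "dual_sections Y z \<theta> V = odd_plane.horizontal (regular_module (sec Y V)) (pz V V) (pt V V)"
proof -
  interpret odd_plane "sec Y V" "regular_module (sec Y V)" "pz V V" "pz V V" "pt V V" "pt V V" "\<theta>_on V"
    by (rule odd_plane_sections[OF V])
  have "(f, g) \<in> dual_sections Y z \<theta> V \<longleftrightarrow> (f, g) \<in> horizontal" for f g
  proof (cases "f \<in> carrier (sec Y V) \<and> g \<in> carrier (sec Y V)")
    case True
    then show ?thesis
      using minus_eq_zeroD[of "pz V V f" "pt V V g"]
      by (auto simp: dual_sections_def d_tilde_eq[OF V] horizontal_def Z.d_closed T.d_closed)
  qed (auto simp: dual_sections_def horizontal_def)
  then show ?thesis by auto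
qed

lemma Psi_eq:
  assumes V: "V \<in> opens Y (whole Y)" and h: "h \<in> carrier (sec Y V)"
  shows "Psi Y z \<theta> V h = extend_on V h"
proof -
  interpret odd_plane "sec Y V" "regular_module (sec Y V)" "pz V V" "pz V V" "pt V V" "pt V V" "\<theta>_on V"
    by (rule odd_plane_sections[OF V])
  show ?thesis
    using h coordinates_closed[OF V]
    by (simp add: Psi_def Let_def pull_def rho_def extend_def par_zero a_minus_def Delta_neg
      Z.d_closed T.d_closed par_closed)
qed

lemma u_coord_eq:
  assumes V: "V \<in> opens Y (whole Y)"
  shows "u_coord Y z \<theta> V = (z_on V, \<theta>_on V)" "Psi Y z \<theta> V (z_on V) = u_coord Y z \<theta> V"
proof -
  interpret odd_plane "sec Y V" "regular_module (sec Y V)" "pz V V" "pz V V" "pt V V" "pt V V" "\<theta>_on V"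
    by (rule odd_plane_sections[OF V])
  show u: "u_coord Y z \<theta> V = (z_on V, \<theta>_on V)"
    using coordinates_closed[OF V]
    by (simp add: u_coord_def pull_def rho_def a_minus_def Delta_neg par_homogeneous[OF \<theta>_on_gr[OF V]])
  show "Psi Y z \<theta> V (z_on V) = u_coord Y z \<theta> V"
    using coordinates_closed[OF V] by (simp add: u Psi_eq[OF V] extend_def partial_z[OF V]
      partial_\<theta>[OF V] a_minus_def)
qed

lemma Psi_\<theta>:
  assumes V: "V \<in> opens Y (whole Y)"
  shows "Psi Y z \<theta> V (\<theta>_on V) = rho Y V"
proof -
  interpret odd_plane "sec Y V" "regular_module (sec Y V)" "pz V V" "pz V V" "pt V V" "pt V V" "\<theta>_on V"
    by (rule odd_plane_sections[OF V])
  show ?thesis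
    using coordinates_closed[OF V] by (simp add: Psi_eq[OF V] extend_def rho_def partial_z[OF V]
      partial_\<theta>[OF V] a_minus_def r_neg)
qed

text \<open>Multiplicativity is the semilinearity of the extension for \<open>\<F> = \<O>\<close>: writing \<open>a\<close> as the restriction
  of its own extension \<open>f + \<rho> g\<close>, the product of the extensions of \<open>a\<close> and \<open>b\<close> extends \<open>(f + \<theta> g) b\<close>.\<close>

lemma structure_iso_dual: "structure_iso Y (dual_curve Y z \<theta>) (Psi Y z \<theta>)"
proof
  show "tp (dual_curve Y z \<theta>) = tp Y" "base (dual_curve Y z \<theta>) = base Y" by simp_all
  fix V assume V: "V \<in> opens Y (whole Y)"
  interpret odd_plane "sec Y V" "regular_module (sec Y V)" "pz V V" "pz V V" "pt V V" "pt V V" "\<theta>_on V"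
    by (rule odd_plane_sections[OF V])
  show "bij_betw (Psi Y z \<theta> V) (carrier (sec Y V)) (carrier (sec (dual_curve Y z \<theta>) V))"
    using bij_extend Psi_eq[OF V] dual_sections_eq[OF V]
    by (simp add: bij_betw_cong[of "carrier (sec Y V)" "Psi Y z \<theta> V" extend])
  show "Psi Y z \<theta> V \<zero>\<^bsub>sec Y V\<^esub> = \<zero>\<^bsub>sec (dual_curve Y z \<theta>) V\<^esub>"
    using extend_zero by (simp add: Psi_eq[OF V])
  show "Psi Y z \<theta> V \<one>\<^bsub>sec Y V\<^esub> = \<one>\<^bsub>sec (dual_curve Y z \<theta>) V\<^esub>"
    by (simp add: Psi_eq[OF V] extend_def partial_constants[OF V] a_minus_def closed)
  show "Psi Y z \<theta> V (alg Y V l) = alg (dual_curve Y z \<theta>) V l" if "l \<in> carrier (base Y)" for l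
    using that alg_closed[OF V that]
    by (simp add: Psi_eq[OF V] extend_def partial_constants[OF V] a_minus_def closed)
  show "Psi Y z \<theta> V ` gr (sec Y V) p = gr (sec (dual_curve Y z \<theta>) V) p" for p
    using extend_gr_image[of p] Psi_eq[OF V] gr_carrier dual_sections_eq[OF V]
    by (simp add: image_cong[of "gr (sec Y V) p" _ "Psi Y z \<theta> V" extend])
  show "Psi Y z \<theta> V (a \<oplus>\<^bsub>sec Y V\<^esub> b) = Psi Y z \<theta> V a \<oplus>\<^bsub>sec (dual_curve Y z \<theta>) V\<^esub> Psi Y z \<theta> V b"
    if "a \<in> carrier (sec Y V)" "b \<in> carrier (sec Y V)" for a b
    using extend_add[of a b] that by (simp add: Psi_eq[OF V] pullback_regular)
  show "Psi Y z \<theta> V (a \<otimes>\<^bsub>sec Y V\<^esub> b) = Psi Y z \<theta> V a \<otimes>\<^bsub>sec (dual_curve Y z \<theta>) V\<^esub> Psi Y z \<theta> V b"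
    if ab: "a \<in> carrier (sec Y V)" "b \<in> carrier (sec Y V)" for a b
  proof -
    obtain f g where fg: "extend a = (f, g)" "f \<in> carrier (sec Y V)" "g \<in> carrier (sec Y V)"
      "pt V V f = \<zero>\<^bsub>sec Y V\<^esub>" "pt V V g = pz V V f"
      using extend_horizontal[of a] ab(1) by (auto elim!: horizontalE)
    have "f \<oplus>\<^bsub>sec Y V\<^esub> \<theta>_on V \<otimes>\<^bsub>sec Y V\<^esub> g = a"
      using diagonal_extend[of a] ab(1) fg(1) by (simp add: diagonal_def)
    then show ?thesis
      using extend_smult[OF fg(2-5), of b] ab fg(1) by (simp add: Psi_eq[OF V] pullback_regular)
  qed
  fix W assume W: "W \<in> opens Y V"
  note W' = opens_trans[OF V W]
  interpret W: odd_plane "sec Y W" "regular_module (sec Y W)" "pz W W" "pz W W" "pt W W" "pt W W" "\<theta>_on W"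
    by (rule odd_plane_sections[OF W'])
  show "res (dual_curve Y z \<theta>) V W (Psi Y z \<theta> V a) = Psi Y z \<theta> W (res Y V W a)"
    if a: "a \<in> carrier (sec Y V)" for a
    using a res_closed[OF V W a] coordinates_res[OF V W]
    by (simp add: Psi_eq[OF V] Psi_eq[OF W'] extend_def W.extend_def a_minus_def
      res_add[OF V W] res_mult[OF V W] res_neg[OF V W] partial_res_section[OF V W]
      closed Z.d_closed T.d_closed coordinates_closed[OF V])
qed

end

sublocale coordinate_patch \<subseteq> dual: structure_iso Y "dual_curve Y z \<theta>" "Psi Y z \<theta>"
  by (rule structure_iso_dual)

section \<open>Vertical vector fields and lifts\<close>

text \<open>With \<open>Z = v(z)\<close>, \<open>T = v(\<theta>)\<close>, \<open>r = v(\<rho>)\<close>, \<open>x = \<rho>\<close>, \<open>s = \<theta>\<close> and the three covariant derivatives \<open>A\<close>, \<open>B\<close>, \<open>C\<close> of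
  a horizontal section, this rewrites \<open>\<nabla>\<^sub>v\<close> in terms of \<open>v(u)\<close> and \<open>v(\<rho>)\<close>.\<close>

lemma (in supermodule) eliminate_vertical_part:
  assumes "Z \<in> carrier R" "T \<in> carrier R" "r \<in> carrier R" "x \<in> carrier R" "s \<in> carrier R"
    and "A \<in> carrier M" "B \<in> carrier M" "C \<in> carrier M"
    and vertical: "(x \<odot>\<^bsub>M\<^esub> A) \<oplus>\<^bsub>M\<^esub> B = \<zero>\<^bsub>M\<^esub>"
  shows "(Z \<odot>\<^bsub>M\<^esub> A) \<oplus>\<^bsub>M\<^esub> (T \<odot>\<^bsub>M\<^esub> B) \<oplus>\<^bsub>M\<^esub> (r \<odot>\<^bsub>M\<^esub> C) =
    ((Z \<ominus> (T \<otimes> x \<ominus> r \<otimes> s)) \<odot>\<^bsub>M\<^esub> A) \<oplus>\<^bsub>M\<^esub> (r \<odot>\<^bsub>M\<^esub> (C \<ominus>\<^bsub>M\<^esub> s \<odot>\<^bsub>M\<^esub> A))"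
proof -
  have "B \<oplus>\<^bsub>M\<^esub> (x \<odot>\<^bsub>M\<^esub> A) = \<zero>\<^bsub>M\<^esub>"
    using vertical assms M.a_comm[of "x \<odot>\<^bsub>M\<^esub> A" B] by (simp add: smult_closed)
  then have B: "B = \<ominus>\<^bsub>M\<^esub> (x \<odot>\<^bsub>M\<^esub> A)"
    using M.minus_equality[of B "x \<odot>\<^bsub>M\<^esub> A"] assms by (simp add: smult_closed)
  show ?thesis
    unfolding B using assms(1-6,8)
    by (simp add: module_simps a_minus_def minus_add M.cancel_middle)
qed

context coordinate_patch
begin

definition z_field :: "'x set \<Rightarrow> 'x set \<Rightarrow> 'a \<times> 'a \<Rightarrow> 'a \<times> 'a" where
  "z_field V = (\<lambda>W\<in>opens (Delta Y) V. \<lambda>s\<in>carrier (sec (Delta Y) W). even_ext (pz W W) s)"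

definition \<theta>_field :: "'x set \<Rightarrow> 'x set \<Rightarrow> 'a \<times> 'a \<Rightarrow> 'a \<times> 'a" where
  "\<theta>_field V = (\<lambda>W\<in>opens (Delta Y) V. \<lambda>s\<in>carrier (sec (Delta Y) W). odd_ext (sec Y W) (pt W W) s)"

definition \<rho>_field :: "'x set \<Rightarrow> 'x set \<Rightarrow> 'a \<times> 'a \<Rightarrow> 'a \<times> 'a" where
  "\<rho>_field V = (\<lambda>W\<in>opens (Delta Y) V. \<lambda>s\<in>carrier (sec (Delta Y) W).
     (\<lambda>(f, g). (g, \<zero>\<^bsub>sec Y W\<^esub>)) s)"

lemma partial_superderivation:
  assumes "V \<in> opens Y (whole Y)"
  shows "superderivation (sec Y V) False (pz V V)" "superderivation (sec Y V) True (pt V V)"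
  using vf_superderivation[OF assms _ opens_self[OF assms]] partial_z(1)[OF assms]
    partial_\<theta>(1)[OF assms] by auto

lemma Delta_fields:
  assumes V: "V \<in> opens Y (whole Y)"
  shows "z_field V \<in> vf (Delta Y) V False" "\<theta>_field V \<in> vf (Delta Y) V True"
    "\<rho>_field V \<in> vf (Delta Y) V True"
proof -
  interpret D: super_presheaf "Delta Y" by (rule presheaf_Delta)
  have VD: "V \<in> opens (Delta Y) (whole (Delta Y))" using V by simp

  have *: "superderivation (sec (Delta Y) W) False (even_ext (pz W W))"
    "superderivation (sec (Delta Y) W) True (odd_ext (sec Y W) (pt W W))"
    "superderivation (sec (Delta Y) W) True (\<lambda>(f, g). (g, \<zero>\<^bsub>sec Y W\<^esub>))"
    if W: "W \<in> opens Y V" for W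
  proof -
    note W' = opens_trans[OF V W]
    interpret supercommutative "sec Y W" by (rule sections[OF W'])
    show "superderivation (sec (Delta Y) W) False (even_ext (pz W W))"
      "superderivation (sec (Delta Y) W) True (odd_ext (sec Y W) (pt W W))"
      "superderivation (sec (Delta Y) W) True (\<lambda>(f, g). (g, \<zero>\<^bsub>sec Y W\<^esub>))"
      using even_ext_superderivation odd_ext_superderivation rho_superderivation
        partial_superderivation[OF W'] by auto
  qed
  have alg: "even_ext (pz W W) (alg (Delta Y) W l) = \<zero>\<^bsub>sec (Delta Y) W\<^esub>"
    "odd_ext (sec Y W) (pt W W) (alg (Delta Y) W l) = \<zero>\<^bsub>sec (Delta Y) W\<^esub>"
    "(\<lambda>(f, g). (g, \<zero>\<^bsub>sec Y W\<^esub>)) (alg (Delta Y) W l) = \<zero>\<^bsub>sec (Delta Y) W\<^esub>"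
    if W: "W \<in> opens Y V" and l: "l \<in> carrier (base Y)" for W l
  proof -
    note W' = opens_trans[OF V W]
    interpret odd_plane "sec Y W" "regular_module (sec Y W)" "pz W W" "pz W W" "pt W W" "pt W W" "\<theta>_on W"
      by (rule odd_plane_sections[OF W'])
    show "even_ext (pz W W) (alg (Delta Y) W l) = \<zero>\<^bsub>sec (Delta Y) W\<^esub>"
      "odd_ext (sec Y W) (pt W W) (alg (Delta Y) W l) = \<zero>\<^bsub>sec (Delta Y) W\<^esub>"
      "(\<lambda>(f, g). (g, \<zero>\<^bsub>sec Y W\<^esub>)) (alg (Delta Y) W l) = \<zero>\<^bsub>sec (Delta Y) W\<^esub>"
      using l by (simp_all add: even_ext_def odd_ext_def partial_constants[OF W'] Z.d_zero T.d_zero)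
  qed
  have res: "res (Delta Y) W W' (even_ext (pz W W) a) = even_ext (pz W' W') (res (Delta Y) W W' a)"
    "res (Delta Y) W W' (odd_ext (sec Y W) (pt W W) a) =
      odd_ext (sec Y W') (pt W' W') (res (Delta Y) W W' a)"
    "res (Delta Y) W W' ((\<lambda>(f, g). (g, \<zero>\<^bsub>sec Y W\<^esub>)) a) =
      (\<lambda>(f, g). (g, \<zero>\<^bsub>sec Y W'\<^esub>)) (res (Delta Y) W W' a)"
    if W: "W \<in> opens Y V" and W': "W' \<in> opens Y W" and a: "a \<in> carrier (sec (Delta Y) W)" for W W' a
  proof -
    note WV = opens_trans[OF V W]
    interpret T: super_operator "sec Y W" "regular_module (sec Y W)" True "pt W W" "pt W W"
      by (rule partial_superderivation(2)[OF WV])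
    show "res (Delta Y) W W' (even_ext (pz W W) a) = even_ext (pz W' W') (res (Delta Y) W W' a)"
      "res (Delta Y) W W' (odd_ext (sec Y W) (pt W W) a) =
        odd_ext (sec Y W') (pt W' W') (res (Delta Y) W W' a)"
      "res (Delta Y) W W' ((\<lambda>(f, g). (g, \<zero>\<^bsub>sec Y W\<^esub>)) a) =
        (\<lambda>(f, g). (g, \<zero>\<^bsub>sec Y W'\<^esub>)) (res (Delta Y) W W' a)"
      using a by (cases a; simp add: even_ext_def odd_ext_def partial_res_section[OF WV W']
        res_neg[OF WV W'] res_zero[OF WV W'] T.d_closed)+
  qed
  show "z_field V \<in> vf (Delta Y) V False"
    unfolding z_field_def
    by (rule D.vf_restrictI[OF VD]; (rule *(1) | rule alg(1) | rule res(1));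
      simp only: opens_Delta Delta_simps(2))
  show "\<theta>_field V \<in> vf (Delta Y) V True"
    unfolding \<theta>_field_def
    by (rule D.vf_restrictI[OF VD]; (rule *(2) | rule alg(2) | rule res(2));
      simp only: opens_Delta Delta_simps(2))
  show "\<rho>_field V \<in> vf (Delta Y) V True"
    unfolding \<rho>_field_def
    by (rule D.vf_restrictI[OF VD]; (rule *(3) | rule alg(3) | rule res(3));
      simp only: opens_Delta Delta_simps(2))
qed

lemma rho_gr:
  assumes V: "V \<in> opens Y (whole Y)" shows "rho Y V \<in> gr (Delta_sec (sec Y V)) True"
proof -
  interpret supercommutative "sec Y V" by (rule sections[OF V])
  show ?thesis by (simp add: rho_def gr_one gr_zero)
qed

text \<open>The field is \<open>\<rho> \<partial>\<^sub>z + \<partial>\<^sub>\<theta>\<close>, which is vertical because the functions on the dual curve are its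
  kernel. Testing a section of the transform on it shows that the section is horizontal.\<close>

lemma vertical_field:
  assumes V: "V \<in> opens Y (whole Y)"
  obtains v where "v \<in> vertical Y z \<theta> V True"
    "v V (pull Y V (z_on V)) = rho Y V" "v V (pull Y V (\<theta>_on V)) = \<one>\<^bsub>sec (Delta Y) V\<^esub>"
    "v V (rho Y V) = \<zero>\<^bsub>sec (Delta Y) V\<^esub>"
proof -
  interpret D: super_presheaf "Delta Y" by (rule presheaf_Delta)
  have VD: "V \<in> opens (Delta Y) (whole (Delta Y))" using V by simp
  note f = Delta_fields[OF V]
  define v where "v = vf_add (Delta Y) V (vf_smult (Delta Y) V (rho Y V) (z_field V)) (\<theta>_field V)"
  have "vf_smult (Delta Y) V (rho Y V) (z_field V) \<in> vf (Delta Y) V True"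
    using D.vf_smult_vf[OF VD _ f(1), of "rho Y V" True] rho_gr[OF V] by simp
  then have v: "v \<in> vf (Delta Y) V True"
    unfolding v_def by (rule D.vf_add_vf[OF VD _ f(2)])
  have v_eq: "v W s = d_tilde Y z \<theta> W s" if W: "W \<in> opens Y V" and s: "s \<in> carrier (sec (Delta Y) W)" for W s
  proof -
    have "res (Delta Y) V W (rho Y V) = rho Y W"
      using V W by (simp add: rho_def res_zero res_one)
    then show ?thesis
      using W s by (simp add: v_def vf_add_def vf_smult_def z_field_def \<theta>_field_def d_tilde_def
        flip: Delta_simps(3))
  qed
  interpret odd_plane "sec Y V" "regular_module (sec Y V)" "pz V V" "pz V V" "pt V V" "pt V V" "\<theta>_on V"
    by (rule odd_plane_sections[OF V])
  have "v \<in> vertical Y z \<theta> V True"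
    using v v_eq by (auto simp: vertical_def dual_sections_def)
  moreover have "v V (pull Y V (z_on V)) = rho Y V"
    "v V (pull Y V (\<theta>_on V)) = \<one>\<^bsub>sec (Delta Y) V\<^esub>" "v V (rho Y V) = \<zero>\<^bsub>sec (Delta Y) V\<^esub>"
    using coordinates_closed[OF V] opens_self[OF V]
    by (simp_all add: v_eq pull_def rho_def d_tilde_eq[OF V] partial_z[OF V] partial_\<theta>[OF V]
      Z.d_zero T.d_zero partial_constants[OF V] a_minus_def)
  ultimately show thesis using that by blast
qed

text \<open>The Leibniz rule for \<open>u = z - \<theta>\<rho>\<close>. The sign in it and the sign for moving \<open>\<theta>\<close> past \<open>v(\<rho>)\<close>, whose
  parity is opposite to that of \<open>v\<close>, multiply to \<open>-1\<close> for either parity of \<open>v\<close>.\<close>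

lemma vf_Delta_z:
  assumes V: "V \<in> opens Y (whole Y)" and v: "v \<in> vf (Delta Y) V p"
  shows "v V (u_coord Y z \<theta> V) = v V (pull Y V (z_on V)) \<ominus>\<^bsub>sec (Delta Y) V\<^esub>
    (v V (pull Y V (\<theta>_on V)) \<otimes>\<^bsub>sec (Delta Y) V\<^esub> rho Y V \<ominus>\<^bsub>sec (Delta Y) V\<^esub>
     v V (rho Y V) \<otimes>\<^bsub>sec (Delta Y) V\<^esub> pull Y V (\<theta>_on V))"
proof -
  interpret D: super_presheaf "Delta Y" by (rule presheaf_Delta)
  have VD: "V \<in> opens (Delta Y) (whole (Delta Y))" using V by simp
  interpret V: supercommutative "sec Y V" by (rule sections[OF V])
  interpret v: super_operator "sec (Delta Y) V" "regular_module (sec (Delta Y) V)" p "v V" "v V"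
    by (rule D.vf_superderivation[OF VD v opens_self[OF VD]])
  have z: "pull Y V (z_on V) \<in> gr (sec (Delta Y) V) False"
    and t: "pull Y V (\<theta>_on V) \<in> gr (sec (Delta Y) V) True" and r: "rho Y V \<in> gr (sec (Delta Y) V) True"
    using z_on_gr[OF V] \<theta>_on_gr[OF V] rho_gr[OF V] V.gr_zero by (simp_all add: pull_def)
  note c = z[THEN v.gr_carrier] t[THEN v.gr_carrier] r[THEN v.gr_carrier]
  have "pull Y V (\<theta>_on V) \<otimes>\<^bsub>sec (Delta Y) V\<^esub> v V (rho Y V) =
      sg (sec (Delta Y) V) (\<not> p) (v V (rho Y V) \<otimes>\<^bsub>sec (Delta Y) V\<^esub> pull Y V (\<theta>_on V))"
    using v.supercommute[OF t v.d_gr[OF r]] by simp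
  then have "v V (pull Y V (\<theta>_on V) \<otimes>\<^bsub>sec (Delta Y) V\<^esub> rho Y V) =
      v V (pull Y V (\<theta>_on V)) \<otimes>\<^bsub>sec (Delta Y) V\<^esub> rho Y V \<ominus>\<^bsub>sec (Delta Y) V\<^esub>
      v V (rho Y V) \<otimes>\<^bsub>sec (Delta Y) V\<^esub> pull Y V (\<theta>_on V)"
    using v.op_leibniz[OF t, of "rho Y V"] c
    by (cases p) (simp_all add: a_minus_def v.d_closed del: Delta_simps)
  then show ?thesis
    using c by (simp add: u_coord_def a_minus_def v.d_add v.d_neg v.d_closed del: Delta_simps)
qed

end

section \<open>The transform in coordinates\<close>

lemma pullback_simps [simp]:
  "msec (pullback Y z \<theta> F) V = pullback_sec (sec Y V) (msec F V)"
  "mres (pullback Y z \<theta> F) V W = map_prod (mres F V W) (mres F V W)"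
  by (simp_all add: pullback_def)

lemma conn_pullback:
  "conn (pullback Y z \<theta> F) V w s =
    (w V (pull Y V (res Y (whole Y) V z)) \<odot>\<^bsub>pullback_sec (sec Y V) (msec F V)\<^esub> nabla_z Y z \<theta> F V s)
      \<oplus>\<^bsub>pullback_sec (sec Y V) (msec F V)\<^esub>
    (w V (pull Y V (res Y (whole Y) V \<theta>)) \<odot>\<^bsub>pullback_sec (sec Y V) (msec F V)\<^esub> nabla_\<theta> Y z \<theta> F V s)
      \<oplus>\<^bsub>pullback_sec (sec Y V) (msec F V)\<^esub>
    (w V (rho Y V) \<odot>\<^bsub>pullback_sec (sec Y V) (msec F V)\<^esub> nabla_\<rho> F V s)"
  by (simp add: pullback_def Let_def)

context patch_dmodule
begin

abbreviation P where "P \<equiv> pullback Y z \<theta> F"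

abbreviation horizontal_on where
  "horizontal_on V \<equiv> odd_plane.horizontal (msec F V) (conn F V (pz V)) (conn F V (pt V))"

abbreviation extend_module where
  "extend_module V \<equiv> odd_plane.extend (msec F V) (conn F V (pz V)) (conn F V (pt V)) (\<theta>_on V)"

lemma tau_incl:
  assumes V: "V \<in> opens Y (whole Y)" and m: "m \<in> carrier (msec F V)"
  shows "tau Y z \<theta> F V (incl F V m) = extend_module V m"
proof -
  interpret odd_plane "sec Y V" "msec F V" "pz V V" "conn F V (pz V)" "pt V V" "conn F V (pt V)" "\<theta>_on V"
    by (rule odd_plane_module[OF V])
  show ?thesis
    using m by (simp add: tau_def Let_def incl_def pull_def rho_def nabla_z_def nabla_\<theta>_def
      even_ext_def odd_ext_def extend_def par_zero par_closed closed a_minus_def pullback_neg Z.op_zero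
      T.op_zero smult_zero zero_smult one_smult par_homogeneous[OF t_odd] neg_smult M.neg_zero)
qed

lemma extend_module_res:
  assumes V: "V \<in> opens Y (whole Y)" and W: "W \<in> opens Y V" and m: "m \<in> carrier (msec F V)"
  shows "mres P V W (extend_module V m) = extend_module W (mres F V W m)"
proof -
  note W' = opens_trans[OF V W]
  interpret odd_plane "sec Y V" "msec F V" "pz V V" "conn F V (pz V)" "pt V V" "conn F V (pt V)" "\<theta>_on V"
    by (rule odd_plane_module[OF V])
  interpret W: odd_plane "sec Y W" "msec F W" "pz W W" "conn F W (pz W)" "pt W W" "conn F W (pt W)" "\<theta>_on W"
    by (rule odd_plane_module[OF W'])
  have neg: "mres F V W (\<ominus>\<^bsub>msec F V\<^esub> n) = \<ominus>\<^bsub>msec F W\<^esub> mres F V W n" if n: "n \<in> carrier (msec F V)" for n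
    using mres_smult[OF V W _ n, of "\<ominus>\<^bsub>sec Y V\<^esub> \<one>\<^bsub>sec Y V\<^esub>"] n mres_closed[OF V W n]
    by (simp add: res_neg[OF V W] res_one[OF V W] neg_smult W.neg_smult one_smult W.one_smult)
  have conn: "mres F V W (conn F V (pz V) m) = conn F W (pz W) (mres F V W m)"
    "mres F V W (conn F V (pt V) m) = conn F W (pt W) (mres F V W m)"
    using conn_res[OF V partial_z(1)[OF V] W m] conn_res[OF V partial_\<theta>(1)[OF V] W m]
      partial_res[OF V W] by simp_all
  show ?thesis
    using m by (simp add: extend_def W.extend_def a_minus_def closed neg conn mres_add[OF V W]
      mres_smult[OF V W] coordinates_res[OF V W])
qed

lemma horizontal_vertical_field:
  assumes V: "V \<in> opens Y (whole Y)" and s: "s \<in> carrier (msec P V)"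
  shows "(rho Y V \<odot>\<^bsub>msec P V\<^esub> nabla_z Y z \<theta> F V s) \<oplus>\<^bsub>msec P V\<^esub> nabla_\<theta> Y z \<theta> F V s = \<zero>\<^bsub>msec P V\<^esub>
    \<longleftrightarrow> s \<in> horizontal_on V"
proof -
  interpret odd_plane "sec Y V" "msec F V" "pz V V" "conn F V (pz V)" "pt V V" "conn F V (pt V)" "\<theta>_on V"
    by (rule odd_plane_module[OF V])
  obtain a b where ab: "s = (a, b)" "a \<in> carrier (msec F V)" "b \<in> carrier (msec F V)"
    using s by (cases s) simp
  have "conn F V (pz V) a \<oplus>\<^bsub>msec F V\<^esub> \<ominus>\<^bsub>msec F V\<^esub> conn F V (pt V) b = \<zero>\<^bsub>msec F V\<^esub> \<longleftrightarrow>
      conn F V (pt V) b = conn F V (pz V) a"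
    using M.minus_eq_zeroD[of "conn F V (pz V) a" "conn F V (pt V) b"] ab(2,3)
    by (auto simp: a_minus_def closed M.r_neg)
  then show ?thesis
    using ab(2,3) by (simp add: ab(1) rho_def nabla_z_def nabla_\<theta>_def even_ext_def odd_ext_def par_zero
      closed zero_smult one_smult horizontal_def)
qed

text \<open>A vector field on \<open>\<Delta>\<close> acts on horizontal sections through its values on \<open>u\<close> and \<open>\<rho>\<close> alone. This makes
  the connection on the transform independent of lifts, and since vertical fields annihilate \<open>u\<close>
  and \<open>\<rho>\<close>, it also shows that they annihilate horizontal sections.\<close>

lemma conn_lift:
  assumes V: "V \<in> opens Y (whole Y)" and v: "v \<in> vf (Delta Y) V p" and s: "s \<in> horizontal_on V"
  shows "conn P V v s = (v V (u_coord Y z \<theta> V) \<odot>\<^bsub>msec P V\<^esub> nabla_z Y z \<theta> F V s) \<oplus>\<^bsub>msec P V\<^esub>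
    (v V (rho Y V) \<odot>\<^bsub>msec P V\<^esub> (nabla_\<rho> F V s \<ominus>\<^bsub>msec P V\<^esub>
      (pull Y V (\<theta>_on V) \<odot>\<^bsub>msec P V\<^esub> nabla_z Y z \<theta> F V s)))"
proof -
  interpret D: super_presheaf "Delta Y" by (rule presheaf_Delta)
  have VD: "V \<in> opens (Delta Y) (whole (Delta Y))" using V by simp
  interpret M: odd_plane "sec Y V" "msec F V" "pz V V" "conn F V (pz V)" "pt V V" "conn F V (pt V)" "\<theta>_on V"
    by (rule odd_plane_module[OF V])
  interpret P: supermodule "Delta_sec (sec Y V)" "pullback_sec (sec Y V) (msec F V)"
    by (rule M.supermodule_pullback)
  interpret v: super_operator "sec (Delta Y) V" "regular_module (sec (Delta Y) V)" p "v V" "v V"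
    by (rule D.vf_superderivation[OF VD v opens_self[OF VD]])
  obtain a b where ab: "s = (a, b)" "a \<in> carrier (msec F V)" "b \<in> carrier (msec F V)"
    using s by (rule M.horizontalE)
  have c: "pull Y V (z_on V) \<in> carrier (Delta_sec (sec Y V))"
    "pull Y V (\<theta>_on V) \<in> carrier (Delta_sec (sec Y V))" "rho Y V \<in> carrier (Delta_sec (sec Y V))"
    using coordinates_closed[OF V] by (simp_all add: pull_def rho_def)
  have v_c: "v V f \<in> carrier (Delta_sec (sec Y V))" if "f \<in> carrier (Delta_sec (sec Y V))" for f
    using v.d_closed[of f] that by simp
  have n: "nabla_z Y z \<theta> F V s \<in> carrier (pullback_sec (sec Y V) (msec F V))"
    "nabla_\<theta> Y z \<theta> F V s \<in> carrier (pullback_sec (sec Y V) (msec F V))"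
    "nabla_\<rho> F V s \<in> carrier (pullback_sec (sec Y V) (msec F V))"
    using ab(2,3) by (simp_all add: ab(1) nabla_z_def nabla_\<theta>_def nabla_\<rho>_def even_ext_def odd_ext_def
      M.closed)
  have "(rho Y V \<odot>\<^bsub>pullback_sec (sec Y V) (msec F V)\<^esub> nabla_z Y z \<theta> F V s)
      \<oplus>\<^bsub>pullback_sec (sec Y V) (msec F V)\<^esub> nabla_\<theta> Y z \<theta> F V s = \<zero>\<^bsub>pullback_sec (sec Y V) (msec F V)\<^esub>"
    using horizontal_vertical_field[OF V, of s] s ab by simp
  from P.eliminate_vertical_part[OF v_c[OF c(1)] v_c[OF c(2)] v_c[OF c(3)] c(3,2) n this]
  show ?thesis
    using vf_Delta_z[OF V v] by (simp only: conn_pullback pullback_simps Delta_simps)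
qed

lemma dual_closed:
  assumes V: "V \<in> opens Y (whole Y)"
  shows "u_coord Y z \<theta> V \<in> dual_sections Y z \<theta> V" "rho Y V \<in> dual_sections Y z \<theta> V"
  using dual.\<Psi>_closed[OF V coordinates_closed(1)[OF V]] dual.\<Psi>_closed[OF V coordinates_closed(2)[OF V]]
  by (simp_all add: u_coord_eq(2)[OF V] Psi_\<theta>[OF V])

text \<open>Horizontality for \<open>\<rho> \<partial>\<^sub>z + \<partial>\<^sub>\<theta>\<close> over \<open>V\<close> already gives it for all vertical fields over all open subsets,
  as these fields act through \<open>u\<close> and \<open>\<rho>\<close>, which they annihilate.\<close>

lemma transform_sections_eq:
  assumes V: "V \<in> opens Y (whole Y)"
  shows "transform_sections Y z \<theta> F V = horizontal_on V"
proof
  interpret odd_plane "sec Y V" "msec F V" "pz V V" "conn F V (pz V)" "pt V V" "conn F V (pt V)" "\<theta>_on V"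
    by (rule odd_plane_module[OF V])
  interpret P: supermodule "Delta_sec (sec Y V)" "pullback_sec (sec Y V) (msec F V)"
    by (rule supermodule_pullback)
  show "transform_sections Y z \<theta> F V \<subseteq> horizontal_on V"
  proof
    fix s assume s: "s \<in> transform_sections Y z \<theta> F V"
    then have sc: "s \<in> carrier (msec P V)" by (simp add: transform_sections_def)
    have sV: "mres P V V s = s" using sc by (cases s) (simp add: mres_id[OF V])
    obtain v where v: "v \<in> vertical Y z \<theta> V True"
      "v V (pull Y V (z_on V)) = rho Y V" "v V (pull Y V (\<theta>_on V)) = \<one>\<^bsub>sec (Delta Y) V\<^esub>"
      "v V (rho Y V) = \<zero>\<^bsub>sec (Delta Y) V\<^esub>"
      by (rule vertical_field[OF V])
    have "conn P V v (mres P V V s) = \<zero>\<^bsub>msec P V\<^esub>"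
      using s v(1) opens_self[OF V] unfolding transform_sections_def by blast
    then have "conn P V v s = \<zero>\<^bsub>msec P V\<^esub>" by (simp only: sV)
    moreover obtain a b where ab: "s = (a, b)" "a \<in> carrier (msec F V)" "b \<in> carrier (msec F V)"
      using sc by (cases s) simp
    have n: "nabla_z Y z \<theta> F V s \<in> carrier (pullback_sec (sec Y V) (msec F V))"
      "nabla_\<theta> Y z \<theta> F V s \<in> carrier (pullback_sec (sec Y V) (msec F V))"
      "nabla_\<rho> F V s \<in> carrier (pullback_sec (sec Y V) (msec F V))"
      using ab(2,3) by (simp_all add: ab(1) nabla_z_def nabla_\<theta>_def nabla_\<rho>_def even_ext_def odd_ext_def
        closed)
    have rc: "rho Y V \<in> carrier (Delta_sec (sec Y V))" by (simp add: rho_def)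
    have "conn P V v s = (rho Y V \<odot>\<^bsub>msec P V\<^esub> nabla_z Y z \<theta> F V s) \<oplus>\<^bsub>msec P V\<^esub> nabla_\<theta> Y z \<theta> F V s"
      using n rc P.smult_closed[OF rc n(1)]
      by (simp add: conn_pullback v(2-4)[unfolded Delta_simps] P.one_smult P.zero_smult
        del: pullback_sec_simps Delta_sec_simps)
    ultimately show "s \<in> horizontal_on V"
      using horizontal_vertical_field[OF V sc] by simp
  qed
  show "horizontal_on V \<subseteq> transform_sections Y z \<theta> F V"
  proof
    fix s assume s: "s \<in> horizontal_on V"
    have sc: "s \<in> carrier (msec P V)" using s by (simp add: horizontal_def)
    have "conn P W v (mres P V W s) = \<zero>\<^bsub>msec P W\<^esub>"
      if W: "W \<in> opens Y V" and v: "v \<in> vertical Y z \<theta> W p" for W p v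
    proof -
      note W' = opens_trans[OF V W]
      interpret W: odd_plane "sec Y W" "msec F W" "pz W W" "conn F W (pz W)" "pt W W" "conn F W (pt W)" "\<theta>_on W"
        by (rule odd_plane_module[OF W'])
      interpret PW: supermodule "Delta_sec (sec Y W)" "pullback_sec (sec Y W) (msec F W)"
        by (rule W.supermodule_pullback)
      obtain m where m: "m \<in> carrier (msec F V)" "s = extend_module V m"
      proof
        show "diagonal s \<in> carrier (msec F V)" using diagonal_closed sc by simp
        show "s = extend_module V (diagonal s)" using extend_diagonal[OF s] by simp
      qed
      have sW: "mres P V W s \<in> horizontal_on W"
        using extend_module_res[OF V W m(1)] m(2) W.extend_horizontal[OF mres_closed[OF V W m(1)]] by simp
      have vv: "v \<in> vf (Delta Y) W p" and kill: "v W f = \<zero>\<^bsub>sec (Delta Y) W\<^esub>" if "f \<in> dual_sections Y z \<theta> W" for f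
        using v opens_self[OF W] that by (simp_all add: vertical_def)
      obtain a b where ab: "mres P V W s = (a, b)" "a \<in> carrier (msec F W)" "b \<in> carrier (msec F W)"
        using sW by (rule W.horizontalE)
      have n: "nabla_z Y z \<theta> F W (mres P V W s) \<in> carrier (pullback_sec (sec Y W) (msec F W))"
        "nabla_\<rho> F W (mres P V W s) \<in> carrier (pullback_sec (sec Y W) (msec F W))"
        using ab(2,3) by (simp_all only: ab(1)) (simp_all add: nabla_z_def nabla_\<rho>_def even_ext_def
          W.closed)
      have t: "pull Y W (\<theta>_on W) \<in> carrier (Delta_sec (sec Y W))"
        using coordinates_closed[OF W'] by (simp add: pull_def)
      show ?thesis
        unfolding conn_lift[OF W' vv[OF dual_closed(1)[OF W']] sW] kill[OF dual_closed(1)[OF W']]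
          kill[OF dual_closed(2)[OF W']]
        using n PW.smult_closed[OF t n(1)]
        by (simp add: PW.zero_smult del: pullback_simps(2) pullback_sec_simps Delta_sec_simps)
    qed
    then show "s \<in> transform_sections Y z \<theta> F V" using sc by (simp add: transform_sections_def)
  qed
qed

lemma extend_module_smult:
  assumes V: "V \<in> opens Y (whole Y)" and f: "f \<in> carrier (sec Y V)" and n: "n \<in> carrier (msec F V)"
  shows "Psi Y z \<theta> V f \<odot>\<^bsub>msec P V\<^esub> extend_module V n = extend_module V (f \<odot>\<^bsub>msec F V\<^esub> n)"
proof -
  interpret M: odd_plane "sec Y V" "msec F V" "pz V V" "conn F V (pz V)" "pt V V" "conn F V (pt V)" "\<theta>_on V"
    by (rule odd_plane_module[OF V])
  interpret S: odd_plane "sec Y V" "regular_module (sec Y V)" "pz V V" "pz V V" "pt V V" "pt V V" "\<theta>_on V"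
    by (rule odd_plane_sections[OF V])
  obtain a b where ab: "extend_on V f = (a, b)" "a \<in> carrier (sec Y V)" "b \<in> carrier (sec Y V)"
    "pt V V a = \<zero>\<^bsub>sec Y V\<^esub>" "pt V V b = pz V V a"
    using S.extend_horizontal[of f] f by (auto elim!: S.horizontalE)
  have "a \<oplus>\<^bsub>sec Y V\<^esub> \<theta>_on V \<otimes>\<^bsub>sec Y V\<^esub> b = f"
    using S.diagonal_extend[of f] f ab(1) by (simp add: S.diagonal_def)
  then show ?thesis
    using M.extend_smult[OF ab(2-5) n] by (simp add: Psi_eq[OF V f] ab(1))
qed

text \<open>The coordinate fields \<open>\<partial>\<^sub>z\<close>, \<open>\<partial>\<^sub>\<theta>\<close> correspond to \<open>\<nabla>\<^sub>z\<close> and \<open>\<nabla>\<^sub>\<rho> - \<theta> \<nabla>\<^sub>z\<close> on extensions, and the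
  coefficients of \<open>w\<close> pass through the extension as \<open>\<Psi>\<close> of themselves.\<close>

lemma conn_extend:
  assumes V: "V \<in> opens Y (whole Y)" and v: "v \<in> vf (Delta Y) V p" and w: "w \<in> vf Y V q"
    and u: "v V (u_coord Y z \<theta> V) = Psi Y z \<theta> V (w V (z_on V))"
    and \<rho>: "v V (rho Y V) = Psi Y z \<theta> V (w V (\<theta>_on V))" and m: "m \<in> carrier (msec F V)"
  shows "conn P V v (extend_module V m) = extend_module V (conn F V w m)"
proof -
  interpret M: odd_plane "sec Y V" "msec F V" "pz V V" "conn F V (pz V)" "pt V V" "conn F V (pt V)" "\<theta>_on V"
    by (rule odd_plane_module[OF V])
  have w_c: "w V (z_on V) \<in> carrier (sec Y V)" "w V (\<theta>_on V) \<in> carrier (sec Y V)"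
    using vf_expansion(1,2)[OF V w] M.gr_carrier by auto
  note smult = extend_module_smult[OF V]
  have nz: "nabla_z Y z \<theta> F V (extend_module V m) = extend_module V (conn F V (pz V) m)"
    using M.extend_nz[OF m] by (simp add: nabla_z_def)
  have "(pull Y V (\<theta>_on V) \<odot>\<^bsub>msec P V\<^esub> extend_module V (conn F V (pz V) m)) =
      (\<theta>_on V, \<zero>\<^bsub>sec Y V\<^esub>) \<odot>\<^bsub>pullback_sec (sec Y V) (msec F V)\<^esub> extend_module V (conn F V (pz V) m)"
    by (simp add: pull_def)
  moreover have "nabla_\<rho> F V (extend_module V m) = (snd (extend_module V m), \<zero>\<^bsub>msec F V\<^esub>)"
    by (simp add: nabla_\<rho>_def case_prod_beta)
  ultimately have nt: "nabla_\<rho> F V (extend_module V m) \<ominus>\<^bsub>msec P V\<^esub>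
      (pull Y V (\<theta>_on V) \<odot>\<^bsub>msec P V\<^esub> extend_module V (conn F V (pz V) m)) =
      extend_module V (conn F V (pt V) m)"
    using M.extend_nt[OF m] by simp
  have "conn P V v (extend_module V m) =
      (Psi Y z \<theta> V (w V (z_on V)) \<odot>\<^bsub>msec P V\<^esub> extend_module V (conn F V (pz V) m)) \<oplus>\<^bsub>msec P V\<^esub>
      (Psi Y z \<theta> V (w V (\<theta>_on V)) \<odot>\<^bsub>msec P V\<^esub> extend_module V (conn F V (pt V) m))"
    unfolding conn_lift[OF V v M.extend_horizontal[OF m]] nz nt u \<rho> ..
  also have "\<dots> = extend_module V ((w V (z_on V) \<odot>\<^bsub>msec F V\<^esub> conn F V (pz V) m) \<oplus>\<^bsub>msec F V\<^esub>
      (w V (\<theta>_on V) \<odot>\<^bsub>msec F V\<^esub> conn F V (pt V) m))"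
    using M.extend_add[OF M.smult_closed[OF w_c(1) M.Z.op_closed[OF m]]
        M.smult_closed[OF w_c(2) M.T.op_closed[OF m]]]
    by (simp only: smult[OF w_c(1) M.Z.op_closed[OF m]] smult[OF w_c(2) M.T.op_closed[OF m]])
      (simp only: pullback_simps)
  also have "\<dots> = extend_module V (conn F V w m)"
    by (simp add: conn_expansion[OF V w m])
  finally show ?thesis .
qed

end

lemma transform_simps [simp]:
  "carrier (msec (transform Y z \<theta> F) V) = transform_sections Y z \<theta> F V"
  "add (msec (transform Y z \<theta> F) V) = add (pullback_sec (sec Y V) (msec F V))"
  "zero (msec (transform Y z \<theta> F) V) = zero (pullback_sec (sec Y V) (msec F V))"
  "smult (msec (transform Y z \<theta> F) V) = smult (pullback_sec (sec Y V) (msec F V))"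
  "mgr (msec (transform Y z \<theta> F) V) p =
    mgr (pullback_sec (sec Y V) (msec F V)) p \<inter> transform_sections Y z \<theta> F V"
  "mres (transform Y z \<theta> F) = mres (pullback Y z \<theta> F)"
  by (simp_all add: transform_def Let_def)

lemma regard_on_dual_simps [simp]:
  "carrier (msec (regard_on_dual Y z \<theta> F) V) = carrier (msec F V)"
  "add (msec (regard_on_dual Y z \<theta> F) V) = add (msec F V)"
  "zero (msec (regard_on_dual Y z \<theta> F) V) = zero (msec F V)"
  "mgr (msec (regard_on_dual Y z \<theta> F) V) = mgr (msec F V)"
  "f \<odot>\<^bsub>msec (regard_on_dual Y z \<theta> F) V\<^esub> m =
    inv_into (carrier (sec Y V)) (Psi Y z \<theta> V) f \<odot>\<^bsub>msec F V\<^esub> m"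
  "mres (regard_on_dual Y z \<theta> F) = mres F"
  by (simp_all add: regard_on_dual_def Let_def)

context coordinate_patch
begin

text \<open>The lift is \<open>w(u) \<partial>\<^sub>z + w(\<rho>) (\<partial>\<^sub>\<rho> - \<theta> \<partial>\<^sub>z)\<close>. That it agrees with \<open>w\<close> on functions of the dual curve is
  the computation of \<open>\<nabla>\<^sub>w\<close> on the transform in the case \<open>\<F> = \<O>\<close>.\<close>

lemma lift_exists:
  assumes V: "V \<in> opens Y (whole Y)" and w: "w \<in> vf (dual_curve Y z \<theta>) V q"
  obtains v where "v \<in> lifts Y z \<theta> V q w"
proof -
  interpret D: super_presheaf "Delta Y" by (rule presheaf_Delta)
  have VD: "V \<in> opens (Delta Y) (whole (Delta Y))" using V by simp
  note f = Delta_fields[OF V]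
  define T where "T = dual.pull_vf V w"
  have T: "T \<in> vf Y V q" unfolding T_def by (rule dual.pull_vf_vf[OF V w])
  interpret V: supercommutative "sec Y V" by (rule sections[OF V])
  interpret DV: supercommutative "Delta_sec (sec Y V)" by (rule V.supercommutative_Delta)
  let ?a = "Psi Y z \<theta> V (T V (z_on V))" and ?b = "Psi Y z \<theta> V (T V (\<theta>_on V))"
  let ?t = "\<ominus>\<^bsub>Delta_sec (sec Y V)\<^esub> pull Y V (\<theta>_on V)"
  have a: "?a \<in> gr (sec (Delta Y) V) q" and b: "?b \<in> gr (sec (Delta Y) V) (\<not> q)"
    using dual.\<Psi>_gr[OF V, of q] dual.\<Psi>_gr[OF V, of "\<not> q"] vf_expansion(1,2)[OF V T] by auto
  have "pull Y V (\<theta>_on V) \<in> gr (Delta_sec (sec Y V)) True"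
    using \<theta>_on_gr[OF V] V.gr_zero by (simp add: pull_def)
  then have t: "?t \<in> gr (sec (Delta Y) V) True"
    using DV.gr_neg by (simp del: Delta_sec_simps)
  define L where "L = vf_add (Delta Y) V (\<rho>_field V) (vf_smult (Delta Y) V ?t (z_field V))"
  define v where "v = vf_add (Delta Y) V (vf_smult (Delta Y) V ?a (z_field V)) (vf_smult (Delta Y) V ?b L)"
  have "L \<in> vf (Delta Y) V True"
    unfolding L_def by (rule D.vf_add_vf[OF VD f(3)]) (use D.vf_smult_vf[OF VD t f(1)] in simp)
  then have v: "v \<in> vf (Delta Y) V q"
    unfolding v_def using D.vf_smult_vf[OF VD a f(1)] D.vf_smult_vf[OF VD b, of L True]
    by (intro D.vf_add_vf[OF VD]) simp_all
  have "v W s = w W s" if W: "W \<in> opens Y V" and s: "s \<in> dual_sections Y z \<theta> W" for W s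
  proof -
    note W' = opens_trans[OF V W]
    interpret S: odd_plane "sec Y W" "regular_module (sec Y W)" "pz W W" "pz W W" "pt W W" "pt W W" "\<theta>_on W"
      by (rule odd_plane_sections[OF W'])
    interpret DW: supercommutative "Delta_sec (sec Y W)" by (rule S.supercommutative_Delta)
    obtain h where h: "h \<in> carrier (sec Y W)" "s = Psi Y z \<theta> W h"
      using dual.\<Psi>_surj[OF W', of s] s by auto
    have TW: "vf_res Y W T \<in> vf Y W q" "vf_res Y W T W = T W"
      using vf_res_vf[OF V W T] opens_self[OF W] by (simp_all add: vf_res_def)
    have T_res: "res Y V W (T V (z_on V)) = T W (z_on W)" "res Y V W (T V (\<theta>_on V)) = T W (\<theta>_on W)"
      using vf_res_section[OF V T opens_self[OF V] W] coordinates_closed[OF V] coordinates_res[OF V W]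
      by simp_all
    have T_c: "T W (z_on W) \<in> carrier (sec Y W)" "T W (\<theta>_on W) \<in> carrier (sec Y W)"
      using vf_expansion(1,2)[OF W' TW(1)] TW(2) S.gr_carrier by auto
    have T_V: "T V (z_on V) \<in> carrier (sec Y V)" "T V (\<theta>_on V) \<in> carrier (sec Y V)"
      using vf_expansion(1,2)[OF V T] V.gr_carrier by auto
    have res: "res (Delta Y) V W ?a = Psi Y z \<theta> W (T W (z_on W))"
      "res (Delta Y) V W ?b = Psi Y z \<theta> W (T W (\<theta>_on W))"
      using dual.\<Psi>_res[OF V W T_V(1)] dual.\<Psi>_res[OF V W T_V(2)] T_res by simp_all
    have pull_c: "pull Y W (\<theta>_on W) \<in> carrier (Delta_sec (sec Y W))"
      using coordinates_closed[OF W'] by (simp add: pull_def)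
    have res_t: "res (Delta Y) V W ?t = \<ominus>\<^bsub>Delta_sec (sec Y W)\<^esub> pull Y W (\<theta>_on W)"
      using coordinates_closed[OF V] coordinates_closed[OF W']
      by (simp add: pull_def V.Delta_neg S.Delta_neg res_neg[OF V W] res_zero[OF V W] coordinates_res[OF V W])
    have cl: "Psi Y z \<theta> W g \<in> carrier (Delta_sec (sec Y W))" if "g \<in> carrier (sec Y W)" for g
      using dual.\<Psi>_closed[OF W' that] by (simp add: dual_sections_def)
    note hz = S.Z.d_closed[OF h(1)] and ht = S.T.d_closed[OF h(1)]
    have s_c: "s \<in> carrier (Delta_sec (sec Y W))" using cl[OF h(1)] h(2) by simp
    have z_s: "z_field V W s = Psi Y z \<theta> W (pz W W h)"
      using W cl[OF h(1)] S.extend_nz[of h] h hz by (simp add: z_field_def Psi_eq[OF W'])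
    have "L W s = (snd s, \<zero>\<^bsub>sec Y W\<^esub>) \<ominus>\<^bsub>Delta_sec (sec Y W)\<^esub>
        (pull Y W (\<theta>_on W) \<otimes>\<^bsub>Delta_sec (sec Y W)\<^esub> Psi Y z \<theta> W (pz W W h))"
      using W s_c DW.l_minus[OF pull_c cl[OF hz]]
      by (simp add: L_def vf_add_def vf_smult_def \<rho>_field_def z_s a_minus_def case_prod_beta res_t
        del: Delta_sec_simps Delta_simps(4))
    also have "\<dots> = Psi Y z \<theta> W (pt W W h)"
      using S.extend_nt[of h] h hz ht by (simp add: Psi_eq[OF W'] pull_def pullback_regular a_minus_def
        a_inv_cong[of "pullback_sec (sec Y W) (regular_module (sec Y W))" "Delta_sec (sec Y W)"]
        del: Delta_sec_simps(2,5) pullback_sec_simps(3,4))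
    finally have L_s: "L W s = Psi Y z \<theta> W (pt W W h)" .
    have "v W s = (Psi Y z \<theta> W (T W (z_on W)) \<otimes>\<^bsub>Delta_sec (sec Y W)\<^esub> Psi Y z \<theta> W (pz W W h))
        \<oplus>\<^bsub>Delta_sec (sec Y W)\<^esub>
        (Psi Y z \<theta> W (T W (\<theta>_on W)) \<otimes>\<^bsub>Delta_sec (sec Y W)\<^esub> Psi Y z \<theta> W (pt W W h))"
      using W s_c by (simp add: v_def vf_add_def vf_smult_def z_s L_s res
        del: Delta_sec_simps Delta_simps(4))
    also have "\<dots> = Psi Y z \<theta> W (T W h)"
      using vf_value[OF W' TW(1) h(1)] T_c hz ht dual.\<Psi>_add[OF W'] dual.\<Psi>_mult[OF W']
      by (simp add: TW(2) del: Delta_sec_simps)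
    also have "\<dots> = w W s"
      using dual.pull_vf_apply(2)[OF V w W h(1)] h(2) by (simp add: T_def)
    finally show ?thesis .
  qed
  then have "v \<in> lifts Y z \<theta> V q w" using v by (simp add: lifts_def)
  then show thesis by (rule that)
qed

end

context patch_dmodule
begin

text \<open>The section in the definition of the connection is unique because a lift exists over the whole of
  \<open>V\<close>, and it has the required restrictions because lifts over smaller sets, of whichever parity, act
  through the values of \<open>w\<close> on \<open>u\<close> and \<open>\<rho>\<close>.\<close>

lemma conn_transform:
  assumes V: "V \<in> opens Y (whole Y)" and w: "w \<in> vf (dual_curve Y z \<theta>) V q"
    and m: "m \<in> carrier (msec F V)"
  shows "conn (transform Y z \<theta> F) V w (extend_module V m) =
    extend_module V (conn F V (dual.pull_vf V w) m)"
proof -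
  let ?T = "dual.pull_vf V w"
  note T = dual.pull_vf_vf[OF V w]
  let ?t = "extend_module V (conn F V ?T m)"
  interpret odd_plane "sec Y V" "msec F V" "pz V V" "conn F V (pz V)" "pt V V" "conn F V (pt V)" "\<theta>_on V"
    by (rule odd_plane_module[OF V])
  interpret T: super_operator "sec Y V" "msec F V" q "?T V" "conn F V ?T"
    by (rule conn_operator[OF V T])
  have lift: "conn P W v (mres P V W (extend_module V m)) = mres P V W ?t"
    if W: "W \<in> opens Y V" and v: "v \<in> lifts Y z \<theta> W p w" for W p v
  proof -
    note W' = opens_trans[OF V W]
    have TW: "vf_res Y W ?T \<in> vf Y W q" "vf_res Y W ?T W = ?T W"
      using vf_res_vf[OF V W T] opens_self[OF W] by (simp_all add: vf_res_def)
    have v_vf: "v \<in> vf (Delta Y) W p" and v_w: "\<And>s. s \<in> dual_sections Y z \<theta> W \<Longrightarrow> v W s = w W s"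
      using v opens_self[OF W] by (auto simp: lifts_def)
    have "v W (u_coord Y z \<theta> W) = Psi Y z \<theta> W (vf_res Y W ?T W (z_on W))"
      "v W (rho Y W) = Psi Y z \<theta> W (vf_res Y W ?T W (\<theta>_on W))"
      using dual.pull_vf_apply(2)[OF V w W] coordinates_closed[OF W'] dual_closed[OF W'] v_w
      by (simp_all add: TW(2) u_coord_eq(2)[OF W'] Psi_\<theta>[OF W'])
    then have "conn P W v (extend_module W (mres F V W m)) =
        extend_module W (conn F W (vf_res Y W ?T) (mres F V W m))"
      by (rule conn_extend[OF W' v_vf TW(1) _ _ mres_closed[OF V W m]])
    then show ?thesis
      by (simp only: extend_module_res[OF V W m] extend_module_res[OF V W T.op_closed[OF m]]
        conn_res[OF V T W m])
  qed
  obtain v where v: "v \<in> lifts Y z \<theta> V q w" by (rule lift_exists[OF V w])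
  have closed: "extend_module V n \<in> carrier (msec P V)" if "n \<in> carrier (msec F V)" for n
    using extend_horizontal[OF that] by (simp add: horizontal_def)
  have mres_P_id: "mres P V V s = s" if "s \<in> carrier (msec P V)" for s
    using that by (cases s) (simp add: mres_id[OF V])
  have "conn (transform Y z \<theta> F) V w (extend_module V m) = (THE t. t \<in> carrier (msec P V) \<and>
      (\<forall>W\<in>opens Y V. \<forall>p. \<forall>v\<in>lifts Y z \<theta> W p w.
        mres P V W t = conn P W v (mres P V W (extend_module V m))))"
    by (simp add: transform_def Let_def)
  also have "\<dots> = ?t"
  proof (rule the_equality)
    show "?t \<in> carrier (msec P V) \<and> (\<forall>W\<in>opens Y V. \<forall>p. \<forall>v\<in>lifts Y z \<theta> W p w.
        mres P V W ?t = conn P W v (mres P V W (extend_module V m)))"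
      using closed[OF T.op_closed[OF m]] lift by simp
    fix t assume t: "t \<in> carrier (msec P V) \<and> (\<forall>W\<in>opens Y V. \<forall>p. \<forall>v\<in>lifts Y z \<theta> W p w.
        mres P V W t = conn P W v (mres P V W (extend_module V m)))"
    then have "mres P V V t = conn P V v (mres P V V (extend_module V m))"
      using opens_self[OF V] v by blast
    also have "\<dots> = mres P V V ?t" by (rule lift[OF opens_self[OF V] v])
    finally show "t = ?t" using mres_P_id t closed[OF T.op_closed[OF m]] by metis
  qed
  finally show ?thesis .
qed

text \<open>The action \<open>\<Psi>\<^sup>-\<^sup>1(w(u)) \<nabla>\<^sub>z + \<Psi>\<^sup>-\<^sup>1(w(\<rho>)) \<nabla>\<^sub>\<theta>\<close> is the contraction with \<open>w\<close> conjugated by \<open>\<Psi>\<close>, whose values on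
  \<open>z\<close> and \<open>\<theta>\<close> are these coefficients because \<open>\<Psi>\<close> maps \<open>z\<close>, \<open>\<theta>\<close> to \<open>u\<close>, \<open>\<rho>\<close>.\<close>

lemma transport_regard:
  "dmodule_transport Y (dual_curve Y z \<theta>) (Psi Y z \<theta>) F (regard_on_dual Y z \<theta> F) (\<lambda>V m. m)"
proof unfold_locales
  fix V assume V: "V \<in> opens Y (whole Y)"
  interpret supermodule "sec Y V" "msec F V" by (rule supermodule_sections[OF V])
  show "bij_betw (\<lambda>m. m) (carrier (msec F V)) (carrier (msec (regard_on_dual Y z \<theta> F) V))"
    by (simp add: bij_betw_def)
  show "f \<odot>\<^bsub>msec F V\<^esub> m = Psi Y z \<theta> V f \<odot>\<^bsub>msec (regard_on_dual Y z \<theta> F) V\<^esub> m"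
    if "f \<in> carrier (sec Y V)" for f m
    using that by (simp add: dual.\<Psi>_inv[OF V])
  fix w p m assume w: "w \<in> vf (dual_curve Y z \<theta>) V p" and m: "m \<in> carrier (msec F V)"
  have "dual.pull_vf V w V a = inv_into (carrier (sec Y V)) (Psi Y z \<theta> V) (w V (Psi Y z \<theta> V a))"
    if "a \<in> carrier (sec Y V)" for a
    using that opens_self[OF V] by (simp add: dual.pull_vf_def)
  then show "conn (regard_on_dual Y z \<theta> F) V w m = conn F V (dual.pull_vf V w) m"
    using conn_expansion[OF V dual.pull_vf_vf[OF V w] m] coordinates_closed[OF V]
    by (simp add: regard_on_dual_def Let_def u_coord_eq(2)[OF V] Psi_\<theta>[OF V])
qed simp_all

lemma transport_transform:
  "dmodule_transport Y (dual_curve Y z \<theta>) (Psi Y z \<theta>) F (transform Y z \<theta> F) extend_module"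
proof unfold_locales
  fix V assume V: "V \<in> opens Y (whole Y)"
  interpret M: odd_plane "sec Y V" "msec F V" "pz V V" "conn F V (pz V)" "pt V V" "conn F V (pt V)" "\<theta>_on V"
    by (rule odd_plane_module[OF V])
  interpret S: odd_plane "sec Y V" "regular_module (sec Y V)" "pz V V" "pz V V" "pt V V" "pt V V" "\<theta>_on V"
    by (rule odd_plane_sections[OF V])
  show "bij_betw (extend_module V) (carrier (msec F V)) (carrier (msec (transform Y z \<theta> F) V))"
    using M.bij_extend by (simp add: transform_sections_eq[OF V])
  show "extend_module V \<zero>\<^bsub>msec F V\<^esub> = \<zero>\<^bsub>msec (transform Y z \<theta> F) V\<^esub>"
    using M.extend_zero by simp
  show "extend_module V ` mgr (msec F V) p = mgr (msec (transform Y z \<theta> F) V) p" for p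
    using M.extend_gr_image[of p] by (simp add: transform_sections_eq[OF V])
  show "extend_module V (m \<oplus>\<^bsub>msec F V\<^esub> n) = extend_module V m \<oplus>\<^bsub>msec (transform Y z \<theta> F) V\<^esub> extend_module V n"
    if "m \<in> carrier (msec F V)" "n \<in> carrier (msec F V)" for m n
    using M.extend_add[OF that] by simp
  show "extend_module V (f \<odot>\<^bsub>msec F V\<^esub> m) = Psi Y z \<theta> V f \<odot>\<^bsub>msec (transform Y z \<theta> F) V\<^esub> extend_module V m"
    if f: "f \<in> carrier (sec Y V)" and m: "m \<in> carrier (msec F V)" for f m
    using extend_module_smult[OF V f m] by simp
  show "conn (transform Y z \<theta> F) V w (extend_module V m) = extend_module V (conn F V (dual.pull_vf V w) m)"
    if "w \<in> vf (dual_curve Y z \<theta>) V p" "m \<in> carrier (msec F V)" for w p m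
    by (rule conn_transform[OF V that])
  show "mres (transform Y z \<theta> F) V W (extend_module V m) = extend_module W (mres F V W m)"
    if "W \<in> opens Y V" "m \<in> carrier (msec F V)" for W m
    using extend_module_res[OF V that] by simp
qed

text \<open>Both modules are images of \<open>\<F>\<close> under transport along \<open>\<Psi>\<close>, by the identity and by \<open>\<tau>\<close>, so \<open>\<tau>\<close> is an
  isomorphism between them.\<close>

lemma tau_isomorphism:
  "dmodule_iso (dual_curve Y z \<theta>) (regard_on_dual Y z \<theta> F) (transform Y z \<theta> F)
     (\<lambda>V m. tau Y z \<theta> F V (incl F V m))"
proof -
  interpret R: dmodule_transport Y "dual_curve Y z \<theta>" "Psi Y z \<theta>" F "regard_on_dual Y z \<theta> F" "\<lambda>V m. m"
    by (rule transport_regard)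
  interpret T: dmodule_transport Y "dual_curve Y z \<theta>" "Psi Y z \<theta>" F "transform Y z \<theta> F" extend_module
    by (rule transport_transform)
  show ?thesis
    unfolding dmodule_iso_def
  proof (intro conjI ballI allI)
    show "dmodule (dual_curve Y z \<theta>) (regard_on_dual Y z \<theta> F)" by (rule R.dmodule_N)
    show "dmodule (dual_curve Y z \<theta>) (transform Y z \<theta> F)" by (rule T.dmodule_N)
    fix V assume "V \<in> opens (dual_curve Y z \<theta>) (whole (dual_curve Y z \<theta>))"
    then have V: "V \<in> opens Y (whole Y)" by simp
    interpret supermodule "sec Y V" "msec F V" by (rule supermodule_sections[OF V])
    note tau = tau_incl[OF V]
    show "bij_betw (\<lambda>m. tau Y z \<theta> F V (incl F V m)) (carrier (msec (regard_on_dual Y z \<theta> F) V))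
        (carrier (msec (transform Y z \<theta> F) V))"
      using T.\<phi>_bij[OF V] bij_betw_cong[of "carrier (msec F V)" _ "extend_module V", OF tau] by simp
    show "tau Y z \<theta> F V (incl F V m) \<in> mgr (msec (transform Y z \<theta> F) V) p"
      if "m \<in> mgr (msec (regard_on_dual Y z \<theta> F) V) p" for p m
      using that T.\<phi>_gr[OF V, of p] tau M.gr_carrier by auto
    fix m assume "m \<in> carrier (msec (regard_on_dual Y z \<theta> F) V)"
    then have m: "m \<in> carrier (msec F V)" by simp
    show "tau Y z \<theta> F V (incl F V (m \<oplus>\<^bsub>msec (regard_on_dual Y z \<theta> F) V\<^esub> n)) =
        tau Y z \<theta> F V (incl F V m) \<oplus>\<^bsub>msec (transform Y z \<theta> F) V\<^esub> tau Y z \<theta> F V (incl F V n)"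
      if "n \<in> carrier (msec (regard_on_dual Y z \<theta> F) V)" for n
      using that m T.\<phi>_add[OF V m, of n] by (simp add: tau)
  next
    fix V f m assume "V \<in> opens (dual_curve Y z \<theta>) (whole (dual_curve Y z \<theta>))"
      and f: "f \<in> carrier (sec (dual_curve Y z \<theta>) V)"
      and m: "m \<in> carrier (msec (regard_on_dual Y z \<theta> F) V)"
    then have V: "V \<in> opens Y (whole Y)" by simp
    interpret supermodule "sec Y V" "msec F V" by (rule supermodule_sections[OF V])
    obtain g where g: "g \<in> carrier (sec Y V)" "f = Psi Y z \<theta> V g" using dual.\<Psi>_surj[OF V f] .
    show "tau Y z \<theta> F V (incl F V (f \<odot>\<^bsub>msec (regard_on_dual Y z \<theta> F) V\<^esub> m)) =
        f \<odot>\<^bsub>msec (transform Y z \<theta> F) V\<^esub> tau Y z \<theta> F V (incl F V m)"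
      using m g T.\<phi>_smult[OF V g(1), of m] by (simp add: tau_incl[OF V] dual.\<Psi>_inv[OF V] smult_closed)
  next
    fix V p w m assume "V \<in> opens (dual_curve Y z \<theta>) (whole (dual_curve Y z \<theta>))"
      and w: "w \<in> vf (dual_curve Y z \<theta>) V p"
      and m: "m \<in> carrier (msec (regard_on_dual Y z \<theta> F) V)"
    then have V: "V \<in> opens Y (whole Y)" and m': "m \<in> carrier (msec F V)" by simp_all
    interpret super_operator "sec Y V" "msec F V" p "dual.pull_vf V w V" "conn F V (dual.pull_vf V w)"
      by (rule conn_operator[OF V dual.pull_vf_vf[OF V w]])
    show "tau Y z \<theta> F V (incl F V (conn (regard_on_dual Y z \<theta> F) V w m)) =
        conn (transform Y z \<theta> F) V w (tau Y z \<theta> F V (incl F V m))"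
      using R.\<phi>_conn[OF V w m'] T.\<phi>_conn[OF V w m'] m' by (simp add: tau_incl[OF V] op_closed)
  next
    fix V W m assume "V \<in> opens (dual_curve Y z \<theta>) (whole (dual_curve Y z \<theta>))"
      and "W \<in> opens (dual_curve Y z \<theta>) V" and m: "m \<in> carrier (msec (regard_on_dual Y z \<theta> F) V)"
    then have V: "V \<in> opens Y (whole Y)" and W: "W \<in> opens Y V" and m': "m \<in> carrier (msec F V)"
      by simp_all
    show "mres (transform Y z \<theta> F) V W (tau Y z \<theta> F V (incl F V m)) =
        tau Y z \<theta> F W (incl F W (mres (regard_on_dual Y z \<theta> F) V W m))"
      using T.\<phi>_res[OF V W m'] mres_closed[OF V W m']
      by (simp add: tau_incl[OF V m'] tau_incl[OF opens_trans[OF V W]])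
  qed
qed

end

section \<open>Coordinate patches of a supercurve\<close>

lemma open_subspace_opens:
  assumes "openin (tp X) U"
  shows "V \<in> opens (open_subspace X U) (whole (open_subspace X U)) \<Longrightarrow> V \<in> opens X (whole X)"
    and "W \<in> opens (open_subspace X U) V \<Longrightarrow> W \<in> opens X V"
  using assms by (auto simp: opens_def open_subspace_def openin_open_subtopology openin_subset)

lemma (in super_presheaf) presheaf_open_subspace:
  assumes "openin (tp Y) U"
  shows "super_presheaf (open_subspace Y U)"
proof -
  note o = open_subspace_opens[OF assms]
  have [simp]: "base (open_subspace Y U) = base Y" "sec (open_subspace Y U) = sec Y"
    "res (open_subspace Y U) = res Y" "alg (open_subspace Y U) = alg Y"
    by (simp_all add: open_subspace_def)
  show ?thesis
  proof
    fix V assume "V \<in> opens (open_subspace Y U) (whole (open_subspace Y U))"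
    then have V: "V \<in> opens Y (whole Y)" by (rule o)
    show "supercommutative_ring (sec (open_subspace Y U) V)"
      using sections[OF V] by (simp add: supercommutative_def)
  qed (use o res_gr res_add res_mult res_one res_id res_res alg_closed in simp_all)
qed

text \<open>The base contains the constant \<open>1/2\<close>.\<close>

lemma supercurve_half:
  assumes "supercurve \<Lambda> X" and V: "V \<in> opens X (whole X)"
  shows "\<exists>h\<in>carrier (sec X V). h \<oplus>\<^bsub>sec X V\<^esub> h = \<one>\<^bsub>sec X V\<^esub>"
proof -
  have L: "nilpotent_extension \<Lambda>" and b: "base X = \<Lambda>" and X: "superspace X"
    using assms(1) by (simp_all add: supercurve_def)
  have hom: "alg X V \<in> ring_hom \<Lambda> (sec X V)"
    using X V b by (auto simp: superspace_def super_ring_hom_def)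
  interpret supercommutative "sec X V"
    using superspace_presheaf[OF X] V by (rule super_presheaf.sections)
  have gL: "graded_abelian_group \<Lambda> (gr \<Lambda>)"
    using L by (simp add: nilpotent_extension_def supercommutative_ring_def graded_group_iff)
  let ?c = "cst \<Lambda> (1/2)"
  have c: "?c \<in> carrier \<Lambda>"
    using L graded_abelian_group.gr_carrier[OF gL] by (auto simp: nilpotent_extension_def)
  have "cst \<Lambda> (1/2 + 1/2) = ?c \<oplus>\<^bsub>\<Lambda>\<^esub> ?c" "cst \<Lambda> 1 = \<one>\<^bsub>\<Lambda>\<^esub>"
    using L unfolding nilpotent_extension_def by blast+
  then have "?c \<oplus>\<^bsub>\<Lambda>\<^esub> ?c = \<one>\<^bsub>\<Lambda>\<^esub>" by simp
  then have "alg X V ?c \<oplus>\<^bsub>sec X V\<^esub> alg X V ?c = \<one>\<^bsub>sec X V\<^esub>"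
    using ring_hom_add[OF hom c c] ring_hom_one[OF hom] by simp
  then show ?thesis using ring_hom_closed[OF hom c] by blast
qed

theorem theorem9:
  fixes \<Lambda> :: "'l super_calgebra"
    and X :: "('x, 'a, 'l) superspace"
    and U :: "'x set"
    and z \<theta> :: 'a
    and \<F> :: "('x, 'a, 'b) dmod"
  assumes "supercurve \<Lambda> X"
    and "openin (tp X) U"
    and "coordinates (open_subspace X U) z \<theta>"
    and "dmodule (open_subspace X U) \<F>"
  shows "dmodule_iso (dual_curve (open_subspace X U) z \<theta>)
           (regard_on_dual (open_subspace X U) z \<theta> \<F>)
           (transform (open_subspace X U) z \<theta> \<F>)
           (\<lambda>V m. tau (open_subspace X U) z \<theta> \<F> V (incl \<F> V m))"
proof -
  have "super_presheaf X"
    using assms(1) by (simp add: supercurve_def superspace_presheaf)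
  then interpret super_presheaf "open_subspace X U"
    using assms(2) by (rule super_presheaf.presheaf_open_subspace)
  interpret patch_dmodule "open_subspace X U" z \<theta> \<F>
  proof
    show "coordinates (open_subspace X U) z \<theta>" "dmodule (open_subspace X U) \<F>" by fact+
    fix V assume "V \<in> opens (open_subspace X U) (whole (open_subspace X U))"
    then have "V \<in> opens X (whole X)" by (rule open_subspace_opens(1)[OF assms(2)])
    then show "\<exists>h\<in>carrier (sec (open_subspace X U) V).
        h \<oplus>\<^bsub>sec (open_subspace X U) V\<^esub> h = \<one>\<^bsub>sec (open_subspace X U) V\<^esub>"
      using supercurve_half[OF assms(1)] by (simp add: open_subspace_def)
  qed
  show ?thesis by (rule tau_isomorphism)
qed

end
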